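(* Let $P\cong\mathbb{N}^k\times\mathbb{Z}_2^l$, let $\Lambda$ be a row-finite $P$-graph with no sources, let $\delta:\Lambda\to\mathbb{Z}_2$ be a functor and let $c$ be a $\mathbb{T}$-valued $2$-cocycle on $\Lambda$. Then there is a grading automorphism $\alpha_\delta$ of $C^*(\Lambda,c)$ such that $$\alpha_\delta(s_\lambda)=(-1)^{\delta(\lambda)}s_\lambda\quad\text{for all }\lambda\in\Lambda.$$ For $i\in\mathbb{Z}_2$, we have $C^*(\Lambda,c)_i=\overline{\operatorname{span}}\{s_\mu s_\nu^*:\delta(\mu)-\delta(\nu)=i\}$.
   Context: A $P$-graph is a countable small category $\Lambda$ with a functor $d:\Lambda\to P$ satisfying the factorisation property: if $d(\lambda)=p+q$ then there are unique $\mu,\nu\in\Lambda$ with $d(\mu)=p$, $d(\nu)=q$, $\lambda=\mu\nu$. $r,s$ are the codomain and domain maps, $\Lambda^p=d^{-1}(p)$, $\Lambda^0$ is identified with the objects, $v\Lambda^p=\{\lambda\in\Lambda^p:r(\lambda)=v\}$. $\Lambda$ is row-finite (has no sources) if every $v\Lambda^p$ is finite (nonempty). A $\mathbb{T}$-valued $2$-cocycle is a function $c$ from composable pairs to $\mathbb{T}$ with $c(\lambda,\mu)c(\lambda\mu,\nu)=c(\mu,\nu)c(\lambda,\mu\nu)$ and $c(r(\lambda),\lambda)=1=c(\lambda,s(\lambda))$. $C^*(\Lambda,c)$ is the universal $C^*$-algebra generated by elements $s_\lambda$ ($\lambda\in\Lambda$) such that: $\{s_v:v\in\Lambda^0\}$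 are mutually orthogonal projections; $s_\mu s_\nu=c(\mu,\nu)s_{\mu\nu}$ when $s(\mu)=r(\nu)$; $s_\lambda^*s_\lambda=s_{s(\lambda)}$; $s_v=\sum_{\lambda\in v\Lambda^p}s_\lambda s_\lambda^*$ for $v\in\Lambda^0,p\in P$. A grading automorphism $\alpha$ of a $C^*$-algebra $A$ is one with $\alpha^2=1$; $A_0=\{a:\alpha(a)=a\}$, $A_1=\{a:\alpha(a)=-a\}$. A functor to $\mathbb{Z}_2$ is a map with $\delta(\lambda\mu)=\delta(\lambda)+\delta(\mu)$ for composable pairs (and $\delta=0$ on objects). *)

theory Defs
  imports
    "HOL-Analysis.Analysis"
    "HOL-Algebra.Module"
    "HOL-Library.Poly_Mapping"
    "HOL-Library.Z2"
begin

section \<open>C*-algebras and gradings\<close>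

text \<open>
  Algebras are not assumed unital: the field \<open>one\<close> inherited from the \<open>module\<close> record is
  never used. It is filled with the zero element in the constructions below.
\<close>

record 'a star_algebra = "(complex, 'a) module" +
  adj :: "'a \<Rightarrow> 'a"
  nrm :: "'a \<Rightarrow> real"

locale cstar_algebra = abelian_group A for A :: "'a star_algebra" (structure) +
  assumes m_closed: "\<lbrakk>a \<in> carrier A; b \<in> carrier A\<rbrakk> \<Longrightarrow> a \<otimes> b \<in> carrier A"
    and m_assoc: "\<lbrakk>a \<in> carrier A; b \<in> carrier A; e \<in> carrier A\<rbrakk>
      \<Longrightarrow> (a \<otimes> b) \<otimes> e = a \<otimes> (b \<otimes> e)"
    and l_distr: "\<lbrakk>a \<in> carrier A; b \<in> carrier A; e \<in> carrier A\<rbrakk>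
      \<Longrightarrow> (a \<oplus> b) \<otimes> e = a \<otimes> e \<oplus> b \<otimes> e"
    and r_distr: "\<lbrakk>a \<in> carrier A; b \<in> carrier A; e \<in> carrier A\<rbrakk>
      \<Longrightarrow> e \<otimes> (a \<oplus> b) = e \<otimes> a \<oplus> e \<otimes> b"
    and smult_closed: "a \<in> carrier A \<Longrightarrow> z \<odot> a \<in> carrier A"
    and smult_l_distr: "a \<in> carrier A \<Longrightarrow> (z + w) \<odot> a = z \<odot> a \<oplus> w \<odot> a"
    and smult_r_distr: "\<lbrakk>a \<in> carrier A; b \<in> carrier A\<rbrakk> \<Longrightarrow> z \<odot> (a \<oplus> b) = z \<odot> a \<oplus> z \<odot> b"
    and smult_assoc: "a \<in> carrier A \<Longrightarrow> (z * w) \<odot> a = z \<odot> (w \<odot> a)"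
    and smult_one: "a \<in> carrier A \<Longrightarrow> 1 \<odot> a = a"
    and smult_mult_l: "\<lbrakk>a \<in> carrier A; b \<in> carrier A\<rbrakk> \<Longrightarrow> (z \<odot> a) \<otimes> b = z \<odot> (a \<otimes> b)"
    and smult_mult_r: "\<lbrakk>a \<in> carrier A; b \<in> carrier A\<rbrakk> \<Longrightarrow> a \<otimes> (z \<odot> b) = z \<odot> (a \<otimes> b)"
    and adj_closed: "a \<in> carrier A \<Longrightarrow> adj A a \<in> carrier A"
    and adj_adj: "a \<in> carrier A \<Longrightarrow> adj A (adj A a) = a"
    and adj_add: "\<lbrakk>a \<in> carrier A; b \<in> carrier A\<rbrakk> \<Longrightarrow> adj A (a \<oplus> b) = adj A a \<oplus> adj A b"
    and adj_smult: "a \<in> carrier A \<Longrightarrow> adj A (z \<odot> a) = cnj z \<odot> adj A a"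
    and adj_mult: "\<lbrakk>a \<in> carrier A; b \<in> carrier A\<rbrakk> \<Longrightarrow> adj A (a \<otimes> b) = adj A b \<otimes> adj A a"
    and nrm_nonneg: "a \<in> carrier A \<Longrightarrow> 0 \<le> nrm A a"
    and nrm_eq_0: "a \<in> carrier A \<Longrightarrow> nrm A a = 0 \<longleftrightarrow> a = \<zero>"
    and nrm_triangle: "\<lbrakk>a \<in> carrier A; b \<in> carrier A\<rbrakk> \<Longrightarrow> nrm A (a \<oplus> b) \<le> nrm A a + nrm A b"
    and nrm_smult: "a \<in> carrier A \<Longrightarrow> nrm A (z \<odot> a) = cmod z * nrm A a"
    and nrm_mult: "\<lbrakk>a \<in> carrier A; b \<in> carrier A\<rbrakk> \<Longrightarrow> nrm A (a \<otimes> b) \<le> nrm A a * nrm A b"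
    and cstar_identity: "a \<in> carrier A \<Longrightarrow> nrm A (adj A a \<otimes> a) = (nrm A a)\<^sup>2"
    and nrm_complete: "\<lbrakk>\<And>n. x n \<in> carrier A;
        \<And>e. 0 < e \<Longrightarrow> \<exists>M. \<forall>m\<ge>M. \<forall>n\<ge>M. nrm A (x m \<ominus> x n) < e\<rbrakk>
      \<Longrightarrow> \<exists>a\<in>carrier A. (\<lambda>n. nrm A (x n \<ominus> a)) \<longlonglongrightarrow> 0"

locale grading_automorphism = cstar_algebra A for A :: "'a star_algebra" (structure) +
  fixes \<alpha> :: "'a \<Rightarrow> 'a"
  assumes bij: "bij_betw \<alpha> (carrier A) (carrier A)"
    and map_add: "\<lbrakk>a \<in> carrier A; b \<in> carrier A\<rbrakk> \<Longrightarrow> \<alpha> (a \<oplus> b) = \<alpha> a \<oplus> \<alpha> b"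
    and map_smult: "a \<in> carrier A \<Longrightarrow> \<alpha> (z \<odot> a) = z \<odot> \<alpha> a"
    and map_mult: "\<lbrakk>a \<in> carrier A; b \<in> carrier A\<rbrakk> \<Longrightarrow> \<alpha> (a \<otimes> b) = \<alpha> a \<otimes> \<alpha> b"
    and map_adj: "a \<in> carrier A \<Longrightarrow> \<alpha> (adj A a) = adj A (\<alpha> a)"
    and involutive: "a \<in> carrier A \<Longrightarrow> \<alpha> (\<alpha> a) = a"

definition graded_part :: "'a star_algebra \<Rightarrow> ('a \<Rightarrow> 'a) \<Rightarrow> bit \<Rightarrow> 'a set"
  where "graded_part A \<alpha> i =
    {a \<in> carrier A. \<alpha> a = (if i = 0 then a else \<ominus>\<^bsub>A\<^esub> a)}"

inductive_set lin_span :: "'a star_algebra \<Rightarrow> 'a set \<Rightarrow> 'a set"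
  for A :: "'a star_algebra" and S :: "'a set"
  where
    zero: "\<zero>\<^bsub>A\<^esub> \<in> lin_span A S"
  | base: "a \<in> S \<Longrightarrow> a \<in> lin_span A S"
  | add: "\<lbrakk>a \<in> lin_span A S; b \<in> lin_span A S\<rbrakk> \<Longrightarrow> a \<oplus>\<^bsub>A\<^esub> b \<in> lin_span A S"
  | smult: "a \<in> lin_span A S \<Longrightarrow> z \<odot>\<^bsub>A\<^esub> a \<in> lin_span A S"

definition closed_span :: "'a star_algebra \<Rightarrow> 'a set \<Rightarrow> 'a set"
  where "closed_span A S =
    {a \<in> carrier A. \<forall>e>0. \<exists>b\<in>lin_span A S. nrm A (a \<ominus>\<^bsub>A\<^esub> b) < e}"

section \<open>Completion of a seminormed *-algebra\<close>

text \<open>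
  The elements are the classes of Cauchy sequences modulo sequences whose seminorm tends to zero;
  in particular elements of seminorm zero are identified with \<open>0\<close>.
\<close>

definition cauchy_seqs :: "'a star_algebra \<Rightarrow> (nat \<Rightarrow> 'a) set"
  where "cauchy_seqs A = {x. (\<forall>n. x n \<in> carrier A) \<and>
    (\<forall>e>0. \<exists>M. \<forall>m\<ge>M. \<forall>n\<ge>M. nrm A (x m \<ominus>\<^bsub>A\<^esub> x n) < e)}"

definition seq_equiv :: "'a star_algebra \<Rightarrow> ((nat \<Rightarrow> 'a) \<times> (nat \<Rightarrow> 'a)) set"
  where "seq_equiv A = {(x, y). x \<in> cauchy_seqs A \<and> y \<in> cauchy_seqs A \<and>
    (\<lambda>n. nrm A (x n \<ominus>\<^bsub>A\<^esub> y n)) \<longlonglongrightarrow> 0}"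

definition seq_class :: "'a star_algebra \<Rightarrow> (nat \<Rightarrow> 'a) \<Rightarrow> (nat \<Rightarrow> 'a) set"
  where "seq_class A x = seq_equiv A `` {x}"

definition completion :: "'a star_algebra \<Rightarrow> (nat \<Rightarrow> 'a) set star_algebra"
  where "completion A = \<lparr>
    carrier = cauchy_seqs A // seq_equiv A,
    monoid.mult = (\<lambda>X Y. \<Union>x\<in>X. \<Union>y\<in>Y. seq_class A (\<lambda>n. x n \<otimes>\<^bsub>A\<^esub> y n)),
    one = seq_class A (\<lambda>n. \<zero>\<^bsub>A\<^esub>),
    zero = seq_class A (\<lambda>n. \<zero>\<^bsub>A\<^esub>),
    add = (\<lambda>X Y. \<Union>x\<in>X. \<Union>y\<in>Y. seq_class A (\<lambda>n. x n \<oplus>\<^bsub>A\<^esub> y n)),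
    smult = (\<lambda>z X. \<Union>x\<in>X. seq_class A (\<lambda>n. z \<odot>\<^bsub>A\<^esub> x n)),
    adj = (\<lambda>X. \<Union>x\<in>X. seq_class A (\<lambda>n. adj A (x n))),
    nrm = (\<lambda>X. THE t. \<forall>x\<in>X. (\<lambda>n. nrm A (x n)) \<longlonglongrightarrow> t)\<rparr>"

section \<open>Universal C*-algebras on generators and relations\<close>

text \<open>
  The free complex *-algebra on a set \<open>X\<close> consists of the finitely supported complex functions on
  the nonempty words in the letters \<open>x\<close> and \<open>x\<^sup>*\<close> with \<open>x \<in> X\<close>; its product is the
  convolution with respect to concatenation. Nonemptiness of the words keeps it non-unital.
\<close>

datatype 'x letter = Plain 'x | Star 'x

datatype 'x word = Word (letters: "'x letter list")

instantiation word :: (type) monoid_add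
begin

definition "0 = Word []"
definition "u + v = Word (letters u @ letters v)"

instance
  by standard (simp_all add: zero_word_def plus_word_def)

end

type_synonym 'x free_elt = "'x word \<Rightarrow>\<^sub>0 complex"

fun flip_letter :: "'x letter \<Rightarrow> 'x letter"
  where
    "flip_letter (Plain x) = Star x"
  | "flip_letter (Star x) = Plain x"

fun base_letter :: "'x letter \<Rightarrow> 'x"
  where
    "base_letter (Plain x) = x"
  | "base_letter (Star x) = x"

definition word_star :: "'x word \<Rightarrow> 'x word"
  where "word_star w = Word (rev (map flip_letter (letters w)))"

definition free_gen :: "'x \<Rightarrow> 'x free_elt"
  where "free_gen x = Poly_Mapping.single (Word [Plain x]) 1"

definition free_smult :: "complex \<Rightarrow> 'x free_elt \<Rightarrow> 'x free_elt"
  where "free_smult z f = Poly_Mapping.map ((*) z) f"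

definition free_star :: "'x free_elt \<Rightarrow> 'x free_elt"
  where "free_star f =
    (\<Sum>w\<in>Poly_Mapping.keys f. Poly_Mapping.single (word_star w) (cnj (Poly_Mapping.lookup f w)))"

definition free_carrier :: "'x set \<Rightarrow> 'x free_elt set"
  where "free_carrier X =
    {f. \<forall>w\<in>Poly_Mapping.keys f. letters w \<noteq> [] \<and> base_letter ` set (letters w) \<subseteq> X}"

definition cstar_seminorms :: "'x set \<Rightarrow> ('x free_elt \<Rightarrow> real) set"
  where "cstar_seminorms X = {p. \<forall>f\<in>free_carrier X.
    0 \<le> p f \<and>
    (\<forall>z. p (free_smult z f) = cmod z * p f) \<and>
    (\<forall>g\<in>free_carrier X. p (f + g) \<le> p f + p g \<and> p (f * g) \<le> p f * p g) \<and>
    p (free_star f * f) = (p f)\<^sup>2}"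

text \<open>
  A family \<open>(t\<^sub>x)\<close> indexed by \<open>X\<close> in a C*-algebra \<open>B\<close> that satisfies the relations
  \<open>f = 0\<close> for \<open>f \<in> R\<close> extends to a *-homomorphism \<open>\<pi>\<close> from the free *-algebra to \<open>B\<close>, and
  \<open>f \<mapsto> \<parallel>\<pi> f\<parallel>\<close> is a C*-seminorm vanishing on \<open>R\<close>. Conversely, completing the free
  *-algebra in such a seminorm gives a C*-algebra with such a family. Hence the completion in the
  supremum of these seminorms is the C*-algebra universal for such families. The supremum is
  meaningful if the seminorms are pointwise bounded, as they are for the relations of a
  row-finite \<open>P\<close>-graph, which force every generator to have seminorm at most 1.
\<close>

definition universal_seminorm :: "'x set \<Rightarrow> 'x free_elt set \<Rightarrow> 'x free_elt \<Rightarrow> real"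
  where "universal_seminorm X R f =
    (SUP p \<in> {p \<in> cstar_seminorms X. \<forall>g\<in>R. p g = 0}. p f)"

definition free_star_algebra :: "'x set \<Rightarrow> 'x free_elt set \<Rightarrow> 'x free_elt star_algebra"
  where "free_star_algebra X R = \<lparr>
    carrier = free_carrier X,
    monoid.mult = (*),
    one = 0,
    zero = 0,
    add = (+),
    smult = free_smult,
    adj = free_star,
    nrm = universal_seminorm X R\<rparr>"

definition universal_cstar :: "'x set \<Rightarrow> 'x free_elt set \<Rightarrow> (nat \<Rightarrow> 'x free_elt) set star_algebra"
  where "universal_cstar X R = completion (free_star_algebra X R)"

definition universal_gen ::
    "'x set \<Rightarrow> 'x free_elt set \<Rightarrow> 'x \<Rightarrow> (nat \<Rightarrow> 'x free_elt) set"
  where "universal_gen X R x = seq_class (free_star_algebra X R) (\<lambda>n. free_gen x)"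

section \<open>P-graphs\<close>

text \<open>
  A small category is given by its morphisms alone, each object being identified with its identity
  morphism; \<open>rng\<close> is the codomain and \<open>src\<close> the domain, and \<open>comp \<mu> \<nu>\<close> is
  meaningful if \<open>src \<mu> = rng \<nu>\<close>.
\<close>

record ('e, 'p) pgraph =
  mor :: "'e set"
  rng :: "'e \<Rightarrow> 'e"
  src :: "'e \<Rightarrow> 'e"
  comp :: "'e \<Rightarrow> 'e \<Rightarrow> 'e"
  deg :: "'e \<Rightarrow> 'p"

definition objs :: "('e, 'p) pgraph \<Rightarrow> 'e set"
  where "objs \<Lambda> = rng \<Lambda> ` mor \<Lambda>"

definition composable :: "('e, 'p) pgraph \<Rightarrow> 'e \<Rightarrow> 'e \<Rightarrow> bool"
  where "composable \<Lambda> \<mu> \<nu> \<longleftrightarrow>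
    \<mu> \<in> mor \<Lambda> \<and> \<nu> \<in> mor \<Lambda> \<and> src \<Lambda> \<mu> = rng \<Lambda> \<nu>"

definition paths_into :: "('e, 'p) pgraph \<Rightarrow> 'e \<Rightarrow> 'p \<Rightarrow> 'e set"
  where "paths_into \<Lambda> v p = {\<eta> \<in> mor \<Lambda>. rng \<Lambda> \<eta> = v \<and> deg \<Lambda> \<eta> = p}"

locale P_graph = monoid P for P :: "'p monoid" (structure) +
  fixes \<Lambda> :: "('e, 'p) pgraph"
  assumes countable_mor: "countable (mor \<Lambda>)"
    and rng_closed: "\<eta> \<in> mor \<Lambda> \<Longrightarrow> rng \<Lambda> \<eta> \<in> mor \<Lambda>"
    and src_closed: "\<eta> \<in> mor \<Lambda> \<Longrightarrow> src \<Lambda> \<eta> \<in> mor \<Lambda>"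
    and rng_rng: "\<eta> \<in> mor \<Lambda> \<Longrightarrow> rng \<Lambda> (rng \<Lambda> \<eta>) = rng \<Lambda> \<eta>"
    and src_rng: "\<eta> \<in> mor \<Lambda> \<Longrightarrow> src \<Lambda> (rng \<Lambda> \<eta>) = rng \<Lambda> \<eta>"
    and rng_src: "\<eta> \<in> mor \<Lambda> \<Longrightarrow> rng \<Lambda> (src \<Lambda> \<eta>) = src \<Lambda> \<eta>"
    and src_src: "\<eta> \<in> mor \<Lambda> \<Longrightarrow> src \<Lambda> (src \<Lambda> \<eta>) = src \<Lambda> \<eta>"
    and comp_closed: "composable \<Lambda> \<mu> \<nu> \<Longrightarrow> comp \<Lambda> \<mu> \<nu> \<in> mor \<Lambda>"
    and rng_comp: "composable \<Lambda> \<mu> \<nu> \<Longrightarrow> rng \<Lambda> (comp \<Lambda> \<mu> \<nu>) = rng \<Lambda> \<mu>"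
    and src_comp: "composable \<Lambda> \<mu> \<nu> \<Longrightarrow> src \<Lambda> (comp \<Lambda> \<mu> \<nu>) = src \<Lambda> \<nu>"
    and comp_assoc: "\<lbrakk>composable \<Lambda> \<eta> \<mu>; composable \<Lambda> \<mu> \<nu>\<rbrakk>
      \<Longrightarrow> comp \<Lambda> (comp \<Lambda> \<eta> \<mu>) \<nu> = comp \<Lambda> \<eta> (comp \<Lambda> \<mu> \<nu>)"
    and comp_rng: "\<eta> \<in> mor \<Lambda> \<Longrightarrow> comp \<Lambda> (rng \<Lambda> \<eta>) \<eta> = \<eta>"
    and comp_src: "\<eta> \<in> mor \<Lambda> \<Longrightarrow> comp \<Lambda> \<eta> (src \<Lambda> \<eta>) = \<eta>"
    and deg_closed: "\<eta> \<in> mor \<Lambda> \<Longrightarrow> deg \<Lambda> \<eta> \<in> carrier P"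
    and deg_obj: "v \<in> objs \<Lambda> \<Longrightarrow> deg \<Lambda> v = \<one>"
    and deg_comp: "composable \<Lambda> \<mu> \<nu> \<Longrightarrow> deg \<Lambda> (comp \<Lambda> \<mu> \<nu>) = deg \<Lambda> \<mu> \<otimes> deg \<Lambda> \<nu>"
    and factorisation: "\<lbrakk>\<eta> \<in> mor \<Lambda>; p \<in> carrier P; q \<in> carrier P; deg \<Lambda> \<eta> = p \<otimes> q\<rbrakk>
      \<Longrightarrow> \<exists>!(\<mu>, \<nu>). composable \<Lambda> \<mu> \<nu> \<and> deg \<Lambda> \<mu> = p \<and> deg \<Lambda> \<nu> = q \<and>
            comp \<Lambda> \<mu> \<nu> = \<eta>"
begin

lemma objs_eq_degree_zero: "objs \<Lambda> = {\<eta> \<in> mor \<Lambda>. deg \<Lambda> \<eta> = \<one>}"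
proof (intro equalityI subsetI)
  fix v assume "v \<in> objs \<Lambda>"
  then show "v \<in> {\<eta> \<in> mor \<Lambda>. deg \<Lambda> \<eta> = \<one>}"
    using deg_obj rng_closed by (auto simp: objs_def)
next
  fix v assume "v \<in> {\<eta> \<in> mor \<Lambda>. deg \<Lambda> \<eta> = \<one>}"
  then have v: "v \<in> mor \<Lambda>" "deg \<Lambda> v = \<one>" by auto
  have o: "rng \<Lambda> v \<in> objs \<Lambda>" "src \<Lambda> v \<in> objs \<Lambda>"
    using v rng_src[OF v(1)] src_closed[OF v(1)] unfolding objs_def by force+
  have 1: "composable \<Lambda> (rng \<Lambda> v) v" "composable \<Lambda> v (src \<Lambda> v)"
    using v by (auto simp: composable_def rng_closed src_closed src_rng rng_src)
  have "\<exists>!(\<mu>, \<nu>). composable \<Lambda> \<mu> \<nu> \<and> deg \<Lambda> \<mu> = \<one> \<and> deg \<Lambda> \<nu> = \<one> \<and> comp \<Lambda> \<mu> \<nu> = v"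
    using factorisation[OF v(1), of \<one> \<one>] v(2) by simp
  then have "(rng \<Lambda> v, v) = (v, src \<Lambda> v)"
    by (rule ex1E) (use 1 o v in \<open>simp add: deg_obj comp_rng comp_src\<close>)
  then show "v \<in> objs \<Lambda>" using o by simp
qed

end

definition row_finite :: "'p monoid \<Rightarrow> ('e, 'p) pgraph \<Rightarrow> bool"
  where "row_finite P \<Lambda> \<longleftrightarrow> (\<forall>v\<in>objs \<Lambda>. \<forall>p\<in>carrier P. finite (paths_into \<Lambda> v p))"

definition no_sources :: "'p monoid \<Rightarrow> ('e, 'p) pgraph \<Rightarrow> bool"
  where "no_sources P \<Lambda> \<longleftrightarrow> (\<forall>v\<in>objs \<Lambda>. \<forall>p\<in>carrier P. paths_into \<Lambda> v p \<noteq> {})"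

definition cocycle :: "('e, 'p) pgraph \<Rightarrow> ('e \<Rightarrow> 'e \<Rightarrow> complex) \<Rightarrow> bool"
  where "cocycle \<Lambda> c \<longleftrightarrow>
    (\<forall>\<mu> \<nu>. composable \<Lambda> \<mu> \<nu> \<longrightarrow> cmod (c \<mu> \<nu>) = 1) \<and>
    (\<forall>\<eta> \<mu> \<nu>. composable \<Lambda> \<eta> \<mu> \<and> composable \<Lambda> \<mu> \<nu> \<longrightarrow>
      c \<eta> \<mu> * c (comp \<Lambda> \<eta> \<mu>) \<nu> = c \<mu> \<nu> * c \<eta> (comp \<Lambda> \<mu> \<nu>)) \<and>
    (\<forall>\<eta>\<in>mor \<Lambda>. c (rng \<Lambda> \<eta>) \<eta> = 1 \<and> c \<eta> (src \<Lambda> \<eta>) = 1)"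

definition Z2_functor :: "('e, 'p) pgraph \<Rightarrow> ('e \<Rightarrow> bit) \<Rightarrow> bool"
  where "Z2_functor \<Lambda> \<delta> \<longleftrightarrow>
    (\<forall>\<mu> \<nu>. composable \<Lambda> \<mu> \<nu> \<longrightarrow> \<delta> (comp \<Lambda> \<mu> \<nu>) = \<delta> \<mu> + \<delta> \<nu>) \<and>
    (\<forall>v\<in>objs \<Lambda>. \<delta> v = 0)"

definition sign :: "bit \<Rightarrow> complex"
  where "sign i = (if i = 0 then 1 else - 1)"

text \<open>The monoid \<open>\<nat>\<^sup>k \<times> \<int>\<^sub>2\<^sup>l\<close>, tuples being functions that vanish from \<open>k\<close> (from \<open>l\<close>) on.\<close>

definition NZ2_monoid :: "nat \<Rightarrow> nat \<Rightarrow> ((nat \<Rightarrow> nat) \<times> (nat \<Rightarrow> bit)) monoid"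
  where "NZ2_monoid k l = \<lparr>
    carrier = {m. \<forall>i\<ge>k. m i = 0} \<times> {g. \<forall>j\<ge>l. g j = 0},
    monoid.mult = (\<lambda>(m, g) (m', g'). (\<lambda>i. m i + m' i, \<lambda>j. g j + g' j)),
    one = (\<lambda>i. 0, \<lambda>j. 0)\<rparr>"

section \<open>Twisted P-graph C*-algebras\<close>

definition ck_relators ::
    "'p monoid \<Rightarrow> ('e, 'p) pgraph \<Rightarrow> ('e \<Rightarrow> 'e \<Rightarrow> complex) \<Rightarrow> 'e free_elt set"
  where "ck_relators P \<Lambda> c =
    {free_star (free_gen v) - free_gen v | v. v \<in> objs \<Lambda>} \<union>
    {free_gen v * free_gen v - free_gen v | v. v \<in> objs \<Lambda>} \<union>
    {free_gen v * free_gen w | v w. v \<in> objs \<Lambda> \<and> w \<in> objs \<Lambda> \<and> v \<noteq> w} \<union>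
    {free_gen \<mu> * free_gen \<nu> - free_smult (c \<mu> \<nu>) (free_gen (comp \<Lambda> \<mu> \<nu>)) | \<mu> \<nu>.
       composable \<Lambda> \<mu> \<nu>} \<union>
    {free_star (free_gen \<eta>) * free_gen \<eta> - free_gen (src \<Lambda> \<eta>) | \<eta>. \<eta> \<in> mor \<Lambda>} \<union>
    {free_gen v - (\<Sum>\<eta>\<in>paths_into \<Lambda> v p. free_gen \<eta> * free_star (free_gen \<eta>)) | v p.
       v \<in> objs \<Lambda> \<and> p \<in> carrier P}"

definition pgraph_cstar ::
    "'p monoid \<Rightarrow> ('e, 'p) pgraph \<Rightarrow> ('e \<Rightarrow> 'e \<Rightarrow> complex) \<Rightarrow>
      (nat \<Rightarrow> 'e free_elt) set star_algebra"
  where "pgraph_cstar P \<Lambda> c = universal_cstar (mor \<Lambda>) (ck_relators P \<Lambda> c)"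

definition pgraph_gen ::
    "'p monoid \<Rightarrow> ('e, 'p) pgraph \<Rightarrow> ('e \<Rightarrow> 'e \<Rightarrow> complex) \<Rightarrow>
      'e \<Rightarrow> (nat \<Rightarrow> 'e free_elt) set"
  where "pgraph_gen P \<Lambda> c = universal_gen (mor \<Lambda>) (ck_relators P \<Lambda> c)"

end

(*
  The degree \<delta> acts on the free *-algebra by w \<mapsto> (-1)^{\<delta>(w)} w. The relators are homogeneous, so
  this action preserves the universal seminorm and extends to an isometric involution of the
  completion. Its eigenspaces are the images of the averages (f \<plusminus> \<alpha>(f))/2, so it remains to see that every
  word is, up to elements of seminorm zero, a combination of products s_\<mu> s_\<nu>^* of the same degree.
  Given \<eta> and \<mu> with the same range, s_\<eta>^* s_\<mu> is expanded over the paths \<zeta> of degree d(\<eta>)d(\<mu>) = d(\<mu>)d(\<eta>),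
  which extend both a path of degree d(\<eta>) and one of degree d(\<mu>). This needs s_\<eta>^* s_\<eta>' to vanish for
  distinct paths of equal degree and range, i.e. that projections with sum a projection are
  mutually orthogonal. Instead of spectral theory, positivity is expressed by \<parallel>e - b\<parallel> \<le> 1, and the
  orthogonality comes from the unit of a normed algebra being an extreme point of the unit ball.
*)
theory Submission
  imports Defs
begin

section \<open>The completion of a seminormed *-algebra\<close>

text \<open>Words in the generators are compared inside the free algebra, modulo the null space of a
  seminorm; the completion enters only at the end, where null elements become zero. The supremum
  that defines the universal seminorm is meaningful only once the competing seminorms are known to
  be pointwise bounded. The Cuntz-Krieger calculus is therefore developed for an arbitrary
  C*-seminorm that kills the relators, and it is used twice: for each competitor, to bound the
  supremum, and then for the supremum itself. In a k-graph one expands over minimal common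
  extensions, whose degree is the join of two degrees. Divisibility in N^k x Z_2^l is not
  antisymmetric for l > 0, so there is no unique join; the product of the two degrees takes its
  place. The condition \<parallel>e - b\<parallel> \<le> 1 is convenient because contractions are
  stable under means and compressions: if m positive elements b_i sum to zero, then e + b_i/m and e
  - b_i/m are both means of contractions, and extremality of e gives b_i = 0. The quantitative input
  for extremality is that (2m choose m) / 4^m tends to 0.\<close>

locale seminormed_star_algebra = abelian_group A for A :: "'a star_algebra" (structure) +
  assumes m_closed: "\<lbrakk>a \<in> carrier A; b \<in> carrier A\<rbrakk> \<Longrightarrow> a \<otimes> b \<in> carrier A"
    and m_assoc: "\<lbrakk>a \<in> carrier A; b \<in> carrier A; e \<in> carrier A\<rbrakk>
      \<Longrightarrow> (a \<otimes> b) \<otimes> e = a \<otimes> (b \<otimes> e)"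
    and l_distr: "\<lbrakk>a \<in> carrier A; b \<in> carrier A; e \<in> carrier A\<rbrakk>
      \<Longrightarrow> (a \<oplus> b) \<otimes> e = a \<otimes> e \<oplus> b \<otimes> e"
    and r_distr: "\<lbrakk>a \<in> carrier A; b \<in> carrier A; e \<in> carrier A\<rbrakk>
      \<Longrightarrow> e \<otimes> (a \<oplus> b) = e \<otimes> a \<oplus> e \<otimes> b"
    and smult_closed: "a \<in> carrier A \<Longrightarrow> z \<odot> a \<in> carrier A"
    and smult_l_distr: "a \<in> carrier A \<Longrightarrow> (z + w) \<odot> a = z \<odot> a \<oplus> w \<odot> a"
    and smult_r_distr: "\<lbrakk>a \<in> carrier A; b \<in> carrier A\<rbrakk> \<Longrightarrow> z \<odot> (a \<oplus> b) = z \<odot> a \<oplus> z \<odot> b"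
    and smult_assoc: "a \<in> carrier A \<Longrightarrow> (z * w) \<odot> a = z \<odot> (w \<odot> a)"
    and smult_one: "a \<in> carrier A \<Longrightarrow> 1 \<odot> a = a"
    and smult_mult_l: "\<lbrakk>a \<in> carrier A; b \<in> carrier A\<rbrakk> \<Longrightarrow> (z \<odot> a) \<otimes> b = z \<odot> (a \<otimes> b)"
    and smult_mult_r: "\<lbrakk>a \<in> carrier A; b \<in> carrier A\<rbrakk> \<Longrightarrow> a \<otimes> (z \<odot> b) = z \<odot> (a \<otimes> b)"
    and adj_closed: "a \<in> carrier A \<Longrightarrow> adj A a \<in> carrier A"
    and adj_adj: "a \<in> carrier A \<Longrightarrow> adj A (adj A a) = a"
    and adj_add: "\<lbrakk>a \<in> carrier A; b \<in> carrier A\<rbrakk> \<Longrightarrow> adj A (a \<oplus> b) = adj A a \<oplus> adj A b"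
    and adj_smult: "a \<in> carrier A \<Longrightarrow> adj A (z \<odot> a) = cnj z \<odot> adj A a"
    and adj_mult: "\<lbrakk>a \<in> carrier A; b \<in> carrier A\<rbrakk> \<Longrightarrow> adj A (a \<otimes> b) = adj A b \<otimes> adj A a"
    and nrm_nonneg: "a \<in> carrier A \<Longrightarrow> 0 \<le> nrm A a"
    and nrm_triangle: "\<lbrakk>a \<in> carrier A; b \<in> carrier A\<rbrakk> \<Longrightarrow> nrm A (a \<oplus> b) \<le> nrm A a + nrm A b"
    and nrm_smult: "a \<in> carrier A \<Longrightarrow> nrm A (z \<odot> a) = cmod z * nrm A a"
    and nrm_mult: "\<lbrakk>a \<in> carrier A; b \<in> carrier A\<rbrakk> \<Longrightarrow> nrm A (a \<otimes> b) \<le> nrm A a * nrm A b"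
    and cstar_identity: "a \<in> carrier A \<Longrightarrow> nrm A (adj A a \<otimes> a) = (nrm A a)\<^sup>2"

text \<open>\<open>seminormed_star_algebra\<close> keeps the axioms of \<open>cstar_algebra\<close>
  except definiteness and completeness. One body of lemmas thus serves the free algebra and, through
  this inclusion, its completion.\<close>

sublocale cstar_algebra \<subseteq> seminormed_star_algebra
  by unfold_locales
    (rule m_closed m_assoc l_distr r_distr smult_closed smult_l_distr smult_r_distr smult_assoc
      smult_one smult_mult_l smult_mult_r adj_closed adj_adj adj_add adj_smult adj_mult
      nrm_nonneg nrm_triangle nrm_smult nrm_mult cstar_identity; assumption)+

context seminormed_star_algebra
begin

lemmas closed_simps [simp] = m_closed smult_closed adj_closed

lemma smult_zero_left:
  assumes "a \<in> carrier A" shows "0 \<odot> a = \<zero>"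
proof -
  have "0 \<odot> a \<oplus> 0 \<odot> a = 0 \<odot> a" using smult_l_distr[OF assms, of 0 0] by simp
  then show ?thesis using assms by (simp add: add.l_cancel_one)
qed

lemma minus_eq_smult:
  assumes "a \<in> carrier A" shows "\<ominus> a = (- 1) \<odot> a"
proof (rule minus_equality)
  have "(- 1) \<odot> a \<oplus> 1 \<odot> a = \<zero>"
    using smult_l_distr[OF assms, of "- 1" 1] smult_zero_left[OF assms] by simp
  then show "(- 1) \<odot> a \<oplus> a = \<zero>" using assms by (simp add: smult_one)
qed (use assms in auto)

lemma nrm_zero [simp]: "nrm A \<zero> = 0"
  using nrm_smult[of \<zero> 0] smult_zero_left[of \<zero>] by simp

lemma nrm_minus: "a \<in> carrier A \<Longrightarrow> nrm A (\<ominus> a) = nrm A a"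
  by (simp add: minus_eq_smult nrm_smult)

lemma nrm_minus_commute:
  assumes "a \<in> carrier A" "b \<in> carrier A" shows "nrm A (a \<ominus> b) = nrm A (b \<ominus> a)"
proof -
  have "\<ominus> (a \<ominus> b) = b \<ominus> a" using assms by (simp add: a_minus_def minus_add a_comm)
  then show ?thesis using nrm_minus[of "a \<ominus> b"] assms by simp
qed

lemma diff_self [simp]: "a \<in> carrier A \<Longrightarrow> a \<ominus> a = \<zero>"
  by (simp add: a_minus_def r_neg)

lemma diff_zero [simp]: "a \<in> carrier A \<Longrightarrow> a \<ominus> \<zero> = a"
  by (simp add: a_minus_def)

lemma diff_add_cancel:
  assumes "a \<in> carrier A" "b \<in> carrier A" shows "a \<ominus> b \<oplus> b = a"
  using assms by (simp add: a_minus_def a_assoc l_neg)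

lemma nrm_dist_triangle:
  assumes "a \<in> carrier A" "b \<in> carrier A" "e \<in> carrier A"
  shows "nrm A (a \<ominus> b) \<le> nrm A (a \<ominus> e) + nrm A (e \<ominus> b)"
proof -
  have "a \<ominus> b = (a \<ominus> e) \<oplus> (e \<ominus> b)"
  proof -
    have "\<ominus> e \<oplus> (e \<oplus> \<ominus> b) = \<ominus> b" using assms by (simp add: a_assoc[symmetric] l_neg)
    then show ?thesis using assms by (simp add: a_minus_def a_assoc)
  qed
  then show ?thesis using nrm_triangle[of "a \<ominus> e" "e \<ominus> b"] assms by simp
qed

lemma nrm_abs_diff:
  assumes "a \<in> carrier A" "b \<in> carrier A"
  shows "\<bar>nrm A a - nrm A b\<bar> \<le> nrm A (a \<ominus> b)"
  using nrm_minus_commute[of a b] assms nrm_triangle[of "a \<ominus> b" b] nrm_triangle[of "b \<ominus> a" a] by (simp add: diff_add_cancel)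

lemma nrm_dist_add:
  assumes "a \<in> carrier A" "b \<in> carrier A" "a' \<in> carrier A" "b' \<in> carrier A"
  shows "nrm A ((a \<oplus> b) \<ominus> (a' \<oplus> b')) \<le> nrm A (a \<ominus> a') + nrm A (b \<ominus> b')"
proof -
  have "(a \<oplus> b) \<ominus> (a' \<oplus> b') = (a \<ominus> a') \<oplus> (b \<ominus> b')"
    using assms by (simp add: a_minus_def minus_add a_ac)
  then show ?thesis using nrm_triangle[of "a \<ominus> a'" "b \<ominus> b'"] assms by simp
qed

lemma smult_diff:
  assumes "a \<in> carrier A" "b \<in> carrier A"
  shows "z \<odot> (a \<ominus> b) = z \<odot> a \<ominus> z \<odot> b"
  using assms by (simp add: a_minus_def minus_eq_smult smult_r_distr smult_assoc[symmetric])

lemma nrm_dist_smult: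
  assumes "a \<in> carrier A" "b \<in> carrier A"
  shows "nrm A (z \<odot> a \<ominus> z \<odot> b) = cmod z * nrm A (a \<ominus> b)"
  using assms by (simp flip: smult_diff add: nrm_smult)

text \<open>Isometry of the involution is not an axiom. It follows from \<parallel>b\<parallel>^2 =
  \<parallel>b^* b\<parallel> \<le> \<parallel>b^*\<parallel> \<parallel>b\<parallel> by cancelling
  \<parallel>b\<parallel>, used for the element and for its adjoint.\<close>

lemma nrm_adj:
  assumes "a \<in> carrier A" shows "nrm A (adj A a) = nrm A a"
proof -
  have le: "nrm A b \<le> nrm A (adj A b)" if b: "b \<in> carrier A" for b
  proof (cases "nrm A b = 0")
    case True then show ?thesis using b by (simp add: nrm_nonneg)
  next
    case False
    then have "0 < nrm A b" using nrm_nonneg[OF b] by simp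
    moreover have "nrm A b * nrm A b \<le> nrm A (adj A b) * nrm A b"
      using nrm_mult[of "adj A b" b] cstar_identity[OF b] b by (simp add: power2_eq_square)
    ultimately show ?thesis by simp
  qed
  show ?thesis using le[OF assms] le[of "adj A a"] assms by (simp add: adj_adj)
qed

lemma nrm_dist_adj:
  assumes "a \<in> carrier A" "b \<in> carrier A"
  shows "nrm A (adj A a \<ominus> adj A b) = nrm A (a \<ominus> b)"
proof -
  have "adj A (a \<ominus> b) = adj A a \<ominus> adj A b"
    using assms by (simp add: a_minus_def minus_eq_smult adj_add adj_smult)
  then show ?thesis using nrm_adj[of "a \<ominus> b"] assms by simp
qed

lemma nrm_dist_mult:
  assumes "a \<in> carrier A" "b \<in> carrier A" "a' \<in> carrier A" "b' \<in> carrier A"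
  shows "nrm A (a \<otimes> b \<ominus> a' \<otimes> b') \<le> nrm A (a \<ominus> a') * nrm A b + nrm A a' * nrm A (b \<ominus> b')"
proof -
  have "nrm A (a \<otimes> b \<ominus> a' \<otimes> b') \<le> nrm A (a \<otimes> b \<ominus> a' \<otimes> b) + nrm A (a' \<otimes> b \<ominus> a' \<otimes> b')"
    using assms by (simp add: nrm_dist_triangle)
  moreover have "a \<otimes> b \<ominus> a' \<otimes> b = (a \<ominus> a') \<otimes> b" "a' \<otimes> b \<ominus> a' \<otimes> b' = a' \<otimes> (b \<ominus> b')"
    using assms by (simp_all add: a_minus_def minus_eq_smult l_distr r_distr smult_mult_l smult_mult_r)
  ultimately show ?thesis
    using nrm_mult[of "a \<ominus> a'" b] nrm_mult[of a' "b \<ominus> b'"] assms by simp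
qed

section \<open>Cauchy sequences and the termwise operations on them\<close>

lemma cauchy_closed: "x \<in> cauchy_seqs A \<Longrightarrow> x n \<in> carrier A"
  by (simp add: cauchy_seqs_def)

lemma cauchyI:
  assumes "\<And>n. x n \<in> carrier A"
    and "\<And>e. 0 < e \<Longrightarrow> \<exists>M. \<forall>m\<ge>M. \<forall>n\<ge>M. nrm A (x m \<ominus> x n) < e"
  shows "x \<in> cauchy_seqs A"
  using assms by (simp add: cauchy_seqs_def)

lemma cauchyD:
  assumes "x \<in> cauchy_seqs A" "0 < e"
  obtains M where "\<And>m n. m \<ge> M \<Longrightarrow> n \<ge> M \<Longrightarrow> nrm A (x m \<ominus> x n) < e"
  using assms unfolding cauchy_seqs_def by blast

lemma cauchy_const [simp]: "a \<in> carrier A \<Longrightarrow> (\<lambda>n. a) \<in> cauchy_seqs A"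
  by (rule cauchyI) simp_all

lemma cauchy_convergent_nrm:
  assumes x: "x \<in> cauchy_seqs A" shows "convergent (\<lambda>n. nrm A (x n))"
  unfolding Cauchy_convergent_iff[symmetric]
proof (rule metric_CauchyI)
  fix e :: real assume "0 < e"
  then obtain M where "\<And>m n. m \<ge> M \<Longrightarrow> n \<ge> M \<Longrightarrow> nrm A (x m \<ominus> x n) < e"
    using cauchyD[OF x] by metis
  then show "\<exists>M. \<forall>m\<ge>M. \<forall>n\<ge>M. dist (nrm A (x m)) (nrm A (x n)) < e"
    using nrm_abs_diff[OF cauchy_closed[OF x] cauchy_closed[OF x]]
    unfolding dist_real_def by (meson le_less_trans)
qed

lemma cauchy_bounded:
  assumes x: "x \<in> cauchy_seqs A" obtains K where "0 < K" "\<And>n. nrm A (x n) \<le> K"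
proof -
  have "Bseq (\<lambda>n. nrm A (x n))" by (rule convergent_imp_Bseq[OF cauchy_convergent_nrm[OF x]])
  then show thesis using that cauchy_closed[OF x] by (auto simp: Bseq_def nrm_nonneg)
qed

text \<open>Common criterion behind the closure of \<open>cauchy_seqs\<close> under all operations.
  Unary operations use it with \<open>x\<close> and \<open>y\<close> equal; for multiplication the
  constant comes from bounds on the two sequences.\<close>

lemma cauchy_lipschitz:
  assumes x: "x \<in> cauchy_seqs A" and y: "y \<in> cauchy_seqs A"
    and w: "\<And>n. w n \<in> carrier A" and K: "0 \<le> K"
    and le: "\<And>m n. nrm A (w m \<ominus> w n) \<le> K * (nrm A (x m \<ominus> x n) + nrm A (y m \<ominus> y n))"
  shows "w \<in> cauchy_seqs A"
proof (rule cauchyI[OF w])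
  fix e :: real assume e: "0 < e"
  \<comment> \<open>The summand 1 keeps the denominator positive for \<open>K = 0\<close> and makes
    \<open>K * (2 * d) < e\<close> strict.\<close>
  define d where "d = e / (2 * K + 1)"
  have d: "0 < d" using e K by (simp add: d_def)
  obtain M where M: "\<And>m n. m \<ge> M \<Longrightarrow> n \<ge> M \<Longrightarrow> nrm A (x m \<ominus> x n) < d"
    using cauchyD[OF x d] by metis
  obtain N where N: "\<And>m n. m \<ge> N \<Longrightarrow> n \<ge> N \<Longrightarrow> nrm A (y m \<ominus> y n) < d"
    using cauchyD[OF y d] by metis
  have "nrm A (w m \<ominus> w n) < e" if mn: "m \<ge> max M N" "n \<ge> max M N" for m n
  proof -
    have "nrm A (w m \<ominus> w n) \<le> K * (2 * d)"
      using M[of m n] N[of m n] mn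
      by (intro order.trans[OF le] mult_left_mono) (use K in auto)
    also have "\<dots> < (2 * K + 1) * d" using d by (simp add: algebra_simps)
    also have "\<dots> = e" using K by (simp add: d_def)
    finally show ?thesis .
  qed
  then show "\<exists>M. \<forall>m\<ge>M. \<forall>n\<ge>M. nrm A (w m \<ominus> w n) < e" by blast
qed

lemma cauchy_add:
  assumes "x \<in> cauchy_seqs A" "y \<in> cauchy_seqs A"
  shows "(\<lambda>n. x n \<oplus> y n) \<in> cauchy_seqs A"
  using assms by (rule cauchy_lipschitz[where K = 1])
    (use assms in \<open>simp_all add: cauchy_closed nrm_dist_add\<close>)

lemma cauchy_mult:
  assumes x: "x \<in> cauchy_seqs A" and y: "y \<in> cauchy_seqs A"
  shows "(\<lambda>n. x n \<otimes> y n) \<in> cauchy_seqs A"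
proof -
  obtain K where K: "0 < K" "\<And>n. nrm A (x n) \<le> K" by (rule cauchy_bounded[OF x]) blast
  obtain L where L: "0 < L" "\<And>n. nrm A (y n) \<le> L" by (rule cauchy_bounded[OF y]) blast
  note c = cauchy_closed[OF x] cauchy_closed[OF y]
  have "nrm A (x m \<otimes> y m \<ominus> x n \<otimes> y n)
      \<le> max K L * (nrm A (x m \<ominus> x n) + nrm A (y m \<ominus> y n))" for m n
  proof -
    have "nrm A (x m \<ominus> x n) * nrm A (y m) \<le> nrm A (x m \<ominus> x n) * max K L"
      using L(2)[of m] c by (intro mult_left_mono) (auto simp: nrm_nonneg)
    moreover have "nrm A (x n) * nrm A (y m \<ominus> y n) \<le> max K L * nrm A (y m \<ominus> y n)"
      using K(2)[of n] c by (intro mult_right_mono) (auto simp: nrm_nonneg)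
    ultimately show ?thesis
      using nrm_dist_mult[OF c c, of m m n n] by (simp add: algebra_simps)
  qed
  then show ?thesis using c K(1) by (intro cauchy_lipschitz[OF x y, of _ "max K L"]) auto
qed

lemma cauchy_smult:
  assumes "x \<in> cauchy_seqs A" shows "(\<lambda>n. z \<odot> x n) \<in> cauchy_seqs A"
  using assms(1) assms(1) by (rule cauchy_lipschitz[where K = "cmod z"])
    (use assms in \<open>auto simp: cauchy_closed nrm_dist_smult nrm_nonneg intro!: mult_left_mono\<close>)

lemma cauchy_adj:
  assumes "x \<in> cauchy_seqs A" shows "(\<lambda>n. adj A (x n)) \<in> cauchy_seqs A"
  using assms(1) assms(1) by (rule cauchy_lipschitz[where K = 1])
    (use assms in \<open>auto simp: cauchy_closed nrm_dist_adj nrm_nonneg\<close>)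

section \<open>Classes of Cauchy sequences and the operations on classes\<close>

lemma seq_equivI:
  assumes "x \<in> cauchy_seqs A" "y \<in> cauchy_seqs A" "(\<lambda>n. nrm A (x n \<ominus> y n)) \<longlonglongrightarrow> 0"
  shows "(x, y) \<in> seq_equiv A"
  using assms by (simp add: seq_equiv_def)

lemma seq_equivD:
  assumes "(x, y) \<in> seq_equiv A"
  shows "x \<in> cauchy_seqs A" "y \<in> cauchy_seqs A" "(\<lambda>n. nrm A (x n \<ominus> y n)) \<longlonglongrightarrow> 0"
    "x n \<in> carrier A" "y n \<in> carrier A"
  using assms by (simp_all add: seq_equiv_def cauchy_seqs_def)

lemma equiv_seq_equiv: "equiv (cauchy_seqs A) (seq_equiv A)"
proof (rule equivI)
  show "seq_equiv A \<subseteq> cauchy_seqs A \<times> cauchy_seqs A" by (auto simp: seq_equiv_def)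
  show "refl_on (cauchy_seqs A) (seq_equiv A)"
    by (rule refl_onI) (auto simp: seq_equiv_def cauchy_closed)
  show "sym (seq_equiv A)"
    by (rule symI) (auto simp: seq_equiv_def cauchy_closed nrm_minus_commute)
  show "trans (seq_equiv A)"
  proof (rule transI)
    fix x y w assume xy: "(x, y) \<in> seq_equiv A" and yw: "(y, w) \<in> seq_equiv A"
    have "(\<lambda>n. nrm A (x n \<ominus> w n)) \<longlonglongrightarrow> 0"
    proof (rule tendsto_sandwich[of "\<lambda>n. 0"])
      show "(\<lambda>n. nrm A (x n \<ominus> y n) + nrm A (y n \<ominus> w n)) \<longlonglongrightarrow> 0"
        using tendsto_add[OF seq_equivD(3)[OF xy] seq_equivD(3)[OF yw]] by simp
    qed (auto intro!: always_eventually nrm_nonneg nrm_dist_triangle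
        simp: seq_equivD[OF xy] seq_equivD[OF yw])
    then show "(x, w) \<in> seq_equiv A"
      using seq_equivD[OF xy] seq_equivD[OF yw] by (simp add: seq_equivI)
  qed
qed

lemma seq_class_eq_iff:
  assumes "x \<in> cauchy_seqs A" "y \<in> cauchy_seqs A"
  shows "seq_class A x = seq_class A y \<longleftrightarrow> (\<lambda>n. nrm A (x n \<ominus> y n)) \<longlonglongrightarrow> 0"
  unfolding seq_class_def using assms
  by (simp add: eq_equiv_class_iff[OF equiv_seq_equiv]) (simp add: seq_equiv_def)

lemma seq_class_eqI:
  "\<lbrakk>x \<in> cauchy_seqs A; y \<in> cauchy_seqs A; (\<lambda>n. nrm A (x n \<ominus> y n)) \<longlonglongrightarrow> 0\<rbrakk>
    \<Longrightarrow> seq_class A x = seq_class A y"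
  by (simp add: seq_class_eq_iff)

lemma seq_class_memD:
  assumes "x' \<in> seq_class A x"
  shows "x' \<in> cauchy_seqs A" "(\<lambda>n. nrm A (x' n \<ominus> x n)) \<longlonglongrightarrow> 0" "x' n \<in> carrier A"
proof -
  have xx': "(x, x') \<in> seq_equiv A" using assms by (simp add: seq_class_def)
  have "(x', x) \<in> seq_equiv A" using equiv_seq_equiv xx' by (simp add: equiv_def symD)
  then show "x' \<in> cauchy_seqs A" "(\<lambda>n. nrm A (x' n \<ominus> x n)) \<longlonglongrightarrow> 0" "x' n \<in> carrier A"
    by (simp_all add: seq_equivD)
qed

lemma seq_class_self: "x \<in> cauchy_seqs A \<Longrightarrow> x \<in> seq_class A x"
  unfolding seq_class_def using equiv_class_self[OF equiv_seq_equiv] by simp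

text \<open>The operations of \<open>completion\<close> are unions over all representatives. Such a
  union collapses to one class as soon as the class does not depend on the representative.\<close>

lemma seq_class_Union1:
  assumes x: "x \<in> cauchy_seqs A" and "\<And>x'. x' \<in> seq_class A x \<Longrightarrow> F x' = F x"
  shows "(\<Union>x'\<in>seq_class A x. F x') = F x"
  using assms seq_class_self[OF x] by blast

lemma seq_class_Union2:
  assumes x: "x \<in> cauchy_seqs A" and y: "y \<in> cauchy_seqs A"
    and "\<And>x' y'. \<lbrakk>x' \<in> seq_class A x; y' \<in> seq_class A y\<rbrakk> \<Longrightarrow> F x' y' = F x y"
  shows "(\<Union>x'\<in>seq_class A x. \<Union>y'\<in>seq_class A y. F x' y') = F x y"
  using assms seq_class_self[OF x] seq_class_self[OF y] by blast

lemma completion_carrier: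
  "carrier (completion A) = seq_class A ` cauchy_seqs A"
  by (auto simp: completion_def quotient_def seq_class_def)

lemma completion_cases:
  assumes "a \<in> carrier (completion A)"
  obtains x where "x \<in> cauchy_seqs A" "a = seq_class A x"
  using assms by (auto simp: completion_carrier)

lemma seq_class_closed [simp]: "x \<in> cauchy_seqs A \<Longrightarrow> seq_class A x \<in> carrier (completion A)"
  by (simp add: completion_carrier)

lemma completion_zero: "\<zero>\<^bsub>completion A\<^esub> = seq_class A (\<lambda>n. \<zero>)"
  by (simp add: completion_def)

lemma completion_add:
  assumes x: "x \<in> cauchy_seqs A" and y: "y \<in> cauchy_seqs A"
  shows "seq_class A x \<oplus>\<^bsub>completion A\<^esub> seq_class A y = seq_class A (\<lambda>n. x n \<oplus> y n)"
proof -
  have "seq_class A (\<lambda>n. x' n \<oplus> y' n) = seq_class A (\<lambda>n. x n \<oplus> y n)"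
    if x': "x' \<in> seq_class A x" and y': "y' \<in> seq_class A y" for x' y'
  proof (rule seq_class_eqI)
    note c = seq_class_memD(3)[OF x'] seq_class_memD(3)[OF y'] cauchy_closed[OF x] cauchy_closed[OF y]
    show "(\<lambda>n. nrm A (x' n \<oplus> y' n \<ominus> (x n \<oplus> y n))) \<longlonglongrightarrow> 0"
    proof (rule tendsto_sandwich[of "\<lambda>n. 0"])
      show "(\<lambda>n. nrm A (x' n \<ominus> x n) + nrm A (y' n \<ominus> y n)) \<longlonglongrightarrow> 0"
        using tendsto_add[OF seq_class_memD(2)[OF x'] seq_class_memD(2)[OF y']] by simp
    qed (auto intro!: always_eventually nrm_nonneg nrm_dist_add simp: c)
  qed (use x y x' y' in \<open>simp_all add: cauchy_add seq_class_memD\<close>)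
  then show ?thesis
    using seq_class_Union2[OF x y, of "\<lambda>x y. seq_class A (\<lambda>n. x n \<oplus> y n)"]
    by (simp add: completion_def)
qed

lemma completion_mult:
  assumes x: "x \<in> cauchy_seqs A" and y: "y \<in> cauchy_seqs A"
  shows "seq_class A x \<otimes>\<^bsub>completion A\<^esub> seq_class A y = seq_class A (\<lambda>n. x n \<otimes> y n)"
proof -
  have "seq_class A (\<lambda>n. x' n \<otimes> y' n) = seq_class A (\<lambda>n. x n \<otimes> y n)"
    if x': "x' \<in> seq_class A x" and y': "y' \<in> seq_class A y" for x' y'
  proof (rule seq_class_eqI)
    note c = seq_class_memD(3)[OF x'] seq_class_memD(3)[OF y'] cauchy_closed[OF x] cauchy_closed[OF y]
    obtain K where K: "\<And>n. nrm A (x n) \<le> K" by (rule cauchy_bounded[OF x]) blast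
    obtain L where L: "\<And>n. nrm A (y' n) \<le> L"
      by (rule cauchy_bounded[OF seq_class_memD(1)[OF y']]) blast
    show "(\<lambda>n. nrm A (x' n \<otimes> y' n \<ominus> x n \<otimes> y n)) \<longlonglongrightarrow> 0"
    proof (rule tendsto_sandwich[of "\<lambda>n. 0"])
      show "(\<lambda>n. nrm A (x' n \<ominus> x n) * L + K * nrm A (y' n \<ominus> y n)) \<longlonglongrightarrow> 0"
        using tendsto_add[OF tendsto_mult_right[OF seq_class_memD(2)[OF x'], of L]
            tendsto_mult_left[OF seq_class_memD(2)[OF y'], of K]] by simp
      have "nrm A (x' n \<otimes> y' n \<ominus> x n \<otimes> y n)
          \<le> nrm A (x' n \<ominus> x n) * L + K * nrm A (y' n \<ominus> y n)" for n
      proof -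
        have "nrm A (x' n \<ominus> x n) * nrm A (y' n) \<le> nrm A (x' n \<ominus> x n) * L"
          using L[of n] c by (intro mult_left_mono) (auto simp: nrm_nonneg)
        moreover have "nrm A (x n) * nrm A (y' n \<ominus> y n) \<le> K * nrm A (y' n \<ominus> y n)"
          using K[of n] c by (intro mult_right_mono) (auto simp: nrm_nonneg)
        ultimately show ?thesis using nrm_dist_mult[OF c] by (meson add_mono order.trans)
      qed
      then show "\<forall>\<^sub>F n in sequentially. nrm A (x' n \<otimes> y' n \<ominus> x n \<otimes> y n)
          \<le> nrm A (x' n \<ominus> x n) * L + K * nrm A (y' n \<ominus> y n)" by simp
    qed (auto intro!: always_eventually nrm_nonneg simp: c)
  qed (use x y x' y' in \<open>simp_all add: cauchy_mult seq_class_memD\<close>)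
  then show ?thesis
    using seq_class_Union2[OF x y, of "\<lambda>x y. seq_class A (\<lambda>n. x n \<otimes> y n)"]
    by (simp add: completion_def)
qed

lemma completion_smult:
  assumes x: "x \<in> cauchy_seqs A"
  shows "z \<odot>\<^bsub>completion A\<^esub> seq_class A x = seq_class A (\<lambda>n. z \<odot> x n)"
proof -
  have "seq_class A (\<lambda>n. z \<odot> x' n) = seq_class A (\<lambda>n. z \<odot> x n)" if x': "x' \<in> seq_class A x" for x'
  proof (rule seq_class_eqI)
    show "(\<lambda>n. nrm A (z \<odot> x' n \<ominus> z \<odot> x n)) \<longlonglongrightarrow> 0"
      using tendsto_mult_left[OF seq_class_memD(2)[OF x'], of "cmod z"]
      by (simp add: nrm_dist_smult seq_class_memD[OF x'] cauchy_closed[OF x])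
  qed (use x x' in \<open>simp_all add: cauchy_smult seq_class_memD\<close>)
  then show ?thesis
    using seq_class_Union1[OF x, of "\<lambda>x. seq_class A (\<lambda>n. z \<odot> x n)"]
    by (simp add: completion_def)
qed

lemma completion_adj:
  assumes x: "x \<in> cauchy_seqs A"
  shows "adj (completion A) (seq_class A x) = seq_class A (\<lambda>n. adj A (x n))"
proof -
  have "seq_class A (\<lambda>n. adj A (x' n)) = seq_class A (\<lambda>n. adj A (x n))"
    if x': "x' \<in> seq_class A x" for x'
  proof (rule seq_class_eqI)
    show "(\<lambda>n. nrm A (adj A (x' n) \<ominus> adj A (x n))) \<longlonglongrightarrow> 0"
      using seq_class_memD(2)[OF x']
      by (simp add: nrm_dist_adj seq_class_memD[OF x'] cauchy_closed[OF x])
  qed (use x x' in \<open>simp_all add: cauchy_adj seq_class_memD\<close>)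
  then show ?thesis
    using seq_class_Union1[OF x, of "\<lambda>x. seq_class A (\<lambda>n. adj A (x n))"]
    by (simp add: completion_def)
qed

text \<open>Resolves the definite description in the norm of \<open>completion\<close>: the norms
  converge along each representative, and equivalent sequences have the same limit because the norm
  is 1-Lipschitz.\<close>

lemma completion_nrm_tendsto:
  assumes x: "x \<in> cauchy_seqs A"
  shows "(\<lambda>n. nrm A (x n)) \<longlonglongrightarrow> nrm (completion A) (seq_class A x)"
proof -
  obtain t where t: "(\<lambda>n. nrm A (x n)) \<longlonglongrightarrow> t"
    using cauchy_convergent_nrm[OF x] by (auto simp: convergent_def)
  have "(\<lambda>n. nrm A (x' n)) \<longlonglongrightarrow> t" if x': "x' \<in> seq_class A x" for x'
  proof -
    have "(\<lambda>n. nrm A (x' n) - nrm A (x n)) \<longlonglongrightarrow> 0"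
      by (rule tendsto_rabs_zero_cancel, rule tendsto_sandwich[of "\<lambda>n. 0", OF _ _ _ seq_class_memD(2)[OF x']])
        (auto intro!: always_eventually nrm_abs_diff simp: seq_class_memD[OF x'] cauchy_closed[OF x])
    from tendsto_add[OF this t] show ?thesis by simp
  qed
  then have "nrm (completion A) (seq_class A x) = t"
    unfolding completion_def using seq_class_self[OF x]
    by (auto intro!: the_equality intro: LIMSEQ_unique)
  then show ?thesis using t by simp
qed

lemma completion_nrm_eqI:
  "\<lbrakk>x \<in> cauchy_seqs A; (\<lambda>n. nrm A (x n)) \<longlonglongrightarrow> t\<rbrakk> \<Longrightarrow> nrm (completion A) (seq_class A x) = t"
  using completion_nrm_tendsto LIMSEQ_unique by blast

text \<open>Algebraic identities hold term by term on representatives, and the norm inequalities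
  pass to limits. Additive inverses come from the scalar -1.\<close>

lemma seminormed_star_algebra_completion: "seminormed_star_algebra (completion A)"
proof -
  note ops = completion_zero completion_add completion_mult completion_smult completion_adj
    cauchy_add cauchy_mult cauchy_smult cauchy_adj cauchy_closed
  note nrm = completion_nrm_tendsto
  note cs = completion_cases
  have neg: "(- 1) \<odot> y \<oplus> y = \<zero>" if "y \<in> carrier A" for y
    using that by (simp add: l_neg flip: minus_eq_smult)
  interpret C: abelian_group "completion A"
  proof (rule abelian_groupI)
    fix a assume "a \<in> carrier (completion A)"
    then obtain x where x: "x \<in> cauchy_seqs A" "a = seq_class A x" by (rule cs)
    have "(- 1) \<odot>\<^bsub>completion A\<^esub> a \<oplus>\<^bsub>completion A\<^esub> a = \<zero>\<^bsub>completion A\<^esub>"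
      using x neg by (simp add: ops)
    then show "\<exists>b\<in>carrier (completion A). b \<oplus>\<^bsub>completion A\<^esub> a = \<zero>\<^bsub>completion A\<^esub>"
      using x by (intro bexI[of _ "(- 1) \<odot>\<^bsub>completion A\<^esub> a"]) (simp_all add: ops)
  qed (auto elim!: cs simp: ops a_ac)
  show ?thesis
  proof unfold_locales
    fix a b assume "a \<in> carrier (completion A)" "b \<in> carrier (completion A)"
    then obtain x y where x: "x \<in> cauchy_seqs A" "a = seq_class A x"
      and y: "y \<in> cauchy_seqs A" "b = seq_class A y" by (metis cs)
    note nx = nrm[OF x(1)] and ny = nrm[OF y(1)]
    note nxy = nrm[OF cauchy_add[OF x(1) y(1)]] and mxy = nrm[OF cauchy_mult[OF x(1) y(1)]]
    show "nrm (completion A) (a \<oplus>\<^bsub>completion A\<^esub> b) \<le> nrm (completion A) a + nrm (completion A) b"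
      unfolding x y completion_add[OF x(1) y(1)]
      by (rule LIMSEQ_le[OF nxy tendsto_add[OF nx ny]])
        (use x y in \<open>auto simp: ops nrm_triangle\<close>)
    show "nrm (completion A) (a \<otimes>\<^bsub>completion A\<^esub> b) \<le> nrm (completion A) a * nrm (completion A) b"
      unfolding x y completion_mult[OF x(1) y(1)]
      by (rule LIMSEQ_le[OF mxy tendsto_mult[OF nx ny]])
        (use x y in \<open>auto simp: ops nrm_mult\<close>)
  next
    fix a z assume "a \<in> carrier (completion A)"
    then obtain x where x: "x \<in> cauchy_seqs A" "a = seq_class A x" by (rule cs)
    note nx = nrm[OF x(1)]
    show "0 \<le> nrm (completion A) a" unfolding x(2)
      by (rule LIMSEQ_le_const[OF nx]) (use x in \<open>auto simp: ops nrm_nonneg\<close>)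
    show "nrm (completion A) (z \<odot>\<^bsub>completion A\<^esub> a) = cmod z * nrm (completion A) a"
      unfolding x(2) completion_smult[OF x(1)]
      using tendsto_mult_left[OF nx, of "cmod z"] x
      by (intro completion_nrm_eqI) (simp_all add: ops nrm_smult)
    show "nrm (completion A) (adj (completion A) a \<otimes>\<^bsub>completion A\<^esub> a) = (nrm (completion A) a)\<^sup>2"
      unfolding x(2) using tendsto_power[OF nx, of 2] x
      by (auto simp: ops cstar_identity intro!: completion_nrm_eqI)
  qed (auto elim!: cs simp: ops m_assoc l_distr r_distr smult_l_distr smult_r_distr smult_assoc
      smult_one smult_mult_l smult_mult_r adj_adj adj_add adj_smult adj_mult)
qed

lemma completion_diff:
  assumes x: "x \<in> cauchy_seqs A" and y: "y \<in> cauchy_seqs A"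
  shows "seq_class A x \<ominus>\<^bsub>completion A\<^esub> seq_class A y = seq_class A (\<lambda>n. x n \<ominus> y n)"
proof -
  interpret C: seminormed_star_algebra "completion A" by (rule seminormed_star_algebra_completion)
  show ?thesis
    using assms by (simp add: a_minus_def C.minus_eq_smult minus_eq_smult completion_add
        completion_smult cauchy_smult cauchy_closed)
qed

lemma cauchy_diff:
  assumes "x \<in> cauchy_seqs A" "y \<in> cauchy_seqs A"
  shows "(\<lambda>n. x n \<ominus> y n) \<in> cauchy_seqs A"
  using assms cauchy_add[OF assms(1) cauchy_smult[OF assms(2), of "- 1"]]
  by (simp add: a_minus_def minus_eq_smult cauchy_closed)

lemma completion_nrm_const: "a \<in> carrier A \<Longrightarrow> nrm (completion A) (seq_class A (\<lambda>n. a)) = nrm A a"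
  by (intro completion_nrm_eqI) simp_all

lemma const_seq_class_tendsto:
  assumes x: "x \<in> cauchy_seqs A"
  shows "(\<lambda>k. nrm (completion A) (seq_class A x \<ominus>\<^bsub>completion A\<^esub> seq_class A (\<lambda>n. x k))) \<longlonglongrightarrow> 0"
proof (rule LIMSEQ_I)
  fix e :: real assume e: "0 < e"
  \<comment> \<open>Half of \<open>e\<close>, since passing to the limit in \<open>n\<close> only
    leaves a weak inequality.\<close>
  obtain M where M: "\<And>m n. m \<ge> M \<Longrightarrow> n \<ge> M \<Longrightarrow> nrm A (x m \<ominus> x n) < e / 2"
    using cauchyD[OF x, of "e / 2"] e by auto
  interpret C: seminormed_star_algebra "completion A" by (rule seminormed_star_algebra_completion)
  have "nrm (completion A) (seq_class A x \<ominus>\<^bsub>completion A\<^esub> seq_class A (\<lambda>n. x k)) < e" if k: "k \<ge> M" for k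
  proof -
    have c: "(\<lambda>n. x k) \<in> cauchy_seqs A" using cauchy_closed[OF x] by simp
    have "nrm (completion A) (seq_class A (\<lambda>n. x n \<ominus> x k)) \<le> e / 2"
      by (rule LIMSEQ_le_const2[OF completion_nrm_tendsto[OF cauchy_diff[OF x c]]])
        (use M k in \<open>auto intro: less_imp_le\<close>)
    then show ?thesis using e by (simp add: completion_diff[OF x c])
  qed
  moreover have "0 \<le> nrm (completion A) (seq_class A x \<ominus>\<^bsub>completion A\<^esub> seq_class A (\<lambda>n. x k))" for k
    using x by (simp add: C.nrm_nonneg cauchy_closed)
  ultimately show "\<exists>no. \<forall>k\<ge>no. norm (nrm (completion A)
      (seq_class A x \<ominus>\<^bsub>completion A\<^esub> seq_class A (\<lambda>n. x k)) - 0) < e" by auto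
qed

theorem cstar_algebra_completion: "cstar_algebra (completion A)"
proof -
  interpret C: seminormed_star_algebra "completion A" by (rule seminormed_star_algebra_completion)
  let ?D = "\<lambda>a b. nrm (completion A) (a \<ominus>\<^bsub>completion A\<^esub> b)"
  let ?\<iota> = "\<lambda>a. seq_class A (\<lambda>n. a)"
  have D: "?D (?\<iota> a) (?\<iota> b) = nrm A (a \<ominus> b)" if "a \<in> carrier A" "b \<in> carrier A" for a b
    using that by (simp add: completion_diff completion_nrm_const)
  show ?thesis
  proof (unfold_locales)
    fix a assume "a \<in> carrier (completion A)"
    then obtain x where x: "x \<in> cauchy_seqs A" "a = seq_class A x" by (rule completion_cases)
    show "(nrm (completion A) a = 0) = (a = \<zero>\<^bsub>completion A\<^esub>)"
    proof
      assume "nrm (completion A) a = 0"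
      then have "(\<lambda>n. nrm A (x n \<ominus> \<zero>)) \<longlonglongrightarrow> 0"
        using completion_nrm_tendsto[OF x(1)] x by (simp add: cauchy_closed)
      then show "a = \<zero>\<^bsub>completion A\<^esub>"
        unfolding x completion_zero by (intro seq_class_eqI x) simp_all
    qed simp
  next
    fix X :: "nat \<Rightarrow> (nat \<Rightarrow> 'a) set"
    assume X: "\<And>n. X n \<in> carrier (completion A)"
      and Cau: "\<And>e. 0 < e \<Longrightarrow> \<exists>M. \<forall>m\<ge>M. \<forall>n\<ge>M. ?D (X m) (X n) < e"
    \<comment> \<open>Diagonal argument: by density \<open>X k\<close> is replaced by a constant
      class at distance below 1/(k+1). The chosen elements form a Cauchy sequence of
      \<open>A\<close>, whose class is the limit of \<open>X\<close>.\<close>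
    have "\<exists>a\<in>carrier A. ?D (X k) (?\<iota> a) < 1 / Suc k" for k
    proof -
      obtain x where x: "x \<in> cauchy_seqs A" "X k = seq_class A x" using X by (metis completion_cases)
      have "\<forall>\<^sub>F n in sequentially. ?D (seq_class A x) (?\<iota> (x n)) < 1 / Suc k"
        by (rule order_tendstoD[OF const_seq_class_tendsto[OF x(1)]]) simp
      then show ?thesis using x by (auto simp: eventually_sequentially cauchy_closed)
    qed
    then obtain y where y: "\<And>k. y k \<in> carrier A" "\<And>k. ?D (X k) (?\<iota> (y k)) < 1 / Suc k" by metis
    have lim: "(\<lambda>k. 1 / real (Suc k)) \<longlonglongrightarrow> 0" by (rule LIMSEQ_Suc[OF lim_1_over_n])
    have yc: "y \<in> cauchy_seqs A"
    proof (rule cauchyI[OF y(1)])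
      fix e :: real assume e: "0 < e"
      obtain M where M: "\<And>m n. m \<ge> M \<Longrightarrow> n \<ge> M \<Longrightarrow> ?D (X m) (X n) < e / 3"
        using Cau[of "e / 3"] e by auto
      obtain N where N: "\<And>k. k \<ge> N \<Longrightarrow> 1 / real (Suc k) < e / 3"
        using order_tendstoD(2)[OF lim, of "e / 3"] e by (auto simp: eventually_sequentially)
      have "nrm A (y m \<ominus> y n) < e" if mn: "m \<ge> max M N" "n \<ge> max M N" for m n
      proof -
        have "?D (?\<iota> (y m)) (?\<iota> (y n)) \<le> ?D (?\<iota> (y m)) (X m) + ?D (X m) (?\<iota> (y n))"
          using y X by (intro C.nrm_dist_triangle) auto
        also have "\<dots> \<le> ?D (?\<iota> (y m)) (X m) + (?D (X m) (X n) + ?D (X n) (?\<iota> (y n)))"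
          using y X by (intro add_left_mono C.nrm_dist_triangle) auto
        also have "?D (?\<iota> (y m)) (X m) = ?D (X m) (?\<iota> (y m))"
          using y X by (intro C.nrm_minus_commute) auto
        also have "\<dots> + (?D (X m) (X n) + ?D (X n) (?\<iota> (y n))) < e"
          using y(2)[of m] y(2)[of n] M[of m n] N[of m] N[of n] mn by simp
        finally show ?thesis using y by (simp add: D)
      qed
      then show "\<exists>M. \<forall>m\<ge>M. \<forall>n\<ge>M. nrm A (y m \<ominus> y n) < e" by blast
    qed
    have "(\<lambda>k. ?D (X k) (seq_class A y)) \<longlonglongrightarrow> 0"
    proof (rule tendsto_sandwich[of "\<lambda>k. 0"])
      show "(\<lambda>k. 1 / real (Suc k) + ?D (seq_class A y) (?\<iota> (y k))) \<longlonglongrightarrow> 0"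
        using tendsto_add[OF lim const_seq_class_tendsto[OF yc]] by simp
      have "?D (X k) (seq_class A y) \<le> 1 / real (Suc k) + ?D (seq_class A y) (?\<iota> (y k))" for k
      proof -
        have "?D (X k) (seq_class A y) \<le> ?D (X k) (?\<iota> (y k)) + ?D (?\<iota> (y k)) (seq_class A y)"
          using X y yc by (intro C.nrm_dist_triangle) auto
        moreover have "?D (?\<iota> (y k)) (seq_class A y) = ?D (seq_class A y) (?\<iota> (y k))"
          using y yc by (intro C.nrm_minus_commute) auto
        ultimately show ?thesis using y(2)[of k] by linarith
      qed
      then show "\<forall>\<^sub>F k in sequentially.
          ?D (X k) (seq_class A y) \<le> 1 / real (Suc k) + ?D (seq_class A y) (?\<iota> (y k))" by simp
    qed (use X yc in \<open>auto simp: C.nrm_nonneg\<close>)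
    then show "\<exists>a\<in>carrier (completion A). (\<lambda>k. ?D (X k) a) \<longlonglongrightarrow> 0" using yc by auto
  qed (rule C.m_closed C.m_assoc C.l_distr C.r_distr C.smult_closed C.smult_l_distr C.smult_r_distr
      C.smult_assoc C.smult_one C.smult_mult_l C.smult_mult_r C.adj_closed C.adj_adj C.adj_add
      C.adj_smult C.adj_mult C.nrm_nonneg C.nrm_triangle C.nrm_smult C.nrm_mult C.cstar_identity;
      assumption)+
qed

end

text \<open>Preservation of distances alone carries Cauchy sequences to Cauchy sequences and
  equivalent ones to equivalent ones, so the map descends to classes.\<close>

lemma (in seminormed_star_algebra) completion_induced_map:
  assumes closed: "\<And>a. a \<in> carrier A \<Longrightarrow> \<phi> a \<in> carrier A"
    and isometric: "\<And>a b. \<lbrakk>a \<in> carrier A; b \<in> carrier A\<rbrakk> \<Longrightarrow> nrm A (\<phi> a \<ominus> \<phi> b) = nrm A (a \<ominus> b)"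
    and x: "x \<in> cauchy_seqs A"
  shows "(\<lambda>n. \<phi> (x n)) \<in> cauchy_seqs A"
    and "(\<Union>x'\<in>seq_class A x. seq_class A (\<lambda>n. \<phi> (x' n))) = seq_class A (\<lambda>n. \<phi> (x n))"
proof -
  have c: "(\<lambda>n. \<phi> (x n)) \<in> cauchy_seqs A" if "x \<in> cauchy_seqs A" for x
    using that that by (rule cauchy_lipschitz[where K = 1])
      (use that in \<open>auto simp: closed isometric cauchy_closed nrm_nonneg\<close>)
  show "(\<lambda>n. \<phi> (x n)) \<in> cauchy_seqs A" by (rule c[OF x])
  have "seq_class A (\<lambda>n. \<phi> (x' n)) = seq_class A (\<lambda>n. \<phi> (x n))" if x': "x' \<in> seq_class A x" for x'
    using seq_class_memD[OF x'] x
    by (intro seq_class_eqI) (auto intro!: c simp: isometric cauchy_closed)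
  then show "(\<Union>x'\<in>seq_class A x. seq_class A (\<lambda>n. \<phi> (x' n))) = seq_class A (\<lambda>n. \<phi> (x n))"
    using seq_class_Union1[OF x, of "\<lambda>x. seq_class A (\<lambda>n. \<phi> (x n))"] by simp
qed

lemma (in seminormed_star_algebra) grading_automorphism_completion:
  assumes closed: "\<And>a. a \<in> carrier A \<Longrightarrow> \<phi> a \<in> carrier A"
    and add: "\<And>a b. \<lbrakk>a \<in> carrier A; b \<in> carrier A\<rbrakk> \<Longrightarrow> \<phi> (a \<oplus> b) = \<phi> a \<oplus> \<phi> b"
    and smult: "\<And>a z. a \<in> carrier A \<Longrightarrow> \<phi> (z \<odot> a) = z \<odot> \<phi> a"
    and mult: "\<And>a b. \<lbrakk>a \<in> carrier A; b \<in> carrier A\<rbrakk> \<Longrightarrow> \<phi> (a \<otimes> b) = \<phi> a \<otimes> \<phi> b"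
    and adj: "\<And>a. a \<in> carrier A \<Longrightarrow> \<phi> (adj A a) = adj A (\<phi> a)"
    and involutive: "\<And>a. a \<in> carrier A \<Longrightarrow> \<phi> (\<phi> a) = a"
    and isometric: "\<And>a. a \<in> carrier A \<Longrightarrow> nrm A (\<phi> a) = nrm A a"
  obtains \<alpha> where "grading_automorphism (completion A) \<alpha>"
    and "\<And>x. x \<in> cauchy_seqs A \<Longrightarrow> \<alpha> (seq_class A x) = seq_class A (\<lambda>n. \<phi> (x n))"
    and "\<And>a. a \<in> carrier (completion A) \<Longrightarrow> nrm (completion A) (\<alpha> a) = nrm (completion A) a"
proof -
  define \<alpha> where "\<alpha> X = (\<Union>x\<in>X. seq_class A (\<lambda>n. \<phi> (x n)))" for X
  have iso: "nrm A (\<phi> a \<ominus> \<phi> b) = nrm A (a \<ominus> b)" if "a \<in> carrier A" "b \<in> carrier A" for a b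
  proof -
    have "\<phi> (a \<ominus> b) = \<phi> a \<ominus> \<phi> b"
      using that by (simp add: a_minus_def minus_eq_smult add smult closed)
    then show ?thesis using isometric[of "a \<ominus> b"] that by simp
  qed
  note ind = completion_induced_map[of \<phi>, OF closed iso]
  have \<alpha>: "\<alpha> (seq_class A x) = seq_class A (\<lambda>n. \<phi> (x n))" if "x \<in> cauchy_seqs A" for x
    unfolding \<alpha>_def by (rule ind(2)) (use that in auto)
  have c: "(\<lambda>n. \<phi> (x n)) \<in> cauchy_seqs A" if "x \<in> cauchy_seqs A" for x
    by (rule ind(1)) (use that in auto)
  note ops = completion_add completion_mult completion_smult completion_adj \<alpha> c
    cauchy_add cauchy_mult cauchy_smult cauchy_adj cauchy_closed
  interpret C: cstar_algebra "completion A" by (rule cstar_algebra_completion)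
  have cl: "\<alpha> a \<in> carrier (completion A)" if "a \<in> carrier (completion A)" for a
    using that by (auto elim!: completion_cases simp: \<alpha> c)
  have inv: "\<alpha> (\<alpha> a) = a" if "a \<in> carrier (completion A)" for a
    using that by (auto elim!: completion_cases simp: \<alpha> c involutive cauchy_closed)
  have "grading_automorphism (completion A) \<alpha>"
  proof unfold_locales
    show "bij_betw \<alpha> (carrier (completion A)) (carrier (completion A))"
      by (rule bij_betw_byWitness[where f' = \<alpha>]) (use cl inv in auto)
    fix a assume "a \<in> carrier (completion A)"
    then show "\<alpha> (\<alpha> a) = a" by (rule inv)
  qed (auto elim!: completion_cases simp: ops add smult mult adj)
  moreover have "nrm (completion A) (\<alpha> a) = nrm (completion A) a"
    if a: "a \<in> carrier (completion A)" for a
  proof -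
    obtain x where x: "x \<in> cauchy_seqs A" "a = seq_class A x" using a by (rule completion_cases)
    then show ?thesis using completion_nrm_tendsto[OF x(1)]
      by (auto simp: \<alpha> c isometric cauchy_closed intro!: completion_nrm_eqI)
  qed
  ultimately show thesis using that \<alpha> by blast
qed

section \<open>The free *-algebra\<close>

lemma letters_plus [simp]: "letters (u + v) = letters u @ letters v"
  by (simp add: plus_word_def)

lemma flip_flip_letter [simp]: "flip_letter (flip_letter x) = x"
  by (cases x) simp_all

lemma flip_letter_comp [simp]: "flip_letter \<circ> flip_letter = id"
  by (simp add: fun_eq_iff)

lemma base_flip_letter [simp]: "base_letter (flip_letter x) = base_letter x"
  by (cases x) simp_all

lemma letters_word_star: "letters (word_star w) = rev (map flip_letter (letters w))"
  by (simp add: word_star_def)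

lemma word_star_star [simp]: "word_star (word_star w) = w"
  by (simp add: word_star_def rev_map)

lemma word_star_plus: "word_star (u + v) = word_star v + word_star u"
  by (rule word.expand) (simp add: letters_word_star)

lemma lookup_free_smult [simp]:
  "Poly_Mapping.lookup (free_smult z f) w = z * Poly_Mapping.lookup f w"
  by (simp add: free_smult_def Poly_Mapping.map.rep_eq when_def)

global_interpretation free: vector_space free_smult
  by unfold_locales (auto intro!: poly_mapping_eqI simp: lookup_add algebra_simps)

text \<open>Scalars are the elements supported on the empty word. They lie outside
  \<open>free_carrier\<close> but inside the ambient unital ring, so scalar laws reduce to ring
  laws; the same ring later supplies the unit in \<open>1 + b\<close>.\<close>

lemma free_smult_conv_mult: "free_smult z f = Poly_Mapping.single 0 z * f"
  by (simp add: free_smult_def mult_map_scale_conv_mult)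

lemma free_smult_mult_left: "free_smult z f * g = free_smult z (f * g)"
  by (simp add: free_smult_conv_mult mult.assoc)

lemma free_smult_single: "free_smult z (Poly_Mapping.single w a) = Poly_Mapping.single w (z * a)"
  by (simp add: free_smult_conv_mult mult_single)

lemma poly_mapping_sum_single:
  fixes f :: "'a \<Rightarrow>\<^sub>0 'b::comm_monoid_add"
  shows "f = (\<Sum>w\<in>Poly_Mapping.keys f. Poly_Mapping.single w (Poly_Mapping.lookup f w))"
  by (rule poly_mapping_eqI)
    (auto simp: lookup_sum lookup_single when_def in_keys_iff if_distrib cong: if_cong)

text \<open>Reduces additive and biadditive identities to monomials, where they become statements
  about words.\<close>

lemma poly_mapping_additive_induct [case_names zero add single]:
  fixes f :: "'a \<Rightarrow>\<^sub>0 'b::comm_monoid_add"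
  assumes "P 0" "\<And>f g. P f \<Longrightarrow> P g \<Longrightarrow> P (f + g)" "\<And>w a. P (Poly_Mapping.single w a)"
  shows "P f"
proof -
  have "P (\<Sum>w\<in>F. Poly_Mapping.single w (Poly_Mapping.lookup f w))" if "finite F" for F
    using that by (induction F) (auto intro: assms)
  then show ?thesis by (subst poly_mapping_sum_single) simp
qed

lemma free_smult_mult_right: "f * free_smult z g = free_smult z (f * g)"
proof (induction f rule: poly_mapping_additive_induct)
  case (single w a)
  have "Poly_Mapping.single w a * Poly_Mapping.single 0 z
      = Poly_Mapping.single 0 z * (Poly_Mapping.single w a :: 'a free_elt)"
    by (simp add: mult_single mult.commute)
  then show ?case by (simp add: free_smult_conv_mult mult.assoc[symmetric])
qed (simp_all add: algebra_simps free.scale_right_distrib)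

lemma lookup_free_star [simp]:
  "Poly_Mapping.lookup (free_star f) w = cnj (Poly_Mapping.lookup f (word_star w))"
proof -
  have eq: "word_star u = w \<longleftrightarrow> u = word_star w" for u by (metis word_star_star)
  show ?thesis
    by (simp add: free_star_def lookup_sum lookup_single when_def eq in_keys_iff)
qed

lemma free_star_add: "free_star (f + g) = free_star f + free_star g"
  and free_star_diff: "free_star (f - g) = free_star f - free_star g"
  and free_star_smult: "free_star (free_smult z f) = free_smult (cnj z) (free_star f)"
  and free_star_star [simp]: "free_star (free_star f) = f"
  and free_star_zero [simp]: "free_star 0 = 0"
  by (auto intro!: poly_mapping_eqI simp: lookup_add lookup_minus)

lemma free_star_single:
  "free_star (Poly_Mapping.single w a) = Poly_Mapping.single (word_star w) (cnj a)"
  by (rule poly_mapping_eqI) (auto simp: lookup_single when_def)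

lemma free_star_mult: "free_star (f * g) = free_star g * free_star f"
proof (induction f rule: poly_mapping_additive_induct)
  case (single u a)
  show ?case
  proof (induction g rule: poly_mapping_additive_induct)
    case (single v b)
    show ?case by (simp add: mult_single free_star_single word_star_plus mult.commute)
  qed (simp_all add: free_star_add algebra_simps)
qed (simp_all add: free_star_add algebra_simps)

lemma free_carrier_zero [simp]: "0 \<in> free_carrier X"
  by (simp add: free_carrier_def)

lemma free_carrier_add [simp]:
  "\<lbrakk>f \<in> free_carrier X; g \<in> free_carrier X\<rbrakk> \<Longrightarrow> f + g \<in> free_carrier X"
  using Poly_Mapping.keys_add[of f g] by (auto simp: free_carrier_def)

lemma free_carrier_smult [simp]: "f \<in> free_carrier X \<Longrightarrow> free_smult z f \<in> free_carrier X"
  by (auto simp: free_carrier_def in_keys_iff)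

lemma free_carrier_diff [simp]:
  assumes "f \<in> free_carrier X" "g \<in> free_carrier X" shows "f - g \<in> free_carrier X"
proof -
  have "f - g = f + free_smult (- 1) g" by (rule poly_mapping_eqI) (simp add: lookup_add lookup_minus)
  then show ?thesis by (metis assms free_carrier_add free_carrier_smult)
qed

lemma free_carrier_mult [simp]:
  assumes "f \<in> free_carrier X" "g \<in> free_carrier X" shows "f * g \<in> free_carrier X"
  using assms Poly_Mapping.keys_mult[of f g]
  unfolding free_carrier_def by (fastforce simp: image_Un)

lemma free_carrier_star [simp]: "f \<in> free_carrier X \<Longrightarrow> free_star f \<in> free_carrier X"
proof -
  assume f: "f \<in> free_carrier X"
  have "letters w \<noteq> [] \<and> base_letter ` set (letters w) \<subseteq> X"
    if w: "w \<in> Poly_Mapping.keys (free_star f)" for w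
  proof -
    have "word_star w \<in> Poly_Mapping.keys f" using w by (simp add: in_keys_iff)
    then have "letters (word_star w) \<noteq> []" "base_letter ` set (letters (word_star w)) \<subseteq> X"
      using f by (auto simp: free_carrier_def)
    then show ?thesis by (simp add: letters_word_star image_image)
  qed
  then show ?thesis by (simp add: free_carrier_def)
qed

lemma free_carrier_gen [simp]: "x \<in> X \<Longrightarrow> free_gen x \<in> free_carrier X"
  by (simp add: free_carrier_def free_gen_def)

lemma free_carrier_sum [simp]:
  "(\<And>i. i \<in> F \<Longrightarrow> f i \<in> free_carrier X) \<Longrightarrow> sum f F \<in> free_carrier X"
  by (induction F rule: infinite_finite_induct) simp_all

lemma free_carrier_single:
  "\<lbrakk>f \<in> free_carrier X; w \<in> Poly_Mapping.keys f\<rbrakk> \<Longrightarrow> Poly_Mapping.single w z \<in> free_carrier X"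
  by (cases "z = 0") (auto simp: free_carrier_def)

lemma single_Cons:
  "Poly_Mapping.single (Word (x # xs)) (1::complex)
    = Poly_Mapping.single (Word [x]) 1 * Poly_Mapping.single (Word xs) 1"
  by (simp add: mult_single plus_word_def)

lemma single_letter:
  "Poly_Mapping.single (Word [Plain x]) 1 = free_gen x"
  "Poly_Mapping.single (Word [Star x]) 1 = free_star (free_gen x)"
  by (simp_all add: free_gen_def free_star_single word_star_def)

subsection \<open>The action of a \<open>\<int>\<^sub>2\<close>-valued degree on the free *-algebra\<close>

lemma sign_add: "sign (i + j) = sign i * sign j"
  by (cases i; cases j) (simp_all add: sign_def)

lemma sign_square [simp]: "sign i * sign i = 1"
  by (simp add: sign_def)

lemma cnj_sign [simp]: "cnj (sign i) = sign i"
  by (simp add: sign_def)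

lemma norm_sign [simp]: "cmod (sign i) = 1"
  by (simp add: sign_def)

text \<open>Plain and starred letters count alike, since an adjoint has degree -\<delta> and
  -\<delta> = \<delta> in Z_2.\<close>

definition word_deg :: "('x \<Rightarrow> bit) \<Rightarrow> 'x word \<Rightarrow> bit"
  where "word_deg \<delta> w = (\<Sum>x\<leftarrow>letters w. \<delta> (base_letter x))"

lemma word_deg_plus: "word_deg \<delta> (u + v) = word_deg \<delta> u + word_deg \<delta> v"
  by (simp add: word_deg_def)

lemma word_deg_star [simp]: "word_deg \<delta> (word_star w) = word_deg \<delta> w"
  by (simp add: word_deg_def letters_word_star rev_map[symmetric] o_def)

definition free_twist :: "('x \<Rightarrow> bit) \<Rightarrow> 'x free_elt \<Rightarrow> 'x free_elt"
  where "free_twist \<delta> = Poly_Mapping.mapp (\<lambda>w z. sign (word_deg \<delta> w) * z)"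

lemma lookup_free_twist [simp]:
  "Poly_Mapping.lookup (free_twist \<delta> f) w = sign (word_deg \<delta> w) * Poly_Mapping.lookup f w"
  by (simp add: free_twist_def lookup_mapp when_def in_keys_iff)

lemma free_twist_add: "free_twist \<delta> (f + g) = free_twist \<delta> f + free_twist \<delta> g"
  and free_twist_diff: "free_twist \<delta> (f - g) = free_twist \<delta> f - free_twist \<delta> g"
  and free_twist_smult: "free_twist \<delta> (free_smult z f) = free_smult z (free_twist \<delta> f)"
  and free_twist_star: "free_twist \<delta> (free_star f) = free_star (free_twist \<delta> f)"
  and free_twist_zero [simp]: "free_twist \<delta> 0 = 0"
  by (auto intro!: poly_mapping_eqI simp: lookup_add lookup_minus algebra_simps)

lemma free_twist_twist [simp]: "free_twist \<delta> (free_twist \<delta> f) = f"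
  by (rule poly_mapping_eqI) (simp flip: mult.assoc)

lemma free_twist_sum: "free_twist \<delta> (sum f F) = (\<Sum>i\<in>F. free_twist \<delta> (f i))"
  by (induction F rule: infinite_finite_induct) (simp_all add: free_twist_add)

lemma free_twist_single:
  "free_twist \<delta> (Poly_Mapping.single w z) = Poly_Mapping.single w (sign (word_deg \<delta> w) * z)"
  by (rule poly_mapping_eqI) (auto simp: lookup_single when_def)

lemma free_twist_gen: "free_twist \<delta> (free_gen x) = free_smult (sign (\<delta> x)) (free_gen x)"
  by (simp add: free_gen_def free_twist_single free_smult_single word_deg_def)

lemma free_twist_mult: "free_twist \<delta> (f * g) = free_twist \<delta> f * free_twist \<delta> g"
proof (induction f rule: poly_mapping_additive_induct)
  case (single u a)
  show ?case
  proof (induction g rule: poly_mapping_additive_induct)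
    case (single v b)
    have "sign (word_deg \<delta> (u + v)) = sign (word_deg \<delta> u) * sign (word_deg \<delta> v)"
      unfolding word_deg_plus by (rule sign_add)
    then show ?case by (simp add: mult_single free_twist_single mult_ac)
  qed (simp_all add: free_twist_add algebra_simps)
qed (simp_all add: free_twist_add algebra_simps)

lemma free_twist_closed [simp]: "f \<in> free_carrier X \<Longrightarrow> free_twist \<delta> f \<in> free_carrier X"
  by (auto simp: free_carrier_def in_keys_iff)

section \<open>C*-seminorms on the free *-algebra\<close>

lemma free_star_algebra_simps [simp]:
  "carrier (free_star_algebra X R) = free_carrier X"
  "f \<otimes>\<^bsub>free_star_algebra X R\<^esub> g = f * g"
  "f \<oplus>\<^bsub>free_star_algebra X R\<^esub> g = f + g"
  "\<zero>\<^bsub>free_star_algebra X R\<^esub> = 0"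
  "z \<odot>\<^bsub>free_star_algebra X R\<^esub> f = free_smult z f"
  "adj (free_star_algebra X R) = free_star"
  "nrm (free_star_algebra X R) = universal_seminorm X R"
  by (simp_all add: free_star_algebra_def)

text \<open>The norm field is overwritten by an arbitrary C*-seminorm, so the general lemmas apply
  to every competitor before anything is known about the universal seminorm.\<close>

lemma seminormed_free_star_algebra:
  assumes p: "p \<in> cstar_seminorms X"
  shows "seminormed_star_algebra ((free_star_algebra X R)\<lparr>nrm := p\<rparr>)" (is "seminormed_star_algebra ?A")
proof -
  have car: "carrier ?A = free_carrier X" "(\<otimes>\<^bsub>?A\<^esub>) = (*)" "(\<oplus>\<^bsub>?A\<^esub>) = (+)" "\<zero>\<^bsub>?A\<^esub> = 0"
    "(\<odot>\<^bsub>?A\<^esub>) = free_smult" "adj ?A = free_star" "nrm ?A = p"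
    by (simp_all add: free_star_algebra_def)
  interpret abelian_group ?A
  proof (rule abelian_groupI, unfold car)
    fix f assume "f \<in> free_carrier X"
    then show "\<exists>g\<in>free_carrier X. g + f = 0" by (intro bexI[of _ "0 - f"] free_carrier_diff) auto
  qed (auto simp: algebra_simps)
  show ?thesis
    by (unfold_locales, unfold car)
      (use p in \<open>auto simp: cstar_seminorms_def mult.assoc distrib_left distrib_right
        free.scale_right_distrib free.scale_left_distrib free_smult_mult_left free_smult_mult_right
        free_star_add free_star_smult free_star_mult\<close>)
qed

section \<open>Congruence modulo the null space of a C*-seminorm\<close>

locale cstar_seminorm =
  fixes X :: "'x set" and p :: "'x free_elt \<Rightarrow> real"
  assumes seminorm: "p \<in> cstar_seminorms X"
begin

lemma nonneg: "f \<in> free_carrier X \<Longrightarrow> 0 \<le> p f"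
  and smult: "f \<in> free_carrier X \<Longrightarrow> p (free_smult z f) = cmod z * p f"
  and triangle: "\<lbrakk>f \<in> free_carrier X; g \<in> free_carrier X\<rbrakk> \<Longrightarrow> p (f + g) \<le> p f + p g"
  and submult: "\<lbrakk>f \<in> free_carrier X; g \<in> free_carrier X\<rbrakk> \<Longrightarrow> p (f * g) \<le> p f * p g"
  and cstar: "f \<in> free_carrier X \<Longrightarrow> p (free_star f * f) = (p f)\<^sup>2"
  using seminorm by (auto simp: cstar_seminorms_def)

lemma star: "f \<in> free_carrier X \<Longrightarrow> p (free_star f) = p f"
  using seminormed_star_algebra.nrm_adj[OF seminormed_free_star_algebra[OF seminorm, of "{}"], of f]
  by simp

lemma zero [simp]: "p 0 = 0"
  using smult[of 0 0] by simp

lemma triangle_sum: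
  "(\<And>i. i \<in> F \<Longrightarrow> f i \<in> free_carrier X) \<Longrightarrow> p (sum f F) \<le> (\<Sum>i\<in>F. p (f i))"
proof (induction F rule: infinite_finite_induct)
  case (insert i F)
  then show ?case using triangle[of "f i" "sum f F"] by auto
qed simp_all

text \<open>Stands for equality in the quotient by the null ideal. Membership of both sides in the
  carrier is built in, so that chains of congruences carry their own side conditions.\<close>

definition eqv :: "'x free_elt \<Rightarrow> 'x free_elt \<Rightarrow> bool" (infix "\<doteq>" 50)
  where "f \<doteq> g \<longleftrightarrow> f \<in> free_carrier X \<and> g \<in> free_carrier X \<and> p (f - g) = 0"

lemma eqvD: assumes "f \<doteq> g" shows "f \<in> free_carrier X" "g \<in> free_carrier X" "p (f - g) = 0"
  using assms by (simp_all add: eqv_def)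

lemma eqv_refl [simp]: "f \<in> free_carrier X \<Longrightarrow> f \<doteq> f"
  by (simp add: eqv_def)

lemma eqv_sym: "f \<doteq> g \<Longrightarrow> g \<doteq> f"
  using smult[of "f - g" "- 1"] by (simp add: eqv_def free.scale_minus_left)

lemma eqv_add: assumes "f \<doteq> g" "f' \<doteq> g'" shows "f + f' \<doteq> g + g'"
proof -
  have "p ((f - g) + (f' - g')) \<le> 0"
    using triangle[of "f - g" "f' - g'"] assms by (simp add: eqv_def)
  moreover have "0 \<le> p ((f - g) + (f' - g'))" using assms by (intro nonneg) (auto simp: eqv_def)
  ultimately show ?thesis using assms by (simp add: eqv_def algebra_simps)
qed

lemma eqv_trans [trans]: "f \<doteq> g \<Longrightarrow> g \<doteq> h \<Longrightarrow> f \<doteq> h"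
  using eqv_add[of f g g h] by (simp add: eqv_def)

lemma eqv_smult: "f \<doteq> g \<Longrightarrow> free_smult z f \<doteq> free_smult z g"
  using smult[of "f - g" z] by (simp add: eqv_def free.scale_right_diff_distrib)

lemma eqv_diff: assumes "f \<doteq> g" "f' \<doteq> g'" shows "f - f' \<doteq> g - g'"
  using eqv_add[OF assms(1) eqv_smult[OF assms(2), of "- 1"]] by (simp add: free.scale_minus_left)

lemma eqv_mult_right: assumes "f \<doteq> g" "h \<in> free_carrier X" shows "f * h \<doteq> g * h"
  using submult[of "f - g" h] nonneg[of "(f - g) * h"] assms by (simp add: eqv_def algebra_simps)

lemma eqv_mult_left: assumes "f \<doteq> g" "h \<in> free_carrier X" shows "h * f \<doteq> h * g"
  using submult[of h "f - g"] nonneg[of "h * (f - g)"] assms by (simp add: eqv_def algebra_simps)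

lemma eqv_mult: assumes "f \<doteq> g" "f' \<doteq> g'" shows "f * f' \<doteq> g * g'"
  using eqv_mult_right[OF assms(1) eqvD(1)[OF assms(2)]]
    eqv_mult_left[OF assms(2) eqvD(2)[OF assms(1)]] by (rule eqv_trans)

lemma eqv_star: assumes "f \<doteq> g" shows "free_star f \<doteq> free_star g"
  using star[of "f - g"] assms by (simp add: eqv_def free_star_diff)

lemma eqv_imp_eq: assumes "f \<doteq> g" shows "p f = p g"
  using triangle[of "f - g" g] triangle[of "g - f" f] eqv_sym[OF assms] assms
  by (simp add: eqv_def)

lemma eqv_zero_iff: "f \<doteq> 0 \<longleftrightarrow> f \<in> free_carrier X \<and> p f = 0"
  by (simp add: eqv_def)

text \<open>The C*-identity makes \<open>p q\<close> equal to its own square, hence 0 or 1.\<close>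

lemma projection_norm_le_1:
  assumes "free_star q \<doteq> q" "q * q \<doteq> q" shows "p q \<le> 1"
proof -
  have q: "q \<in> free_carrier X" using assms(1) by (rule eqvD)
  have "free_star q * q \<doteq> q" using eqv_mult_right[OF assms(1) q] assms(2) by (rule eqv_trans)
  then have "(p q)\<^sup>2 = p q" using cstar[OF q] eqv_imp_eq by metis
  then show ?thesis by (auto simp: power2_eq_square)
qed

end

subsection \<open>An extreme point argument\<close>

text \<open>The coefficient of \<open>X\<^sup>j\<close> in \<open>X (1 + X)\<^sup>N\<close>.\<close>

definition shifted_binomial :: "nat \<Rightarrow> nat \<Rightarrow> nat"
  where "shifted_binomial N j = (case j of 0 \<Rightarrow> 0 | Suc i \<Rightarrow> N choose i)"

lemma shifted_binomial_simps [simp]: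
  "shifted_binomial N 0 = 0" "shifted_binomial N (Suc i) = (N choose i)"
  by (simp_all add: shifted_binomial_def)

context
  fixes c d :: "'a::ring_1"
  assumes commute: "c * d = d * c"
begin

text \<open>Both products are expanded over the same monomials of degree \<open>Suc N\<close>, so
  that adding them gives Pascal's rule and subtracting them gives the coefficients wanted below. The
  padding terms, at \<open>j = 0\<close> for \<open>c\<close> and at \<open>j = Suc N\<close> for
  \<open>d\<close>, have coefficient 0.\<close>

private lemma mult_binomial_sum:
  shows "c * (\<Sum>j\<le>N. of_nat (N choose j) * (c ^ j * d ^ (N - j)))
      = (\<Sum>j\<le>Suc N. of_nat (shifted_binomial N j) * (c ^ j * d ^ (Suc N - j)))" (is ?c)
    and "d * (\<Sum>j\<le>N. of_nat (N choose j) * (c ^ j * d ^ (N - j)))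
      = (\<Sum>j\<le>Suc N. of_nat (N choose j) * (c ^ j * d ^ (Suc N - j)))" (is ?d)
proof -
  have n: "x * (of_nat k * y) = of_nat k * (x * y)" for x y :: 'a and k
    by (metis mult.assoc mult_of_nat_commute)
  show ?c
    by (subst sum.atMost_Suc_shift) (simp add: sum_distrib_left n mult.assoc)
  have "d * (c ^ j * d ^ (N - j)) = c ^ j * d ^ (Suc N - j)" if "j \<le> N" for j
  proof -
    have "d * c ^ j = c ^ j * d" by (rule power_commuting_commutes[symmetric]) (rule commute)
    then have "d * (c ^ j * d ^ (N - j)) = c ^ j * d ^ Suc (N - j)"
      by (metis mult.assoc power_Suc)
    then show ?thesis using that by (simp add: Suc_diff_le)
  qed
  then show ?d by (simp add: sum_distrib_left n binomial_eq_0)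
qed

lemma commuting_binomial:
  "(c + d) ^ N = (\<Sum>j\<le>N. of_nat (N choose j) * (c ^ j * d ^ (N - j)))"
proof (induction N)
  case (Suc N)
  have "of_nat (shifted_binomial N j) + of_nat (N choose j) = (of_nat (Suc N choose j) :: 'a)" for j
    by (cases j) simp_all
  then show ?case
    by (simp only: power_Suc Suc distrib_right mult_binomial_sum sum.distrib[symmetric]
        distrib_right[symmetric])
qed simp

lemma commuting_binomial_difference:
  "(c - d) * (c + d) ^ N
    = (\<Sum>j\<le>Suc N. of_int (int (shifted_binomial N j) - int (N choose j)) * (c ^ j * d ^ (Suc N - j)))"
  by (simp only: commuting_binomial left_diff_distrib mult_binomial_sum sum_subtractf[symmetric]
      of_int_diff of_int_of_nat_eq)

end

text \<open>An even row increases up to its middle and decreases afterwards. The consecutive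
  differences telescope, so each half contributes the central coefficient; the total is 0 because
  the row vanishes at position \<open>Suc (2 * m)\<close>.\<close>

lemma sum_abs_binomial_differences:
  "(\<Sum>j\<le>Suc (2 * m). \<bar>real (shifted_binomial (2 * m) j) - real (2 * m choose j)\<bar>)
    = 2 * real (2 * m choose m)"
proof -
  let ?g = "\<lambda>j. real (2 * m choose j) - real (shifted_binomial (2 * m) j)"
  have tel: "(\<Sum>j\<le>n. ?g j) = real (2 * m choose n)" for n
    by (induction n) simp_all
  have split: "{..Suc (2 * m)} = {..m} \<union> {Suc m..Suc (2 * m)}" by auto
  have lo: "\<bar>- ?g j\<bar> = ?g j" if "j \<le> m" for j
    using that binomial_mono[of "j - 1" j "2 * m"] by (cases j) auto
  have hi: "\<bar>- ?g j\<bar> = - ?g j" if "j \<in> {Suc m..Suc (2 * m)}" for j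
  proof (cases j)
    case (Suc i)
    then show ?thesis using that binomial_antimono[of i j "2 * m"]
      by (cases "j = Suc (2 * m)") (auto simp: binomial_eq_0)
  qed (use that in simp)
  have "(\<Sum>j\<le>m. ?g j) + (\<Sum>j=Suc m..Suc (2 * m). ?g j) = 0"
    using tel[of "Suc (2 * m)"] unfolding split by (subst (asm) sum.union_disjoint) (auto simp: binomial_eq_0)
  moreover have "(\<Sum>j\<le>Suc (2 * m). \<bar>- ?g j\<bar>) = (\<Sum>j\<le>m. ?g j) + (\<Sum>j=Suc m..Suc (2 * m). - ?g j)"
    unfolding split by (subst sum.union_disjoint) (use lo hi in \<open>auto intro!: arg_cong2[where f = "(+)"] sum.cong\<close>)
  ultimately have "(\<Sum>j\<le>Suc (2 * m). \<bar>- ?g j\<bar>) = 2 * real (2 * m choose m)"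
    using tel[of m] unfolding sum_negf by linarith
  then show ?thesis by (simp only: minus_diff_eq)
qed

text \<open>The factor \<open>2 * real m + 1\<close> is what lets the induction close: successive
  normalised coefficients have ratio (2m+1)/(2m+2), and (2m+1)(2m+3) \<le> (2m+2)^2.\<close>

lemma central_binomial_upper_bound: "(real (2 * m choose m) / 4 ^ m)\<^sup>2 * (2 * real m + 1) \<le> 1"
proof (induction m)
  case (Suc m)
  \<comment> \<open>The absorption identity is applied to rows 2m+2 and 2m+1, with the symmetry of
    row 2m+1 in between.\<close>
  have "Suc m * (2 * Suc m choose Suc m) = 2 * (2 * m + 1) * (2 * m choose m)"
  proof -
    have absorb: "Suc m * (Suc n choose Suc m) = Suc n * (n choose m)" for n
      using Suc_times_binomial_eq[of n m] by (simp only: mult.commute)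
    have "Suc (2 * m) choose m = Suc (2 * m) choose Suc m"
      using binomial_symmetric[of m "Suc (2 * m)"] by (simp del: binomial_Suc_Suc)
    then have "Suc m * (Suc (Suc (2 * m)) choose Suc m) = 2 * (Suc m * (Suc (2 * m) choose Suc m))"
      using absorb[of "Suc (2 * m)"] by (simp del: binomial_Suc_Suc)
    also have "\<dots> = 2 * (2 * m + 1) * (2 * m choose m)"
      unfolding absorb by simp
    finally show ?thesis by (simp del: binomial_Suc_Suc)
  qed
  then have "real (Suc m * (2 * Suc m choose Suc m)) = real (2 * (2 * m + 1) * (2 * m choose m))"
    by (rule arg_cong)
  then have "real (Suc m) * real (2 * Suc m choose Suc m) = 2 * (2 * real m + 1) * real (2 * m choose m)"
    by (simp only: of_nat_mult of_nat_add of_nat_numeral of_nat_1)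
  moreover have "x' / (4 * q) = t / (2 * n) * (x / q)" if "n * x' = 2 * t * x" "0 < n" "0 < q"
    for n t q x x' :: real
    using that by (simp add: field_simps)
  ultimately have rec: "real (2 * Suc m choose Suc m) / 4 ^ Suc m
      = (2 * real m + 1) / (2 * real (Suc m)) * (real (2 * m choose m) / 4 ^ m)"
    unfolding power_Suc by (metis of_nat_0_less_iff zero_less_Suc zero_less_numeral zero_less_power)
  have coeff: "((2 * real m + 1) / (2 * real (Suc m)))\<^sup>2 * (2 * real (Suc m) + 1) \<le> 2 * real m + 1"
  proof -
    have "(2 * real m + 1)\<^sup>2 * (2 * real (Suc m) + 1) \<le> (2 * real m + 1) * (2 * real (Suc m))\<^sup>2"
      by (simp add: power2_eq_square algebra_simps)
    moreover have "0 < (2 * real (Suc m))\<^sup>2" by simp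
    ultimately show ?thesis
      unfolding power_divide times_divide_eq_left by (simp only: pos_divide_le_eq)
  qed
  have "(real (2 * Suc m choose Suc m) / 4 ^ Suc m)\<^sup>2 * (2 * real (Suc m) + 1)
      = ((2 * real m + 1) / (2 * real (Suc m)))\<^sup>2 * (2 * real (Suc m) + 1)
        * (real (2 * m choose m) / 4 ^ m)\<^sup>2"
    by (simp only: rec power_mult_distrib) (simp only: mult_ac)
  also have "\<dots> \<le> (2 * real m + 1) * (real (2 * m choose m) / 4 ^ m)\<^sup>2"
    by (rule mult_right_mono[OF coeff]) simp
  also have "\<dots> \<le> 1" using Suc by (simp only: mult.commute)
  finally show ?case .
qed simp

lemma central_binomial_tendsto_0: "(\<lambda>m. real (2 * m choose m) / 4 ^ m) \<longlonglongrightarrow> 0"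
proof -
  have "(\<lambda>m. (real (2 * m choose m) / 4 ^ m)\<^sup>2) \<longlonglongrightarrow> 0"
  proof (rule tendsto_sandwich[OF _ _ tendsto_const LIMSEQ_inverse_real_of_nat])
    have "(real (2 * m choose m) / 4 ^ m)\<^sup>2 \<le> inverse (real (Suc m))" for m
    proof -
      have "(real (2 * m choose m) / 4 ^ m)\<^sup>2 * real (Suc m)
          \<le> (real (2 * m choose m) / 4 ^ m)\<^sup>2 * (2 * real m + 1)"
        by (intro mult_left_mono) auto
      also have "\<dots> \<le> 1" by (rule central_binomial_upper_bound)
      finally show ?thesis by (simp add: field_simps)
    qed
    then show "\<forall>\<^sub>F m in sequentially. (real (2 * m choose m) / 4 ^ m)\<^sup>2 \<le> inverse (real (Suc m))"
      by (rule always_eventually[OF allI])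
  qed auto
  then show ?thesis by (simp add: power_tendsto_0_iff)
qed

context cstar_seminorm
begin

lemma of_int_mult: "f \<in> free_carrier X \<Longrightarrow> p (of_int n * f) = \<bar>real_of_int n\<bar> * p f"
proof -
  assume f: "f \<in> free_carrier X"
  have "of_int n * f = free_smult (of_int n) f" by (simp add: free_smult_conv_mult)
  then show ?thesis using smult[OF f, of "of_int n"] by simp
qed

lemma free_carrier_of_int_mult: "f \<in> free_carrier X \<Longrightarrow> of_int n * f \<in> free_carrier X"
  using free_carrier_smult[of f X "of_int n"] by (simp add: free_smult_conv_mult)

text \<open>
  A unit \<open>e\<close> is an extreme point of the unit ball: with \<open>c = 1 + b\<close> and \<open>d = 1 - b\<close> the element
  \<open>2\<^sup>N\<^sup>+\<^sup>1 e b = e (c - d) (c + d)\<^sup>N\<close> is a combination of the contractions \<open>e c\<^sup>j d\<^sup>k\<close> whose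
  coefficients, differences of consecutive binomial coefficients, are of total size \<open>o(2\<^sup>N)\<close>.
\<close>

lemma extreme_point:
  assumes e: "e \<in> free_carrier X" "e * e \<doteq> e" "p e \<le> 1"
    and b: "b \<in> free_carrier X" "e * b \<doteq> b" "b * e \<doteq> b"
    and le: "p (e + b) \<le> 1" "p (e - b) \<le> 1"
  shows "p b = 0"
proof -
  let ?c = "1 + b" and ?d = "1 - b"
  \<comment> \<open>Right multiples of \<open>e\<close> that are contractions. Since
    \<open>f * e \<doteq> f\<close>, multiplying \<open>f\<close> by \<open>1 + b\<close> or
    \<open>1 - b\<close> is the same, up to null elements, as multiplying by the contractions
    \<open>e + b\<close> or \<open>e - b\<close>; hence \<open>V\<close> is stable. The ring unit is
    not in the carrier, so \<open>p\<close> is applied only to products that begin with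
    \<open>e\<close>.\<close>
  define V where "V = {f \<in> free_carrier X. f * e \<doteq> f \<and> p f \<le> 1}"
  have V: "f * ?c \<in> V" "f * ?d \<in> V" if f: "f \<in> V" for f
  proof -
    have fe: "f \<in> free_carrier X" "f * e \<doteq> f" "p f \<le> 1" using f by (auto simp: V_def)
    have fb: "f * (b * e) \<doteq> f * b" by (rule eqv_mult_left) (use b fe in auto)
    have "f * (e + b) \<doteq> f * ?c" "f * (e - b) \<doteq> f * ?d"
      using eqv_add[OF fe(2) eqv_refl[of "f * b"]] eqv_diff[OF fe(2) eqv_refl[of "f * b"]] fe b
      by (simp_all add: algebra_simps)
    then have "p (f * ?c) = p (f * (e + b))" "p (f * ?d) = p (f * (e - b))"
      by (metis eqv_imp_eq)+
    moreover have "p f * p (e + b) \<le> 1 * 1" "p f * p (e - b) \<le> 1 * 1"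
      by (rule mult_mono; use fe le e b in \<open>simp add: nonneg\<close>)+
    ultimately have "p (f * ?c) \<le> 1" "p (f * ?d) \<le> 1"
      using submult[of f "e + b"] submult[of f "e - b"] fe e b by simp_all
    moreover have "f * ?c * e \<doteq> f * ?c" "f * ?d * e \<doteq> f * ?d"
      using eqv_add[OF fe(2) fb] eqv_diff[OF fe(2) fb] by (simp_all add: algebra_simps)
    moreover have "f * ?c \<in> free_carrier X" "f * ?d \<in> free_carrier X"
      using fe b by (simp_all add: algebra_simps)
    ultimately show "f * ?c \<in> V" "f * ?d \<in> V" by (simp_all add: V_def)
  qed
  have W: "e * (?c ^ j * ?d ^ k) \<in> V" for j k
  proof -
    have "e * ?c ^ j \<in> V"
    proof (induction j)
      case (Suc j) then show ?case using V(1)[of "e * ?c ^ j"] by (simp add: power_Suc2 mult.assoc del: power_Suc)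
    qed (use e in \<open>simp add: V_def\<close>)
    then show ?thesis
    proof (induction k)
      case (Suc k) then show ?case using V(2)[of "e * (?c ^ j * ?d ^ k)"]
        by (simp add: power_Suc2 mult.assoc del: power_Suc)
    qed simp
  qed
  \<comment> \<open>The exponent is taken even, N = 2m, so that the coefficients have absolute sum
    exactly twice the central binomial coefficient, against the factor 2 * 4^m in front of
    \<open>e * b\<close>.\<close>
  have bound: "p b \<le> real (2 * m choose m) / 4 ^ m" for m
  proof -
    let ?k = "\<lambda>j. int (shifted_binomial (2 * m) j) - int (2 * m choose j)"
    let ?S = "\<Sum>j\<le>Suc (2 * m). of_int (?k j) * (e * (?c ^ j * ?d ^ (Suc (2 * m) - j)))"
    have n: "e * (of_int k * y) = of_int k * (e * y)" for y k
      by (metis mult.assoc mult_of_int_commute)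
    have cd: "?c * ?d = ?d * ?c" by (simp add: algebra_simps)
    have "?c - ?d = 2 * b" by (simp add: mult_2)
    moreover have "(?c + ?d) ^ (2 * m) = of_int (4 ^ m)" by (simp add: power_mult)
    ultimately have "e * ((?c - ?d) * (?c + ?d) ^ (2 * m)) = e * (2 * b * of_int (4 ^ m))"
      by (simp only:)
    also have "2 * b * of_int (4 ^ m) = 2 * (of_int (4 ^ m) * b)"
      by (simp only: mult.assoc mult_of_int_commute)
    also have "\<dots> = of_int (2 * 4 ^ m) * b" by (simp add: mult.assoc)
    also have "e * (of_int (2 * 4 ^ m) * b) = of_int (2 * 4 ^ m) * (e * b)" by (rule n)
    finally have "of_int (2 * 4 ^ m) * (e * b) = e * ((?c - ?d) * (?c + ?d) ^ (2 * m))" by (rule sym)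
    also have "\<dots> = ?S"
      by (simp only: commuting_binomial_difference[OF cd] sum_distrib_left n)
    finally have eq: "of_int (2 * 4 ^ m) * (e * b) = ?S" .
    have "2 * 4 ^ m * p b = p (of_int (2 * 4 ^ m) * (e * b))"
      using eqv_imp_eq[OF b(2)] e b by (subst of_int_mult) auto
    also have "\<dots> \<le> (\<Sum>j\<le>Suc (2 * m). p (of_int (?k j) * (e * (?c ^ j * ?d ^ (Suc (2 * m) - j)))))"
      unfolding eq
      by (intro triangle_sum free_carrier_of_int_mult) (use W in \<open>simp add: V_def\<close>)
    also have "\<dots> \<le> (\<Sum>j\<le>Suc (2 * m). \<bar>real (shifted_binomial (2 * m) j) - real (2 * m choose j)\<bar>)"
    proof (rule sum_mono)
      fix j
      let ?w = "e * (?c ^ j * ?d ^ (Suc (2 * m) - j))"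
      have w: "?w \<in> free_carrier X" "p ?w \<le> 1" using W[of j "Suc (2 * m) - j"] by (auto simp: V_def)
      have "p (of_int (?k j) * ?w) = \<bar>real_of_int (?k j)\<bar> * p ?w" by (rule of_int_mult[OF w(1)])
      also have "\<dots> \<le> \<bar>real_of_int (?k j)\<bar> * 1" by (rule mult_left_mono) (use w in auto)
      finally show "p (of_int (?k j) * ?w) \<le> \<bar>real (shifted_binomial (2 * m) j) - real (2 * m choose j)\<bar>"
        by simp
    qed
    finally show ?thesis unfolding sum_abs_binomial_differences by (simp add: field_simps)
  qed
  have "p b \<le> 0" by (rule LIMSEQ_le_const[OF central_binomial_tendsto_0]) (use bound in auto)
  then show ?thesis using nonneg[OF b(1)] by simp
qed

text \<open>
  Each \<open>b i\<close> is positive in the sense \<open>p (e - b i) \<le> 1\<close>; the vanishing sum makes \<open>- b i\<close>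
  positive as well.
\<close>

lemma sum_positive_eq_0:
  assumes F: "finite F"
    and e: "e \<in> free_carrier X" "e * e \<doteq> e" "p e \<le> 1"
    and b: "\<And>i. i \<in> F \<Longrightarrow> b i \<in> free_carrier X" "\<And>i. i \<in> F \<Longrightarrow> e * b i \<doteq> b i"
      "\<And>i. i \<in> F \<Longrightarrow> b i * e \<doteq> b i" "\<And>i. i \<in> F \<Longrightarrow> p (e - b i) \<le> 1"
    and sum: "sum b F \<doteq> 0" and i: "i \<in> F"
  shows "p (b i) = 0"
proof -
  define m where "m = card F"
  have m: "0 < m" using F i by (auto simp: m_def card_gt_0_iff)
  \<comment> \<open>Dividing by the number \<open>m\<close> of elements turns sums of
    \<open>m\<close> contractions into means; \<open>extreme_point\<close> is applied to
    \<open>b i / m\<close>.\<close>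
  define z :: complex where "z = 1 / of_nat m"
  have z: "cmod z = 1 / m" by (simp add: z_def norm_divide)
  have mz: "free_smult z (of_nat m * f) = f" for f :: "'x free_elt"
  proof -
    have "of_nat m * f = free_smult (of_nat m) f" by (simp add: free_smult_conv_mult)
    then show ?thesis using m by (simp add: z_def)
  qed
  let ?b = "free_smult z (b i)"
  have bi: "b i \<in> free_carrier X" using b i by blast
  have rest: "(\<Sum>j\<in>F - {i}. e - b j) \<in> free_carrier X" by (intro free_carrier_sum free_carrier_diff) (use e b in auto)
  \<comment> \<open>The right side consists of \<open>m - 1\<close> contractions
    \<open>e - b j\<close>, one further contraction \<open>e\<close>, and a null element. This is
    the only place where the vanishing sum enters, and it bounds \<open>e + b i / m\<close>.\<close>
  have "of_nat m * e + b i = (\<Sum>j\<in>F - {i}. e - b j) + e + sum b F"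
  proof -
    have "(\<Sum>j\<in>F - {i}. e - b j) = of_nat (m - 1) * e - (sum b F - b i)"
      using F i by (simp add: sum_subtractf m_def sum_diff1)
    moreover have "of_nat m * e = of_nat (m - 1) * e + e"
      using m by (cases m) (simp_all add: algebra_simps)
    ultimately show ?thesis by simp
  qed
  moreover have "(\<Sum>j\<in>F - {i}. e - b j) + e + sum b F \<doteq> (\<Sum>j\<in>F - {i}. e - b j) + e + 0"
    using rest e sum by (intro eqv_add eqv_refl) auto
  ultimately have "p (of_nat m * e + b i) = p ((\<Sum>j\<in>F - {i}. e - b j) + e)"
    using eqv_imp_eq by fastforce
  also have "\<dots> \<le> (\<Sum>j\<in>F - {i}. p (e - b j)) + p e"
    using triangle[OF rest e(1)] triangle_sum[of "F - {i}" "\<lambda>j. e - b j"] e b by fastforce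
  also have "\<dots> \<le> (\<Sum>j\<in>F - {i}. 1) + 1"
    using b e by (intro add_mono sum_mono) auto
  also have "\<dots> = real m" using F i m by (simp add: m_def of_nat_diff)
  finally have m_le: "p (of_nat m * e + b i) \<le> real m" .
  have me: "of_nat m * e \<in> free_carrier X"
    using free_carrier_of_int_mult[OF e(1), of "int m"] by simp
  have "p ?b = 0"
  proof (rule extreme_point[OF e])
    show "?b \<in> free_carrier X" using bi by simp
    show "e * ?b \<doteq> ?b" "?b * e \<doteq> ?b"
      using eqv_smult[OF b(2)[OF i]] eqv_smult[OF b(3)[OF i]]
      by (simp_all add: free_smult_mult_left free_smult_mult_right)
    have "e + ?b = free_smult z (of_nat m * e + b i)" by (simp add: free.scale_right_distrib mz)
    then show "p (e + ?b) \<le> 1" using smult[of "of_nat m * e + b i" z] me bi m_le m z by simp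
    \<comment> \<open>The other sign is a mean as well: \<open>m - 1\<close> copies of
      \<open>e\<close> and one copy of the contraction \<open>e - b i\<close>.\<close>
    have "e - ?b = free_smult z (of_nat (m - 1) * e + (e - b i))"
    proof -
      have "of_nat (m - 1) * e + (e - b i) = of_nat m * e - b i"
        using m by (cases m) (simp_all add: algebra_simps)
      then show ?thesis by (simp only: free.scale_right_diff_distrib mz)
    qed
    moreover have "p (of_nat (m - 1) * e + (e - b i)) \<le> real (m - 1) * 1 + 1"
    proof -
      have me': "of_nat (m - 1) * e \<in> free_carrier X" "p (of_nat (m - 1) * e) = real (m - 1) * p e"
        using free_carrier_of_int_mult[OF e(1), of "int (m - 1)"] of_int_mult[OF e(1), of "int (m - 1)"]
        by simp_all
      have "real (m - 1) * p e \<le> real (m - 1) * 1" by (rule mult_left_mono) (use e in auto)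
      then show ?thesis
        using triangle[of "of_nat (m - 1) * e" "e - b i"] me' e bi b(4)[OF i] by simp
    qed
    moreover have "of_nat (m - 1) * e + (e - b i) \<in> free_carrier X"
      using free_carrier_of_int_mult[OF e(1), of "int (m - 1)"] e bi by simp
    ultimately show "p (e - ?b) \<le> 1"
      using smult[of "of_nat (m - 1) * e + (e - b i)" z] m z by (simp add: of_nat_diff)
  qed
  then show ?thesis using smult[OF bi, of z] z m by simp
qed

end

subsection \<open>The universal seminorm\<close>

text \<open>Keeps the family under the supremum nonempty, whatever the relators are.\<close>

lemma zero_in_cstar_seminorms: "(\<lambda>f. 0) \<in> cstar_seminorms X"
  by (simp add: cstar_seminorms_def)

text \<open>Without pointwise bounds the real supremum would be an unspecified value, not an upper
  bound.\<close>

context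
  fixes X :: "'x set" and R :: "'x free_elt set"
  assumes bounded: "\<And>f. f \<in> free_carrier X \<Longrightarrow> \<exists>K. \<forall>p\<in>cstar_seminorms X. (\<forall>g\<in>R. p g = 0) \<longrightarrow> p f \<le> K"
begin

lemma universal_seminorm_upper:
  assumes "p \<in> cstar_seminorms X" "\<forall>g\<in>R. p g = 0" "f \<in> free_carrier X"
  shows "p f \<le> universal_seminorm X R f"
  unfolding universal_seminorm_def
proof (rule cSUP_upper)
  obtain K where "\<forall>p\<in>cstar_seminorms X. (\<forall>g\<in>R. p g = 0) \<longrightarrow> p f \<le> K"
    using bounded[OF assms(3)] by blast
  then show "bdd_above ((\<lambda>p. p f) ` {p \<in> cstar_seminorms X. \<forall>g\<in>R. p g = 0})"
    by (auto intro!: bdd_aboveI)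
qed (use assms in auto)

lemma universal_seminorm_least:
  assumes "\<And>p. \<lbrakk>p \<in> cstar_seminorms X; \<forall>g\<in>R. p g = 0\<rbrakk> \<Longrightarrow> p f \<le> K"
  shows "universal_seminorm X R f \<le> K"
  unfolding universal_seminorm_def
  by (rule cSUP_least) (use assms zero_in_cstar_seminorms in blast)+

lemma universal_seminorm_vanishes: "g \<in> R \<Longrightarrow> universal_seminorm X R g = 0"
proof -
  assume g: "g \<in> R"
  have "(\<lambda>p. p g) ` {p \<in> cstar_seminorms X. \<forall>g\<in>R. p g = 0} = {0}"
    using g zero_in_cstar_seminorms[of X] by (auto simp: image_iff)
  then show ?thesis by (simp add: universal_seminorm_def)
qed

text \<open>Each axiom survives the supremum over the competitors. For the C*-identity, squaring and
  square roots are monotone on nonnegative reals and so commute with the supremum.\<close>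

lemma universal_seminorm_cstar: "universal_seminorm X R \<in> cstar_seminorms X"
proof -
  let ?u = "universal_seminorm X R"
  let ?S = "{p \<in> cstar_seminorms X. \<forall>g\<in>R. p g = 0}"
  have S: "cstar_seminorm X p" "\<forall>g\<in>R. p g = 0" if "p \<in> ?S" for p
    using that by (auto simp: cstar_seminorm_def)
  have up: "p f \<le> ?u f" if "p \<in> ?S" "f \<in> free_carrier X" for p f
    using that universal_seminorm_upper by blast
  have least: "?u f \<le> K" if "\<And>p. p \<in> ?S \<Longrightarrow> p f \<le> K" for f K
    using that universal_seminorm_least by blast
  have nonneg: "0 \<le> ?u f" if "f \<in> free_carrier X" for f
    using up[of "\<lambda>f. 0" f] that zero_in_cstar_seminorms by auto
  have smult_le: "?u (free_smult z f) \<le> cmod z * ?u f" if "f \<in> free_carrier X" for z f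
  proof (rule least)
    fix p assume p: "p \<in> ?S"
    show "p (free_smult z f) \<le> cmod z * ?u f"
      using cstar_seminorm.smult[OF S(1)[OF p] that, of z] up[OF p that] by (simp add: mult_left_mono)
  qed
  have smult: "?u (free_smult z f) = cmod z * ?u f" if f: "f \<in> free_carrier X" for z f
  proof (cases "z = 0")
    case True
    then show ?thesis using smult_le[OF f, of z] nonneg[of "free_smult z f"] f by simp
  next
    case False
    \<comment> \<open>Applying the inequality to \<open>inverse z\<close> and
      \<open>free_smult z f\<close> reverses it, so homogeneity follows from its easy half.\<close>
    then have "?u f \<le> inverse (cmod z) * ?u (free_smult z f)"
      using smult_le[of "free_smult z f" "inverse z"] f by (simp add: norm_inverse)
    then show ?thesis using smult_le[OF f, of z] False by (simp add: field_simps)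
  qed
  have add: "?u (f + g) \<le> ?u f + ?u g" if "f \<in> free_carrier X" "g \<in> free_carrier X" for f g
  proof (rule least)
    fix p assume p: "p \<in> ?S"
    show "p (f + g) \<le> ?u f + ?u g"
      using cstar_seminorm.triangle[OF S(1)[OF p] that] up[OF p that(1)] up[OF p that(2)] by simp
  qed
  have mult: "?u (f * g) \<le> ?u f * ?u g" if "f \<in> free_carrier X" "g \<in> free_carrier X" for f g
  proof (rule least)
    fix p assume p: "p \<in> ?S"
    have "p f * p g \<le> ?u f * ?u g"
      using that p by (intro mult_mono up nonneg cstar_seminorm.nonneg[OF S(1)]) auto
    then show "p (f * g) \<le> ?u f * ?u g"
      using cstar_seminorm.submult[OF S(1)[OF p] that] by simp
  qed
  have cstar: "?u (free_star f * f) = (?u f)\<^sup>2" if f: "f \<in> free_carrier X" for f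
  proof (rule antisym)
    show "?u (free_star f * f) \<le> (?u f)\<^sup>2"
    proof (rule least)
      fix p assume p: "p \<in> ?S"
      show "p (free_star f * f) \<le> (?u f)\<^sup>2"
        using cstar_seminorm.cstar[OF S(1)[OF p] f] cstar_seminorm.nonneg[OF S(1)[OF p] f] up[OF p f]
        by (simp add: power_mono)
    qed
    have "?u f \<le> sqrt (?u (free_star f * f))"
    proof (rule least)
      fix p assume p: "p \<in> ?S"
      have "(p f)\<^sup>2 \<le> ?u (free_star f * f)"
        using cstar_seminorm.cstar[OF S(1)[OF p] f] up[OF p, of "free_star f * f"] f by simp
      then show "p f \<le> sqrt (?u (free_star f * f))" by (rule real_le_rsqrt)
    qed
    then have "(?u f)\<^sup>2 \<le> (sqrt (?u (free_star f * f)))\<^sup>2"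
      using nonneg[OF f] by (rule power_mono)
    then show "(?u f)\<^sup>2 \<le> ?u (free_star f * f)" using f by (simp add: nonneg)
  qed
  show ?thesis using nonneg smult add mult cstar by (simp add: cstar_seminorms_def)
qed

text \<open>If \<open>p\<close> competes in the supremum, so does its composition with the twist,
  because the twist only rescales the relators. This gives one inequality; the twist being its own
  inverse gives the other.\<close>

lemma universal_seminorm_twist:
  assumes R: "R \<subseteq> free_carrier X" "\<And>g. g \<in> R \<Longrightarrow> \<exists>z. free_twist \<delta> g = free_smult z g"
    and f: "f \<in> free_carrier X"
  shows "universal_seminorm X R (free_twist \<delta> f) = universal_seminorm X R f"
proof -
  have le: "universal_seminorm X R (free_twist \<delta> f) \<le> universal_seminorm X R f"
    if f: "f \<in> free_carrier X" for f
  proof (rule universal_seminorm_least)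
    fix p assume p: "p \<in> cstar_seminorms X" "\<forall>g\<in>R. p g = 0"
    interpret cstar_seminorm X p by unfold_locales (rule p)
    have "(\<lambda>f. p (free_twist \<delta> f)) \<in> cstar_seminorms X"
      by (auto simp: cstar_seminorms_def free_twist_smult free_twist_add free_twist_mult
          free_twist_star nonneg smult triangle submult cstar)
    moreover have "p (free_twist \<delta> g) = 0" if "g \<in> R" for g
    proof -
      obtain z where "free_twist \<delta> g = free_smult z g" using R(2)[OF \<open>g \<in> R\<close>] by blast
      then show ?thesis using smult[of g z] R(1) p(2) \<open>g \<in> R\<close> by auto
    qed
    ultimately show "p (free_twist \<delta> f) \<le> universal_seminorm X R f"
      using universal_seminorm_upper[of "\<lambda>f. p (free_twist \<delta> f)" f] f by blast
  qed
  show ?thesis using le[OF f] le[of "free_twist \<delta> f"] f by simp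
qed

end

section \<open>Cuntz--Krieger seminorms\<close>

lemma Z2_functor_comp:
  "\<lbrakk>Z2_functor \<Lambda> \<delta>; composable \<Lambda> \<mu> \<nu>\<rbrakk> \<Longrightarrow> \<delta> (comp \<Lambda> \<mu> \<nu>) = \<delta> \<mu> + \<delta> \<nu>"
  by (simp add: Z2_functor_def)

context P_graph
begin

lemma objsD: assumes "v \<in> objs \<Lambda>" shows "v \<in> mor \<Lambda>" "rng \<Lambda> v = v" "src \<Lambda> v = v"
  using assms by (auto simp: objs_def rng_closed rng_rng src_rng)

lemma rng_in_objs [simp]: "\<eta> \<in> mor \<Lambda> \<Longrightarrow> rng \<Lambda> \<eta> \<in> objs \<Lambda>"
  by (simp add: objs_def)

lemma src_in_objs [simp]: "\<eta> \<in> mor \<Lambda> \<Longrightarrow> src \<Lambda> \<eta> \<in> objs \<Lambda>"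
  using rng_src[of \<eta>] src_closed[of \<eta>] by (metis rng_in_objs)

lemma ck_relators_closed: "ck_relators P \<Lambda> c \<subseteq> free_carrier (mor \<Lambda>)"
  unfolding ck_relators_def
  by (auto simp: objsD src_closed comp_closed composable_def paths_into_def
      intro!: free_carrier_diff free_carrier_mult free_carrier_sum free_carrier_smult)

text \<open>Objects have degree 0, and in \<open>T \<eta> * S \<eta>\<close> and
  \<open>S \<eta> * T \<eta>\<close> the sign appears squared, so those relators are fixed. In the
  composition relator both terms have degree \<delta> \<mu> + \<delta> \<nu>.\<close>

lemma ck_relators_homogeneous:
  assumes \<delta>: "Z2_functor \<Lambda> \<delta>" and g: "g \<in> ck_relators P \<Lambda> c"
  shows "\<exists>z. free_twist \<delta> g = free_smult z g"
proof -
  have obj: "free_twist \<delta> (free_gen v) = free_gen v" if "v \<in> objs \<Lambda>" for v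
    using \<delta> that by (simp add: free_twist_gen Z2_functor_def sign_def)
  have id: "\<exists>z. free_twist \<delta> g = free_smult z g" if "free_twist \<delta> g = g" for g
    using that by (intro exI[of _ 1]) simp
  have square: "free_twist \<delta> (free_star (free_gen \<eta>) * free_gen \<eta>) = free_star (free_gen \<eta>) * free_gen \<eta>"
    "free_twist \<delta> (free_gen \<eta> * free_star (free_gen \<eta>)) = free_gen \<eta> * free_star (free_gen \<eta>)" for \<eta>
    by (simp_all add: free_twist_mult free_twist_star free_twist_gen free_star_smult
        free_smult_mult_left free_smult_mult_right)
  have comp: "free_twist \<delta> (free_gen \<mu> * free_gen \<nu> - free_smult (c \<mu> \<nu>) (free_gen (comp \<Lambda> \<mu> \<nu>)))
      = free_smult (sign (\<delta> \<mu>) * sign (\<delta> \<nu>))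
          (free_gen \<mu> * free_gen \<nu> - free_smult (c \<mu> \<nu>) (free_gen (comp \<Lambda> \<mu> \<nu>)))"
    if "composable \<Lambda> \<mu> \<nu>" for \<mu> \<nu>
  proof -
    have "sign (\<delta> (comp \<Lambda> \<mu> \<nu>)) = sign (\<delta> \<mu>) * sign (\<delta> \<nu>)"
      by (simp only: Z2_functor_comp[OF \<delta> that] sign_add)
    then show ?thesis
      by (simp add: free_twist_diff free_twist_mult free_twist_gen free_twist_smult
          free_smult_mult_left free_smult_mult_right free.scale_right_diff_distrib mult_ac)
  qed
  from g consider
      v where "v \<in> objs \<Lambda>" "g = free_star (free_gen v) - free_gen v"
    | v where "v \<in> objs \<Lambda>" "g = free_gen v * free_gen v - free_gen v"
    | v w where "v \<in> objs \<Lambda>" "w \<in> objs \<Lambda>" "g = free_gen v * free_gen w"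
    | \<mu> \<nu> where "composable \<Lambda> \<mu> \<nu>"
        "g = free_gen \<mu> * free_gen \<nu> - free_smult (c \<mu> \<nu>) (free_gen (comp \<Lambda> \<mu> \<nu>))"
    | \<eta> where "\<eta> \<in> mor \<Lambda>" "g = free_star (free_gen \<eta>) * free_gen \<eta> - free_gen (src \<Lambda> \<eta>)"
    | v q where "v \<in> objs \<Lambda>"
        "g = free_gen v - (\<Sum>\<eta>\<in>paths_into \<Lambda> v q. free_gen \<eta> * free_star (free_gen \<eta>))"
    unfolding ck_relators_def by auto
  then show ?thesis
  proof cases
    case 1 then show ?thesis by (intro id) (simp add: free_twist_diff free_twist_star obj)
  next
    case 2 then show ?thesis by (intro id) (simp add: free_twist_diff free_twist_mult obj)
  next
    case 3 then show ?thesis by (intro id) (simp add: free_twist_mult obj)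
  next
    case 4 then show ?thesis using comp by blast
  next
    case 5 then show ?thesis by (intro id) (simp add: free_twist_diff square obj)
  next
    case 6 then show ?thesis by (intro id) (simp add: free_twist_diff free_twist_sum square obj)
  qed
qed

end

text \<open>An arbitrary competitor for the universal seminorm; the universal seminorm becomes an
  instance once the bound \<open>p_bounded\<close> is available.\<close>

locale ck_seminorm = P_graph P \<Lambda> + cstar_seminorm "mor \<Lambda>" p
  for P :: "'p monoid" (structure) and \<Lambda> :: "('e, 'p) pgraph" and p +
  fixes c :: "'e \<Rightarrow> 'e \<Rightarrow> complex"
  assumes commutative: "\<lbrakk>a \<in> carrier P; b \<in> carrier P\<rbrakk> \<Longrightarrow> a \<otimes> b = b \<otimes> a"
    and row_finite: "row_finite P \<Lambda>"
    and cocycle: "cocycle \<Lambda> c"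
    and vanishes: "\<forall>g\<in>ck_relators P \<Lambda> c. p g = 0"
begin

notation eqv (infix "\<doteq>" 50)

abbreviation S :: "'e \<Rightarrow> 'e free_elt" where "S \<equiv> free_gen"
abbreviation T :: "'e \<Rightarrow> 'e free_elt" where "T \<eta> \<equiv> free_star (free_gen \<eta>)"

lemma relator_eqv:
  "\<lbrakk>f - g \<in> ck_relators P \<Lambda> c; f \<in> free_carrier (mor \<Lambda>); g \<in> free_carrier (mor \<Lambda>)\<rbrakk> \<Longrightarrow> f \<doteq> g"
  using vanishes by (simp add: eqv_def)

lemma obj_star: "v \<in> objs \<Lambda> \<Longrightarrow> T v \<doteq> S v"
  by (rule relator_eqv) (unfold ck_relators_def, blast, auto simp: objsD)

lemma obj_idem: "v \<in> objs \<Lambda> \<Longrightarrow> S v * S v \<doteq> S v"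
  by (rule relator_eqv) (unfold ck_relators_def, blast, auto simp: objsD)

lemma obj_orthogonal: "\<lbrakk>v \<in> objs \<Lambda>; w \<in> objs \<Lambda>; v \<noteq> w\<rbrakk> \<Longrightarrow> S v * S w \<doteq> 0"
  by (rule relator_eqv) (unfold ck_relators_def diff_zero, blast, auto simp: objsD)

lemma gen_comp: "composable \<Lambda> \<mu> \<nu> \<Longrightarrow> S \<mu> * S \<nu> \<doteq> free_smult (c \<mu> \<nu>) (S (comp \<Lambda> \<mu> \<nu>))"
  by (rule relator_eqv) (unfold ck_relators_def, blast, auto simp: comp_closed composable_def)

lemma star_gen: "\<eta> \<in> mor \<Lambda> \<Longrightarrow> T \<eta> * S \<eta> \<doteq> S (src \<Lambda> \<eta>)"
  by (rule relator_eqv) (unfold ck_relators_def, blast, auto simp: src_closed)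

lemma obj_sum:
  "\<lbrakk>v \<in> objs \<Lambda>; q \<in> carrier P\<rbrakk> \<Longrightarrow> S v \<doteq> (\<Sum>\<eta>\<in>paths_into \<Lambda> v q. S \<eta> * T \<eta>)"
  by (rule relator_eqv) (unfold ck_relators_def, blast, auto simp: objsD paths_into_def intro!: free_carrier_sum)

section \<open>Products of generators with their source and range projections\<close>

lemma gen_src: assumes "\<eta> \<in> mor \<Lambda>" shows "S \<eta> * S (src \<Lambda> \<eta>) \<doteq> S \<eta>"
proof -
  have "composable \<Lambda> \<eta> (src \<Lambda> \<eta>)" using assms by (simp add: composable_def src_closed rng_src)
  moreover have "c \<eta> (src \<Lambda> \<eta>) = 1" using cocycle assms unfolding cocycle_def by blast
  ultimately show ?thesis using gen_comp[of \<eta> "src \<Lambda> \<eta>"] comp_src[OF assms] by simp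
qed

lemma rng_gen: assumes "\<eta> \<in> mor \<Lambda>" shows "S (rng \<Lambda> \<eta>) * S \<eta> \<doteq> S \<eta>"
proof -
  have "composable \<Lambda> (rng \<Lambda> \<eta>) \<eta>" using assms by (simp add: composable_def rng_closed src_rng)
  moreover have "c (rng \<Lambda> \<eta>) \<eta> = 1" using cocycle assms unfolding cocycle_def by blast
  ultimately show ?thesis using gen_comp[of "rng \<Lambda> \<eta>" \<eta>] comp_rng[OF assms] by simp
qed

lemma star_rng: assumes "\<eta> \<in> mor \<Lambda>" shows "T \<eta> * S (rng \<Lambda> \<eta>) \<doteq> T \<eta>"
proof -
  have "T \<eta> * S (rng \<Lambda> \<eta>) \<doteq> T \<eta> * T (rng \<Lambda> \<eta>)"
    using assms by (intro eqv_mult_left eqv_sym[OF obj_star]) auto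
  also have "\<dots> = free_star (S (rng \<Lambda> \<eta>) * S \<eta>)" by (simp add: free_star_mult)
  also have "\<dots> \<doteq> T \<eta>" using assms by (intro eqv_star rng_gen)
  finally show ?thesis .
qed

lemma src_star: assumes "\<eta> \<in> mor \<Lambda>" shows "S (src \<Lambda> \<eta>) * T \<eta> \<doteq> T \<eta>"
proof -
  have "S (src \<Lambda> \<eta>) * T \<eta> \<doteq> T (src \<Lambda> \<eta>) * T \<eta>"
    using assms by (intro eqv_mult_right eqv_sym[OF obj_star]) auto
  also have "\<dots> = free_star (S \<eta> * S (src \<Lambda> \<eta>))" by (simp add: free_star_mult)
  also have "\<dots> \<doteq> T \<eta>" using assms by (intro eqv_star gen_src)
  finally show ?thesis .
qed

text \<open>The factors absorb two distinct vertex projections on their adjacent sides, and those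
  projections are orthogonal.\<close>

lemma mult_zero_of_objs:
  assumes v: "v \<in> objs \<Lambda>" "w \<in> objs \<Lambda>" "v \<noteq> w"
    and f: "f * S v \<doteq> f" and g: "S w * g \<doteq> g"
  shows "f * g \<doteq> 0"
proof -
  have fg: "f \<in> free_carrier (mor \<Lambda>)" "g \<in> free_carrier (mor \<Lambda>)"
    using f g by (auto dest: eqvD)
  have "f * g \<doteq> (f * S v) * (S w * g)" by (rule eqv_mult[OF eqv_sym[OF f] eqv_sym[OF g]])
  also have "\<dots> = f * (S v * S w) * g" by (simp add: mult.assoc)
  also have "\<dots> \<doteq> f * 0 * g" using v fg by (intro eqv_mult_left eqv_mult_right obj_orthogonal)
  finally show ?thesis by simp
qed

lemma gen_mult_zero:
  "\<lbrakk>\<mu> \<in> mor \<Lambda>; \<nu> \<in> mor \<Lambda>; src \<Lambda> \<mu> \<noteq> rng \<Lambda> \<nu>\<rbrakk> \<Longrightarrow> S \<mu> * S \<nu> \<doteq> 0"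
  by (rule mult_zero_of_objs[OF _ _ _ gen_src rng_gen]) auto

lemma star_mult_zero:
  "\<lbrakk>\<mu> \<in> mor \<Lambda>; \<nu> \<in> mor \<Lambda>; rng \<Lambda> \<mu> \<noteq> rng \<Lambda> \<nu>\<rbrakk> \<Longrightarrow> T \<mu> * S \<nu> \<doteq> 0"
  by (rule mult_zero_of_objs[OF _ _ _ star_rng rng_gen]) auto

lemma p_obj_le_1: "v \<in> objs \<Lambda> \<Longrightarrow> p (S v) \<le> 1"
  by (intro projection_norm_le_1 obj_star obj_idem)

text \<open>By the C*-identity the square of \<open>p (S \<eta>)\<close> is the seminorm of the
  source projection.\<close>

lemma p_gen_le_1: assumes "\<eta> \<in> mor \<Lambda>" shows "p (S \<eta>) \<le> 1"
proof -
  have "(p (S \<eta>))\<^sup>2 = p (S (src \<Lambda> \<eta>))"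
    using cstar[of "S \<eta>"] eqv_imp_eq[OF star_gen] assms by simp
  then have "(p (S \<eta>))\<^sup>2 \<le> 1\<^sup>2" using p_obj_le_1[of "src \<Lambda> \<eta>"] assms by simp
  then show ?thesis by (rule power2_le_imp_le) simp
qed

lemma p_word_le_1:
  "\<lbrakk>ls \<noteq> []; base_letter ` set ls \<subseteq> mor \<Lambda>\<rbrakk>
    \<Longrightarrow> Poly_Mapping.single (Word ls) 1 \<in> free_carrier (mor \<Lambda>) \<and> p (Poly_Mapping.single (Word ls) 1) \<le> 1"
proof (induction ls rule: list_nonempty_induct)
  case (single x)
  then show ?case by (cases x) (simp_all add: single_letter p_gen_le_1 star)
next
  case (cons x ls)
  let ?x = "Poly_Mapping.single (Word [x]) 1 :: 'e free_elt"
  let ?ls = "Poly_Mapping.single (Word ls) 1 :: 'e free_elt"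
  have x: "?x \<in> free_carrier (mor \<Lambda>)" "p ?x \<le> 1"
    using cons by (cases x; simp add: single_letter p_gen_le_1 star)+
  have ls: "?ls \<in> free_carrier (mor \<Lambda>)" "p ?ls \<le> 1" using cons by auto
  have "p ?x * p ?ls \<le> 1 * 1" by (rule mult_mono) (use x ls in \<open>auto simp: nonneg\<close>)
  then show ?case unfolding single_Cons[of x ls] using submult[OF x(1) ls(1)] x ls by auto
qed

text \<open>Words are products of contractions. The resulting bound, the sum of the absolute values
  of the coefficients, does not mention \<open>p\<close>, and so it bounds the supremum over all
  competitors.\<close>

lemma p_bounded:
  assumes f: "f \<in> free_carrier (mor \<Lambda>)"
  shows "p f \<le> (\<Sum>w\<in>Poly_Mapping.keys f. cmod (Poly_Mapping.lookup f w))"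
proof -
  let ?s = "\<lambda>w. Poly_Mapping.single w (Poly_Mapping.lookup f w)"
  have "p f = p (\<Sum>w\<in>Poly_Mapping.keys f. ?s w)" by (rule arg_cong[OF poly_mapping_sum_single])
  also have "\<dots> \<le> (\<Sum>w\<in>Poly_Mapping.keys f. p (?s w))"
    by (rule triangle_sum) (rule free_carrier_single[OF f])
  also have "\<dots> \<le> (\<Sum>w\<in>Poly_Mapping.keys f. cmod (Poly_Mapping.lookup f w))"
  proof (rule sum_mono)
    fix w assume "w \<in> Poly_Mapping.keys f"
    then have "letters w \<noteq> []" "base_letter ` set (letters w) \<subseteq> mor \<Lambda>"
      using f by (auto simp: free_carrier_def)
    from p_word_le_1[OF this]
    have w: "Poly_Mapping.single w 1 \<in> free_carrier (mor \<Lambda>)" "p (Poly_Mapping.single w 1) \<le> 1" by auto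
    have "?s w = free_smult (Poly_Mapping.lookup f w) (Poly_Mapping.single w 1)"
      by (simp add: free_smult_single)
    then have "p (?s w) = cmod (Poly_Mapping.lookup f w) * p (Poly_Mapping.single w 1)"
      using smult[OF w(1)] by simp
    also have "\<dots> \<le> cmod (Poly_Mapping.lookup f w) * 1" by (rule mult_left_mono) (use w in auto)
    finally show "p (?s w) \<le> cmod (Poly_Mapping.lookup f w)" by simp
  qed
  finally show ?thesis .
qed

text \<open>
  Compressing \<open>S v \<doteq> \<Sum>\<nu>. S \<nu> * T \<nu>\<close> by \<open>S \<mu>\<close> gives \<open>\<Sum>\<nu>\<noteq>\<mu>. (T \<nu> * S \<mu>)\<^sup>* (T \<nu> * S \<mu>) \<doteq> 0\<close>.
\<close>

lemma star_gen_orthogonal: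
  assumes \<mu>: "\<mu> \<in> mor \<Lambda>" and \<nu>: "\<nu> \<in> mor \<Lambda>" and eq: "rng \<Lambda> \<mu> = rng \<Lambda> \<nu>" "deg \<Lambda> \<mu> = deg \<Lambda> \<nu>"
    and neq: "\<nu> \<noteq> \<mu>"
  shows "T \<nu> * S \<mu> \<doteq> 0"
proof -
  define v where "v = rng \<Lambda> \<mu>"
  define e where "e = S (src \<Lambda> \<mu>)"
  define F where "F = paths_into \<Lambda> v (deg \<Lambda> \<mu>)"
  define b where "b \<kappa> = T \<mu> * (S \<kappa> * T \<kappa>) * S \<mu>" for \<kappa>
  have v: "v \<in> objs \<Lambda>" "v \<in> mor \<Lambda>" using \<mu> by (auto simp: v_def objsD)
  have F: "finite F" "\<mu> \<in> F" "\<nu> \<in> F"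
    using row_finite \<mu> \<nu> eq v deg_closed by (auto simp: F_def row_finite_def paths_into_def v_def)
  have mor: "\<kappa> \<in> mor \<Lambda>" "rng \<Lambda> \<kappa> = v" if "\<kappa> \<in> F" for \<kappa>
    using that by (auto simp: F_def paths_into_def)
  have e: "e \<in> free_carrier (mor \<Lambda>)" "e * e \<doteq> e" "p e \<le> 1"
    using \<mu> by (auto simp: e_def src_closed obj_idem p_obj_le_1)
  have b: "b \<kappa> \<in> free_carrier (mor \<Lambda>)" if "\<kappa> \<in> F" for \<kappa>
    using mor[OF that] \<mu> by (simp add: b_def)
  have eb: "e * b \<kappa> \<doteq> b \<kappa>" "b \<kappa> * e \<doteq> b \<kappa>" if "\<kappa> \<in> F" for \<kappa>
  proof -
    have "(e * T \<mu>) * (S \<kappa> * T \<kappa> * S \<mu>) \<doteq> T \<mu> * (S \<kappa> * T \<kappa> * S \<mu>)"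
      unfolding e_def using mor[OF that] \<mu> by (intro eqv_mult_right src_star) auto
    then show "e * b \<kappa> \<doteq> b \<kappa>" by (simp add: b_def mult.assoc)
    have "(T \<mu> * (S \<kappa> * T \<kappa>)) * (S \<mu> * e) \<doteq> (T \<mu> * (S \<kappa> * T \<kappa>)) * S \<mu>"
      unfolding e_def using mor[OF that] \<mu> by (intro eqv_mult_left gen_src) auto
    then show "b \<kappa> * e \<doteq> b \<kappa>" by (simp add: b_def mult.assoc)
  qed
  have e_eq: "e \<doteq> T \<mu> * S v * S \<mu>"
  proof -
    have "e \<doteq> T \<mu> * S \<mu>" unfolding e_def using \<mu> by (intro eqv_sym[OF star_gen])
    also have "\<dots> \<doteq> T \<mu> * S v * S \<mu>"
      unfolding v_def using \<mu> by (intro eqv_mult_right eqv_sym[OF star_rng]) auto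
    finally show ?thesis .
  qed
  have ST: "(S \<kappa> * T \<kappa>) * (S \<kappa> * T \<kappa>) \<doteq> S \<kappa> * T \<kappa>" if "\<kappa> \<in> mor \<Lambda>" for \<kappa>
  proof -
    have "S \<kappa> * ((T \<kappa> * S \<kappa>) * T \<kappa>) \<doteq> S \<kappa> * (S (src \<Lambda> \<kappa>) * T \<kappa>)"
      using that by (intro eqv_mult_left eqv_mult_right star_gen) auto
    also have "\<dots> \<doteq> S \<kappa> * T \<kappa>" using that by (intro eqv_mult_left src_star) auto
    finally show ?thesis by (simp add: mult.assoc)
  qed
  \<comment> \<open>The range projection of \<kappa> lies below \<open>S v\<close>, so
    \<open>?q\<close> is again a projection. Up to null elements \<open>e - b \<kappa>\<close> is
    the compression \<open>T \<mu> * ?q * S \<mu>\<close>, hence a contraction; this is the form of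
    positivity needed for \<open>sum_positive_eq_0\<close>.\<close>
  have le: "p (e - b \<kappa>) \<le> 1" if "\<kappa> \<in> F" for \<kappa>
  proof -
    note \<kappa> = mor[OF that]
    let ?q = "S v - S \<kappa> * T \<kappa>"
    have q: "?q \<in> free_carrier (mor \<Lambda>)" using \<kappa> v by simp
    have "p ?q \<le> 1"
    proof (rule projection_norm_le_1)
      have "free_star ?q = T v - S \<kappa> * T \<kappa>" by (simp add: free_star_diff free_star_mult)
      also have "\<dots> \<doteq> ?q" using \<kappa> v by (intro eqv_diff obj_star eqv_refl) auto
      finally show "free_star ?q \<doteq> ?q" .
      have 1: "S v * (S \<kappa> * T \<kappa>) \<doteq> S \<kappa> * T \<kappa>"
        using eqv_mult_right[OF rng_gen[OF \<kappa>(1)], of "T \<kappa>"] \<kappa> by (simp add: mult.assoc)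
      have 2: "(S \<kappa> * T \<kappa>) * S v \<doteq> S \<kappa> * T \<kappa>"
        using eqv_mult_left[OF star_rng[OF \<kappa>(1)], of "S \<kappa>"] \<kappa> by (simp add: mult.assoc)
      have "?q * ?q = (S v * S v - S v * (S \<kappa> * T \<kappa>)) - ((S \<kappa> * T \<kappa>) * S v - (S \<kappa> * T \<kappa>) * (S \<kappa> * T \<kappa>))"
        by (simp add: algebra_simps)
      also have "\<dots> \<doteq> (S v - S \<kappa> * T \<kappa>) - (S \<kappa> * T \<kappa> - S \<kappa> * T \<kappa>)"
        by (intro eqv_diff 1 2 obj_idem v ST \<kappa>)
      finally show "?q * ?q \<doteq> ?q" by simp
    qed
    have "T \<mu> * ?q * S \<mu> = T \<mu> * S v * S \<mu> - b \<kappa>"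
      by (simp only: b_def left_diff_distrib right_diff_distrib)
    also have "\<dots> \<doteq> e - b \<kappa>" by (intro eqv_diff eqv_sym[OF e_eq] eqv_refl b that)
    finally have "p (e - b \<kappa>) = p (T \<mu> * ?q * S \<mu>)" using eqv_imp_eq by metis
    also have "\<dots> \<le> p (T \<mu>) * p ?q * p (S \<mu>)"
      using submult[of "T \<mu> * ?q" "S \<mu>"] submult[of "T \<mu>" ?q] q \<mu> nonneg[of "S \<mu>"]
      by (meson free_carrier_gen free_carrier_mult free_carrier_star mult_right_mono order.trans)
    also have "\<dots> \<le> 1 * 1 * 1"
      using \<mu> q p_gen_le_1[OF \<mu>] \<open>p ?q \<le> 1\<close>
      by (intro mult_mono mult_nonneg_nonneg nonneg) (auto simp: star)
    finally show ?thesis by simp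
  qed
  \<comment> \<open>The summand at \<mu> already exhausts the total \<open>e\<close>, so the
    remaining positive elements sum to a null element.\<close>
  have b\<mu>: "b \<mu> \<doteq> e"
  proof -
    have "b \<mu> = (T \<mu> * S \<mu>) * (T \<mu> * S \<mu>)" by (simp add: b_def mult.assoc)
    also have "\<dots> \<doteq> e * e" unfolding e_def using \<mu> by (intro eqv_mult star_gen)
    finally show ?thesis using e(2) by (rule eqv_trans)
  qed
  have "sum b (F - {\<mu>}) = sum b F - b \<mu>" using F by (simp add: sum_diff1)
  also have "\<dots> = T \<mu> * (\<Sum>\<kappa>\<in>F. S \<kappa> * T \<kappa>) * S \<mu> - b \<mu>"
    by (simp only: b_def[abs_def] sum_distrib_left sum_distrib_right)
  also have "\<dots> \<doteq> T \<mu> * S v * S \<mu> - b \<mu>"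
    unfolding F_def
    by (intro eqv_diff eqv_mult_left eqv_mult_right eqv_sym[OF obj_sum] eqv_refl v)
      (use \<mu> F b deg_closed in auto)
  also have "\<dots> \<doteq> e - e" by (intro eqv_diff eqv_sym[OF e_eq] b\<mu>)
  finally have "sum b (F - {\<mu>}) \<doteq> 0" by simp
  then have "p (b \<nu>) = 0"
    using sum_positive_eq_0[OF _ e, of "F - {\<mu>}" b \<nu>] F b eb le neq by blast
  moreover have "b \<nu> = free_star (T \<nu> * S \<mu>) * (T \<nu> * S \<mu>)"
    by (simp add: b_def free_star_mult mult.assoc)
  ultimately have "p (T \<nu> * S \<mu>) = 0" using cstar[of "T \<nu> * S \<mu>"] \<mu> \<nu> by simp
  then show ?thesis using \<mu> \<nu> by (simp add: eqv_zero_iff)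
qed

section \<open>Reduction of words to combinations of products
  \<open>S \<mu> * T \<nu>\<close>\<close>

lemma composableD:
  assumes "composable \<Lambda> \<mu> \<nu>" shows "\<mu> \<in> mor \<Lambda>" "\<nu> \<in> mor \<Lambda>" "src \<Lambda> \<mu> = rng \<Lambda> \<nu>" "comp \<Lambda> \<mu> \<nu> \<in> mor \<Lambda>"
  using assms comp_closed by (auto simp: composable_def)

text \<open>Since the cocycle has modulus 1, its conjugate inverts it and \<open>gen_comp\<close>
  can be read backwards, to split a generator along a factorisation of its path.\<close>

lemma comp_gen:
  assumes "composable \<Lambda> \<mu> \<nu>" shows "S (comp \<Lambda> \<mu> \<nu>) \<doteq> free_smult (cnj (c \<mu> \<nu>)) (S \<mu> * S \<nu>)"
proof -
  have "cmod (c \<mu> \<nu>) = 1" using assms cocycle unfolding cocycle_def by blast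
  then have "cnj (c \<mu> \<nu>) * c \<mu> \<nu> = 1"
    using complex_norm_square[of "c \<mu> \<nu>"] by (simp add: mult.commute)
  then have "S (comp \<Lambda> \<mu> \<nu>) = free_smult (cnj (c \<mu> \<nu>)) (free_smult (c \<mu> \<nu>) (S (comp \<Lambda> \<mu> \<nu>)))"
    by simp
  also have "\<dots> \<doteq> free_smult (cnj (c \<mu> \<nu>)) (S \<mu> * S \<nu>)"
    by (intro eqv_smult eqv_sym[OF gen_comp] assms)
  finally show ?thesis .
qed

text \<open>The factorisation property gives \<zeta> = \<mu>\<beta> with \<mu> of the same degree as
  \<eta>. Either \<mu> = \<eta>, and \<open>T \<eta>\<close> cancels it up to a cocycle value, or
  \<open>star_gen_orthogonal\<close> kills the product.\<close>

lemma star_gen_extension: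
  assumes \<eta>: "\<eta> \<in> mor \<Lambda>" and \<zeta>: "\<zeta> \<in> mor \<Lambda>" and rng: "rng \<Lambda> \<zeta> = rng \<Lambda> \<eta>"
    and deg: "deg \<Lambda> \<zeta> = deg \<Lambda> \<eta> \<otimes> q" "q \<in> carrier P"
  obtains (zero) "T \<eta> * S \<zeta> \<doteq> 0"
    | (extension) \<beta> z where "composable \<Lambda> \<eta> \<beta>" "comp \<Lambda> \<eta> \<beta> = \<zeta>" "T \<eta> * S \<zeta> \<doteq> free_smult z (S \<beta>)"
proof -
  have "\<exists>!(\<mu>, \<nu>). composable \<Lambda> \<mu> \<nu> \<and> deg \<Lambda> \<mu> = deg \<Lambda> \<eta> \<and> deg \<Lambda> \<nu> = q \<and> comp \<Lambda> \<mu> \<nu> = \<zeta>"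
    using \<eta> \<zeta> deg by (intro factorisation deg_closed)
  then obtain \<mu> \<beta> where \<mu>\<beta>: "composable \<Lambda> \<mu> \<beta>" "deg \<Lambda> \<mu> = deg \<Lambda> \<eta>" "comp \<Lambda> \<mu> \<beta> = \<zeta>" by auto
  note D = composableD[OF \<mu>\<beta>(1)]
  have "rng \<Lambda> \<mu> = rng \<Lambda> \<eta>" using rng_comp[OF \<mu>\<beta>(1)] \<mu>\<beta> rng by simp
  let ?z = "cnj (c \<mu> \<beta>)"
  have "T \<eta> * S \<zeta> \<doteq> T \<eta> * free_smult ?z (S \<mu> * S \<beta>)"
    using comp_gen[OF \<mu>\<beta>(1)] \<eta> \<mu>\<beta>(3) by (intro eqv_mult_left) auto
  also have "\<dots> = free_smult ?z (T \<eta> * S \<mu> * S \<beta>)" by (simp add: free_smult_mult_right mult.assoc)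
  finally have *: "T \<eta> * S \<zeta> \<doteq> free_smult ?z (T \<eta> * S \<mu> * S \<beta>)" .
  show thesis
  proof (cases "\<eta> = \<mu>")
    case True
    note *
    also have "free_smult ?z (T \<eta> * S \<mu> * S \<beta>) \<doteq> free_smult ?z (S (rng \<Lambda> \<beta>) * S \<beta>)"
      using star_gen[OF \<eta>] True D by (intro eqv_smult eqv_mult_right) auto
    also have "\<dots> \<doteq> free_smult ?z (S \<beta>)" using D by (intro eqv_smult rng_gen)
    finally show thesis using extension \<mu>\<beta> True by blast
  next
    case False
    note *
    also have "free_smult ?z (T \<eta> * S \<mu> * S \<beta>) \<doteq> free_smult ?z (0 * S \<beta>)"
      using False \<eta> D \<open>rng \<Lambda> \<mu> = rng \<Lambda> \<eta>\<close> \<mu>\<beta>(2)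
      by (intro eqv_smult eqv_mult_right star_gen_orthogonal) auto
    finally show thesis using zero by simp
  qed
qed

text \<open>Closed under null perturbations, which become equalities in the completion. No relation
  between the sources of \<mu> and \<nu> is imposed, matching the generating set in the
  theorem.\<close>

inductive_set ck_span :: "('e \<Rightarrow> bit) \<Rightarrow> bit \<Rightarrow> 'e free_elt set" for \<delta> i
  where
    zero: "0 \<in> ck_span \<delta> i"
  | base: "\<lbrakk>\<mu> \<in> mor \<Lambda>; \<nu> \<in> mor \<Lambda>; \<delta> \<mu> - \<delta> \<nu> = i\<rbrakk> \<Longrightarrow> S \<mu> * T \<nu> \<in> ck_span \<delta> i"
  | add: "\<lbrakk>f \<in> ck_span \<delta> i; g \<in> ck_span \<delta> i\<rbrakk> \<Longrightarrow> f + g \<in> ck_span \<delta> i"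
  | smult: "f \<in> ck_span \<delta> i \<Longrightarrow> free_smult z f \<in> ck_span \<delta> i"
  | eqv: "\<lbrakk>f \<in> ck_span \<delta> i; f \<doteq> g\<rbrakk> \<Longrightarrow> g \<in> ck_span \<delta> i"

lemma ck_span_closed: "f \<in> ck_span \<delta> i \<Longrightarrow> f \<in> free_carrier (mor \<Lambda>)"
  by (induction rule: ck_span.induct) (auto dest: eqvD)

lemma ck_span_sum: "(\<And>x. x \<in> F \<Longrightarrow> f x \<in> ck_span \<delta> i) \<Longrightarrow> sum f F \<in> ck_span \<delta> i"
  by (induction F rule: infinite_finite_induct) (auto intro: ck_span.zero ck_span.add)

lemma ck_span_eqv: "\<lbrakk>g \<doteq> f; f \<in> ck_span \<delta> i\<rbrakk> \<Longrightarrow> g \<in> ck_span \<delta> i"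
  by (rule ck_span.eqv[OF _ eqv_sym])

lemma ck_span_null: "f \<doteq> 0 \<Longrightarrow> f \<in> ck_span \<delta> i"
  by (rule ck_span_eqv[OF _ ck_span.zero])

text \<open>Words grow by one letter on the left, so stability under left multiplication by
  \<open>S \<eta>\<close>, and by \<open>T \<eta>\<close> below, replaces stability under
  products.\<close>

lemma ck_span_gen_mult:
  assumes \<delta>: "Z2_functor \<Lambda> \<delta>" and \<eta>: "\<eta> \<in> mor \<Lambda>" and f: "f \<in> ck_span \<delta> i"
  shows "S \<eta> * f \<in> ck_span \<delta> (\<delta> \<eta> + i)"
  using f
proof (induction rule: ck_span.induct)
  case (base \<mu> \<nu>)
  show ?case
  proof (cases "src \<Lambda> \<eta> = rng \<Lambda> \<mu>")
    case True
    then have comp: "composable \<Lambda> \<eta> \<mu>" using \<eta> base by (simp add: composable_def)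
    have "S \<eta> * (S \<mu> * T \<nu>) = S \<eta> * S \<mu> * T \<nu>" by (simp add: mult.assoc)
    also have "\<dots> \<doteq> free_smult (c \<eta> \<mu>) (S (comp \<Lambda> \<eta> \<mu>)) * T \<nu>"
      using base by (intro eqv_mult_right gen_comp comp) auto
    also have "\<dots> = free_smult (c \<eta> \<mu>) (S (comp \<Lambda> \<eta> \<mu>) * T \<nu>)" by (rule free_smult_mult_left)
    finally show ?thesis
    proof (rule ck_span_eqv)
      have "\<delta> (comp \<Lambda> \<eta> \<mu>) - \<delta> \<nu> = \<delta> \<eta> + i"
        by (simp only: Z2_functor_comp[OF \<delta> comp] base(3)[symmetric] add_diff_eq)
      then show "free_smult (c \<eta> \<mu>) (S (comp \<Lambda> \<eta> \<mu>) * T \<nu>) \<in> ck_span \<delta> (\<delta> \<eta> + i)"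
        using comp_closed[OF comp] base by (intro ck_span.smult ck_span.base)
    qed
  next
    case False
    have "S \<eta> * S \<mu> * T \<nu> \<doteq> 0 * T \<nu>"
      using False \<eta> base by (intro eqv_mult_right gen_mult_zero) auto
    then show ?thesis by (intro ck_span_null) (simp add: mult.assoc)
  qed
next
  case (eqv f g)
  show ?case by (rule ck_span.eqv[OF eqv.IH eqv_mult_left[OF eqv.hyps(2)]]) (use \<eta> in simp)
qed (simp_all add: distrib_left free_smult_mult_right ck_span.zero ck_span.add ck_span.smult)

text \<open>The projection \<open>S v\<close> is inserted between \<open>T \<eta>\<close> and
  \<open>S \<mu>\<close> and expanded over paths \<zeta>. Each summand is
  \<open>T \<eta> * S \<zeta>\<close> times the adjoint of
  \<open>S \<nu> * (T \<mu> * S \<zeta>)\<close>, and commutativity of \<open>P\<close> lets \<zeta>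
  be factored through the degree of \<eta> and through that of \<mu>.\<close>

lemma ck_span_star_mult:
  assumes \<delta>: "Z2_functor \<Lambda> \<delta>" and \<eta>: "\<eta> \<in> mor \<Lambda>" and f: "f \<in> ck_span \<delta> i"
  shows "T \<eta> * f \<in> ck_span \<delta> (\<delta> \<eta> + i)"
  using f
proof (induction rule: ck_span.induct)
  case (base \<mu> \<nu>)
  show ?case
  proof (cases "rng \<Lambda> \<eta> = rng \<Lambda> \<mu>")
    case True
    define v where "v = rng \<Lambda> \<mu>"
    define F where "F = paths_into \<Lambda> v (deg \<Lambda> \<eta> \<otimes> deg \<Lambda> \<mu>)"
    have F: "\<zeta> \<in> mor \<Lambda>" "rng \<Lambda> \<zeta> = rng \<Lambda> \<eta>" "rng \<Lambda> \<zeta> = rng \<Lambda> \<mu>"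
      "deg \<Lambda> \<zeta> = deg \<Lambda> \<eta> \<otimes> deg \<Lambda> \<mu>" "deg \<Lambda> \<zeta> = deg \<Lambda> \<mu> \<otimes> deg \<Lambda> \<eta>" if "\<zeta> \<in> F" for \<zeta>
      using that True commutative[of "deg \<Lambda> \<eta>" "deg \<Lambda> \<mu>"] \<eta> base deg_closed
      by (auto simp: F_def v_def paths_into_def)
    have v: "v \<in> objs \<Lambda>" using base by (simp add: v_def)
    have "T \<eta> * (S \<mu> * T \<nu>) \<doteq> T \<eta> * (S v * S \<mu> * T \<nu>)"
      unfolding v_def using \<eta> base by (intro eqv_mult_left eqv_mult_right eqv_sym[OF rng_gen]) auto
    also have "\<dots> \<doteq> T \<eta> * ((\<Sum>\<zeta>\<in>F. S \<zeta> * T \<zeta>) * S \<mu> * T \<nu>)"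
      unfolding F_def using \<eta> base v deg_closed by (intro eqv_mult_left eqv_mult_right obj_sum) auto
    also have "\<dots> = (\<Sum>\<zeta>\<in>F. (T \<eta> * S \<zeta>) * free_star (S \<nu> * (T \<mu> * S \<zeta>)))"
      by (simp add: sum_distrib_left sum_distrib_right mult.assoc free_star_mult)
    finally show ?thesis
    proof (rule ck_span_eqv[OF _ ck_span_sum])
      fix \<zeta> assume "\<zeta> \<in> F"
      note \<zeta> = F[OF this]
      have cl: "T \<eta> * S \<zeta> \<in> free_carrier (mor \<Lambda>)" "S \<nu> * (T \<mu> * S \<zeta>) \<in> free_carrier (mor \<Lambda>)"
        using \<zeta> \<eta> base by auto
      show "(T \<eta> * S \<zeta>) * free_star (S \<nu> * (T \<mu> * S \<zeta>)) \<in> ck_span \<delta> (\<delta> \<eta> + i)"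
      proof (rule star_gen_extension[OF \<eta> \<zeta>(1,2,4) deg_closed[OF base(1)]])
        assume "T \<eta> * S \<zeta> \<doteq> 0"
        from eqv_mult_right[OF this free_carrier_star[OF cl(2)]] show ?thesis
          by (intro ck_span_null) simp
      next
        fix \<beta> z assume \<beta>: "composable \<Lambda> \<eta> \<beta>" "comp \<Lambda> \<eta> \<beta> = \<zeta>" "T \<eta> * S \<zeta> \<doteq> free_smult z (S \<beta>)"
        show ?thesis
        proof (rule star_gen_extension[OF base(1) \<zeta>(1,3,5) deg_closed[OF \<eta>]])
          assume "T \<mu> * S \<zeta> \<doteq> 0"
          from eqv_mult_left[OF eqv_star[OF eqv_mult_left[OF this]] cl(1), of "S \<nu>"] show ?thesis
            using base by (intro ck_span_null) simp
        next
          fix \<gamma> y assume \<gamma>: "composable \<Lambda> \<mu> \<gamma>" "comp \<Lambda> \<mu> \<gamma> = \<zeta>" "T \<mu> * S \<zeta> \<doteq> free_smult y (S \<gamma>)"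
          have "\<delta> \<eta> + \<delta> \<beta> = \<delta> \<mu> + \<delta> \<gamma>" using Z2_functor_comp[OF \<delta> \<beta>(1)] Z2_functor_comp[OF \<delta> \<gamma>(1)] \<beta>(2) \<gamma>(2)
            by (simp only:)
          \<comment> \<open>The two factorisations \<zeta> = \<eta>\<beta> = \<mu>\<gamma> give
            \<delta> \<beta> - \<delta> \<gamma> = \<delta> \<mu> - \<delta> \<eta>, and -\<delta>
            \<eta> = \<delta> \<eta> in Z_2.\<close>
          then have deg: "\<delta> \<beta> - (\<delta> \<nu> + \<delta> \<gamma>) = \<delta> \<eta> + i"
            unfolding base(3)[symmetric]
            by (cases "\<delta> \<eta>"; cases "\<delta> \<beta>"; cases "\<delta> \<mu>"; cases "\<delta> \<gamma>"; cases "\<delta> \<nu>") simp_all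
          have "(T \<eta> * S \<zeta>) * free_star (S \<nu> * (T \<mu> * S \<zeta>))
              \<doteq> free_smult z (S \<beta>) * free_star (S \<nu> * free_smult y (S \<gamma>))"
            using base by (intro eqv_mult \<beta> eqv_star eqv_mult_left \<gamma>) auto
          also have "\<dots> = free_smult (z * cnj y) (S \<beta> * free_star (S \<nu> * S \<gamma>))"
            by (simp add: free_smult_mult_left free_smult_mult_right free_star_smult mult_ac)
          finally show ?thesis
          proof (rule ck_span_eqv[OF _ ck_span.smult])
            show "S \<beta> * free_star (S \<nu> * S \<gamma>) \<in> ck_span \<delta> (\<delta> \<eta> + i)"
            \<comment> \<open>The range of \<gamma> is the source of \<mu>, which need not be the
              source of \<nu>; if they differ, the product vanishes.\<close>
            proof (cases "src \<Lambda> \<nu> = rng \<Lambda> \<gamma>")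
              case True
              then have comp: "composable \<Lambda> \<nu> \<gamma>"
                using base composableD[OF \<gamma>(1)] by (simp add: composable_def)
              have "S \<beta> * free_star (S \<nu> * S \<gamma>)
                  \<doteq> S \<beta> * free_star (free_smult (c \<nu> \<gamma>) (S (comp \<Lambda> \<nu> \<gamma>)))"
                using composableD[OF \<beta>(1)] by (intro eqv_mult_left eqv_star gen_comp comp) auto
              also have "\<dots> = free_smult (cnj (c \<nu> \<gamma>)) (S \<beta> * T (comp \<Lambda> \<nu> \<gamma>))"
                by (simp add: free_star_smult free_smult_mult_right)
              finally show ?thesis
              proof (rule ck_span_eqv[OF _ ck_span.smult[OF ck_span.base]])
                show "\<delta> \<beta> - \<delta> (comp \<Lambda> \<nu> \<gamma>) = \<delta> \<eta> + i" using deg by (simp only: Z2_functor_comp[OF \<delta> comp])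
              qed (use composableD[OF \<beta>(1)] comp_closed[OF comp] in auto)
            next
              case False
              have "S \<beta> * free_star (S \<nu> * S \<gamma>) \<doteq> S \<beta> * free_star 0"
                using False composableD[OF \<beta>(1)] composableD[OF \<gamma>(1)] base
                by (intro eqv_mult_left eqv_star gen_mult_zero) auto
              then show ?thesis by (intro ck_span_null) (simp add: mult.assoc)
            qed
          qed
        qed
      qed
    qed
  next
    case False
    have "T \<eta> * S \<mu> * T \<nu> \<doteq> 0 * T \<nu>"
      using False \<eta> base by (intro eqv_mult_right star_mult_zero) auto
    then show ?thesis by (intro ck_span_null) (simp add: mult.assoc)
  qed
next
  case (eqv f g)
  show ?case by (rule ck_span.eqv[OF eqv.IH eqv_mult_left[OF eqv.hyps(2)]]) (use \<eta> in simp)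
qed (simp_all add: distrib_left free_smult_mult_right ck_span.zero ck_span.add ck_span.smult)

text \<open>A single letter becomes a product of the required form by multiplying it with its source
  projection, which has degree 0. Longer words follow by left multiplication.\<close>

lemma ck_span_word:
  assumes \<delta>: "Z2_functor \<Lambda> \<delta>"
  shows "\<lbrakk>ls \<noteq> []; base_letter ` set ls \<subseteq> mor \<Lambda>\<rbrakk>
    \<Longrightarrow> Poly_Mapping.single (Word ls) 1 \<in> ck_span \<delta> (word_deg \<delta> (Word ls))"
proof (induction ls rule: list_nonempty_induct)
  case (single x)
  define \<eta> where "\<eta> = base_letter x"
  have \<eta>: "\<eta> \<in> mor \<Lambda>" using single by (simp add: \<eta>_def)
  have src: "\<delta> (src \<Lambda> \<eta>) = 0" using \<delta> src_in_objs[OF \<eta>] unfolding Z2_functor_def by blast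
  have "S \<eta> * T (src \<Lambda> \<eta>) \<in> ck_span \<delta> (\<delta> \<eta>)"
    using \<eta> src by (intro ck_span.base) (auto simp: src_closed)
  moreover have "S \<eta> \<doteq> S \<eta> * T (src \<Lambda> \<eta>)"
    using eqv_mult_left[OF obj_star[OF src_in_objs[OF \<eta>]], of "S \<eta>"] gen_src[OF \<eta>] \<eta>
    by (metis eqv_sym eqv_trans free_carrier_gen)
  ultimately have S: "S \<eta> \<in> ck_span \<delta> (\<delta> \<eta>)" by (metis ck_span_eqv)
  have "S (src \<Lambda> \<eta>) * T \<eta> \<in> ck_span \<delta> (\<delta> \<eta>)"
    using \<eta> src by (intro ck_span.base) (auto simp: src_closed)
  then have T: "T \<eta> \<in> ck_span \<delta> (\<delta> \<eta>)" using src_star[OF \<eta>] by (rule ck_span.eqv)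
  have "word_deg \<delta> (Word [x]) = \<delta> \<eta>" by (simp add: word_deg_def \<eta>_def)
  then show ?case using S T by (cases x) (simp_all add: single_letter \<eta>_def)
next
  case (cons x ls)
  have "word_deg \<delta> (Word (x # ls)) = \<delta> (base_letter x) + word_deg \<delta> (Word ls)"
    by (simp add: word_deg_def)
  then show ?case unfolding single_Cons[of x ls]
    using cons ck_span_gen_mult[OF \<delta>] ck_span_star_mult[OF \<delta>]
    by (cases x) (simp_all add: single_letter)
qed

lemma homogeneous_in_ck_span:
  assumes \<delta>: "Z2_functor \<Lambda> \<delta>" and f: "f \<in> free_carrier (mor \<Lambda>)"
    and deg: "\<And>w. w \<in> Poly_Mapping.keys f \<Longrightarrow> word_deg \<delta> w = i"
  shows "f \<in> ck_span \<delta> i"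
proof -
  have "Poly_Mapping.single w (Poly_Mapping.lookup f w) \<in> ck_span \<delta> i"
    if w: "w \<in> Poly_Mapping.keys f" for w
  proof -
    have "letters w \<noteq> []" "base_letter ` set (letters w) \<subseteq> mor \<Lambda>"
      using f w by (auto simp: free_carrier_def)
    from ck_span_word[OF \<delta> this] have "Poly_Mapping.single w 1 \<in> ck_span \<delta> i"
      using deg[OF w] by simp
    from ck_span.smult[OF this, of "Poly_Mapping.lookup f w"] show ?thesis
      by (simp add: free_smult_single)
  qed
  then show ?thesis by (subst poly_mapping_sum_single[of f]) (rule ck_span_sum)
qed

end

section \<open>The grading automorphism\<close>

text \<open>Commutativity is pulled back along an injective homomorphism; it makes the product of
  two degrees a multiple of each from the left.\<close>

lemma NZ2_iso_commutative:
  assumes iso: "P \<cong> NZ2_monoid k l" and P: "monoid P"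
    and a: "a \<in> carrier P" and b: "b \<in> carrier P"
  shows "a \<otimes>\<^bsub>P\<^esub> b = b \<otimes>\<^bsub>P\<^esub> a"
proof -
  obtain h where h: "h \<in> hom P (NZ2_monoid k l)" "inj_on h (carrier P)"
    using iso by (auto simp: is_iso_def iso_def bij_betw_def)
  have "x \<otimes>\<^bsub>NZ2_monoid k l\<^esub> y = y \<otimes>\<^bsub>NZ2_monoid k l\<^esub> x" for x y
  proof -
    have "(\<lambda>i. fst x i + fst y i) = (\<lambda>i. fst y i + fst x i)"
      "(\<lambda>j. snd x j + snd y j) = (\<lambda>j. snd y j + snd x j)"
      by (rule ext, rule add.commute)+
    then show ?thesis by (simp only: NZ2_monoid_def monoid.simps case_prod_unfold)
  qed
  then have "h (a \<otimes>\<^bsub>P\<^esub> b) = h (b \<otimes>\<^bsub>P\<^esub> a)" using h(1) a b by (simp add: hom_mult)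
  then show ?thesis using h(2) a b monoid.m_closed[OF P] by (auto dest: inj_onD)
qed

locale row_finite_cocycle = P_graph P \<Lambda> for P :: "'p monoid" (structure) and \<Lambda> :: "('e, 'p) pgraph" +
  fixes c :: "'e \<Rightarrow> 'e \<Rightarrow> complex"
  assumes commutative: "\<lbrakk>a \<in> carrier P; b \<in> carrier P\<rbrakk> \<Longrightarrow> a \<otimes> b = b \<otimes> a"
    and row_finite: "row_finite P \<Lambda>"
    and cocycle: "cocycle \<Lambda> c"
begin

abbreviation "R \<equiv> ck_relators P \<Lambda> c"
abbreviation "u \<equiv> universal_seminorm (mor \<Lambda>) R"
abbreviation "F \<equiv> free_star_algebra (mor \<Lambda>) R"

lemma ck_seminormI:
  assumes "p \<in> cstar_seminorms (mor \<Lambda>)" "\<forall>g\<in>R. p g = 0"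
  shows "ck_seminorm P \<Lambda> p c"
  by unfold_locales (use assms commutative row_finite cocycle in auto)

lemma seminorms_bounded:
  assumes "f \<in> free_carrier (mor \<Lambda>)"
  shows "\<exists>K. \<forall>p\<in>cstar_seminorms (mor \<Lambda>). (\<forall>g\<in>R. p g = 0) \<longrightarrow> p f \<le> K"
  by (intro exI ballI impI) (rule ck_seminorm.p_bounded[OF ck_seminormI assms])

text \<open>With the bounds in place, the universal seminorm is a C*-seminorm killing the relators,
  so the whole calculus of \<open>ck_seminorm\<close> applies to it.\<close>

sublocale U: ck_seminorm P \<Lambda> u c
proof (rule ck_seminormI)
  show "u \<in> cstar_seminorms (mor \<Lambda>)"
    by (rule universal_seminorm_cstar) (rule seminorms_bounded)
  show "\<forall>g\<in>R. u g = 0"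
    by (intro ballI universal_seminorm_vanishes seminorms_bounded)
qed

sublocale F: seminormed_star_algebra F
proof -
  \<comment> \<open>Overwriting the norm by itself changes nothing, which brings the statement for
    arbitrary seminorms to \<open>F\<close>.\<close>
  have "F\<lparr>nrm := u\<rparr> = F" by (simp add: free_star_algebra_def)
  with seminormed_free_star_algebra[OF U.seminorm, of R] show "seminormed_star_algebra F"
    by (simp only:)
qed

lemma pgraph_cstar_eq: "pgraph_cstar P \<Lambda> c = completion F"
  by (simp add: pgraph_cstar_def universal_cstar_def)

sublocale A: cstar_algebra "completion F"
  by (rule F.cstar_algebra_completion)

section \<open>The canonical map of the free algebra into the completion\<close>

definition inc :: "'e free_elt \<Rightarrow> (nat \<Rightarrow> 'e free_elt) set"
  where "inc f = seq_class F (\<lambda>n. f)"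

lemma pgraph_gen_eq: "pgraph_gen P \<Lambda> c \<eta> = inc (free_gen \<eta>)"
  by (simp add: pgraph_gen_def universal_gen_def inc_def)

lemma inc_closed [simp]: "f \<in> free_carrier (mor \<Lambda>) \<Longrightarrow> inc f \<in> carrier (completion F)"
  by (simp add: inc_def)

lemma inc_ops:
  assumes "f \<in> free_carrier (mor \<Lambda>)"
  shows "z \<odot>\<^bsub>completion F\<^esub> inc f = inc (free_smult z f)"
    and "adj (completion F) (inc f) = inc (free_star f)"
    and "g \<in> free_carrier (mor \<Lambda>) \<Longrightarrow> inc f \<oplus>\<^bsub>completion F\<^esub> inc g = inc (f + g)"
    and "g \<in> free_carrier (mor \<Lambda>) \<Longrightarrow> inc f \<otimes>\<^bsub>completion F\<^esub> inc g = inc (f * g)"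
  using assms
  by (simp_all add: inc_def F.completion_smult F.completion_adj F.completion_add F.completion_mult)

lemma inc_zero: "\<zero>\<^bsub>completion F\<^esub> = inc 0"
  by (simp add: inc_def F.completion_zero)

lemma inc_eqv: assumes "U.eqv f g" shows "inc f = inc g"
proof -
  note D = U.eqvD[OF assms]
  have "f \<ominus>\<^bsub>F\<^esub> g = f - g"
    using D(2) F.minus_eq_smult[of g] by (simp add: a_minus_def free.scale_minus_left)
  then show ?thesis unfolding inc_def using D by (intro F.seq_class_eqI) simp_all
qed

lemma inc_ck_span:
  assumes "f \<in> U.ck_span \<delta> i"
  shows "inc f \<in> lin_span (completion F) {inc (free_gen \<mu>) \<otimes>\<^bsub>completion F\<^esub> adj (completion F) (inc (free_gen \<nu>)) | \<mu> \<nu>.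
    \<mu> \<in> mor \<Lambda> \<and> \<nu> \<in> mor \<Lambda> \<and> \<delta> \<mu> - \<delta> \<nu> = i}" (is "_ \<in> lin_span _ ?S")
  using assms
proof (induction rule: U.ck_span.induct)
  case zero
  show ?case unfolding inc_zero[symmetric] by (rule lin_span.zero)
next
  case (base \<mu> \<nu>)
  then have "inc (free_gen \<mu> * free_star (free_gen \<nu>))
      = inc (free_gen \<mu>) \<otimes>\<^bsub>completion F\<^esub> adj (completion F) (inc (free_gen \<nu>))"
    by (simp add: inc_ops)
  then show ?case using base by (intro lin_span.base) blast
next
  case (add f g)
  then show ?case using lin_span.add[OF add.IH] by (simp add: inc_ops U.ck_span_closed)
next
  case (smult f z)
  then show ?case using lin_span.smult[OF smult.IH, of z] by (simp add: inc_ops U.ck_span_closed)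
next
  case (eqv f g)
  then show ?case using inc_eqv[OF eqv.hyps(2)] by simp
qed

lemma inc_dense:
  assumes a: "a \<in> carrier (completion F)" and e: "0 < e"
  obtains f where "f \<in> free_carrier (mor \<Lambda>)" "nrm (completion F) (a \<ominus>\<^bsub>completion F\<^esub> inc f) < e"
proof -
  obtain x where x: "x \<in> cauchy_seqs F" "a = seq_class F x" using a by (rule F.completion_cases)
  have "\<forall>\<^sub>F k in sequentially. nrm (completion F) (a \<ominus>\<^bsub>completion F\<^esub> inc (x k)) < e"
    unfolding x(2) inc_def by (rule order_tendstoD(2)[OF F.const_seq_class_tendsto[OF x(1)] e])
  then obtain k where "nrm (completion F) (a \<ominus>\<^bsub>completion F\<^esub> inc (x k)) < e"
    by (auto simp: eventually_sequentially)
  then show thesis using that F.cauchy_closed[OF x(1), of k] by simp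
qed

theorem grading:
  assumes \<delta>: "Z2_functor \<Lambda> \<delta>"
  obtains \<alpha> where "grading_automorphism (completion F) \<alpha>"
    and "\<And>\<eta>. \<eta> \<in> mor \<Lambda> \<Longrightarrow> \<alpha> (inc (free_gen \<eta>)) = sign (\<delta> \<eta>) \<odot>\<^bsub>completion F\<^esub> inc (free_gen \<eta>)"
    and "\<And>i. graded_part (completion F) \<alpha> i =
      closed_span (completion F) {inc (free_gen \<mu>) \<otimes>\<^bsub>completion F\<^esub> adj (completion F) (inc (free_gen \<nu>)) | \<mu> \<nu>.
        \<mu> \<in> mor \<Lambda> \<and> \<nu> \<in> mor \<Lambda> \<and> \<delta> \<mu> - \<delta> \<nu> = i}"
proof -
  have twist: "u (free_twist \<delta> f) = u f" if "f \<in> free_carrier (mor \<Lambda>)" for f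
    by (rule universal_seminorm_twist[OF _ ck_relators_closed _ that])
      (rule seminorms_bounded ck_relators_homogeneous[OF \<delta>]; assumption)+
  obtain \<alpha> where \<alpha>: "grading_automorphism (completion F) \<alpha>"
    and cls: "\<And>x. x \<in> cauchy_seqs F \<Longrightarrow> \<alpha> (seq_class F x) = seq_class F (\<lambda>n. free_twist \<delta> (x n))"
    and isometric: "\<And>a. a \<in> carrier (completion F) \<Longrightarrow> nrm (completion F) (\<alpha> a) = nrm (completion F) a"
    by (rule F.grading_automorphism_completion[of "free_twist \<delta>"])
      (rule that, assumption+ |
        simp add: free_twist_add free_twist_smult free_twist_mult free_twist_star twist)+
  interpret \<alpha>: grading_automorphism "completion F" \<alpha> by (rule \<alpha>)
  let ?B = "completion F"
  have inc: "\<alpha> (inc f) = inc (free_twist \<delta> f)" if "f \<in> free_carrier (mor \<Lambda>)" for f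
    unfolding inc_def using that by (simp add: cls)
  have closed: "\<alpha> a \<in> carrier ?B" if "a \<in> carrier ?B" for a
    using bij_betwE[OF \<alpha>.bij] that by blast
  have diff: "nrm ?B (\<alpha> a \<ominus>\<^bsub>?B\<^esub> \<alpha> b) = nrm ?B (a \<ominus>\<^bsub>?B\<^esub> b)"
    if "a \<in> carrier ?B" "b \<in> carrier ?B" for a b
  proof -
    have "\<alpha> (a \<ominus>\<^bsub>?B\<^esub> b) = \<alpha> a \<ominus>\<^bsub>?B\<^esub> \<alpha> b"
      using that by (simp add: a_minus_def A.minus_eq_smult \<alpha>.map_add \<alpha>.map_smult closed)
    then show ?thesis using isometric[of "a \<ominus>\<^bsub>?B\<^esub> b"] that by simp
  qed
  have gen: "\<alpha> (inc (free_gen \<eta>)) = sign (\<delta> \<eta>) \<odot>\<^bsub>?B\<^esub> inc (free_gen \<eta>)" if "\<eta> \<in> mor \<Lambda>" for \<eta>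
    using that by (simp add: inc free_twist_gen inc_ops)
  \<comment> \<open>Writes both graded parts as one eigenvalue equation, so that
    \<open>i = 0\<close> and \<open>i = 1\<close> need no separate treatment.\<close>
  have part: "graded_part ?B \<alpha> i = {a \<in> carrier ?B. \<alpha> a = sign i \<odot>\<^bsub>?B\<^esub> a}" for i
  proof -
    have "sign i \<odot>\<^bsub>?B\<^esub> a = (if i = 0 then a else \<ominus>\<^bsub>?B\<^esub> a)" if "a \<in> carrier ?B" for a
      using that by (simp add: sign_def A.smult_one A.minus_eq_smult)
    then show ?thesis unfolding graded_part_def by (intro Collect_cong) auto
  qed
  have "graded_part ?B \<alpha> i = closed_span ?B {inc (free_gen \<mu>) \<otimes>\<^bsub>?B\<^esub> adj ?B (inc (free_gen \<nu>)) | \<mu> \<nu>.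
        \<mu> \<in> mor \<Lambda> \<and> \<nu> \<in> mor \<Lambda> \<and> \<delta> \<mu> - \<delta> \<nu> = i}" (is "_ = closed_span _ ?S") for i
  proof (intro equalityI subsetI)
    fix a assume "a \<in> graded_part ?B \<alpha> i"
    then have a: "a \<in> carrier ?B" "\<alpha> a = sign i \<odot>\<^bsub>?B\<^esub> a" by (auto simp: part)
    have "\<exists>b\<in>lin_span ?B ?S. nrm ?B (a \<ominus>\<^bsub>?B\<^esub> b) < e" if e: "0 < e" for e
    proof -
      obtain f where f: "f \<in> free_carrier (mor \<Lambda>)" "nrm ?B (a \<ominus>\<^bsub>?B\<^esub> inc f) < e"
        using inc_dense[OF a(1) e] by blast
      \<comment> \<open>The component of degree \<open>i\<close> of the approximant
        \<open>f\<close>. Its coefficient at a word \<open>w\<close> is that of \<open>f\<close>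
        times (1 + \<open>sign i * sign (word_deg \<delta> w)\<close>) / 2, which vanishes unless
        the degrees agree.\<close>
      define g where "g = free_smult (1 / 2) (f + free_smult (sign i) (free_twist \<delta> f))"
      have g: "g \<in> free_carrier (mor \<Lambda>)" using f by (simp add: g_def)
      have "g \<in> U.ck_span \<delta> i"
      proof (rule U.homogeneous_in_ck_span[OF \<delta> g])
        fix w assume "w \<in> Poly_Mapping.keys g"
        then have "sign i * sign (word_deg \<delta> w) \<noteq> - 1"
          by (auto simp: g_def in_keys_iff lookup_add mult.assoc[symmetric])
        then show "word_deg \<delta> w = i" by (cases i; cases "word_deg \<delta> w") (simp_all add: sign_def)
      qed
      then have "inc g \<in> lin_span ?B ?S" by (rule inc_ck_span)
      moreover have "nrm ?B (a \<ominus>\<^bsub>?B\<^esub> inc g) < e"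
      proof -
        \<comment> \<open>The averaging operator on the completion. It does not increase distances
          because \<alpha> is isometric, it fixes \<open>a\<close>, and it sends
          \<open>inc f\<close> to \<open>inc g\<close>; hence \<open>inc g\<close> is as close to
          \<open>a\<close> as \<open>inc f\<close> is.\<close>
        let ?E = "\<lambda>x. (1 / 2) \<odot>\<^bsub>?B\<^esub> (x \<oplus>\<^bsub>?B\<^esub> sign i \<odot>\<^bsub>?B\<^esub> \<alpha> x)"
        have "sign i \<odot>\<^bsub>?B\<^esub> \<alpha> a = a" using a by (simp add: A.smult_assoc[symmetric] A.smult_one)
        then have "?E a = (1 / 2) \<odot>\<^bsub>?B\<^esub> ((1 + 1) \<odot>\<^bsub>?B\<^esub> a)"
          using a by (simp only: A.smult_l_distr A.smult_one)
        then have Ea: "?E a = a" using a by (simp add: A.smult_assoc[symmetric] A.smult_one)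
        have Eg: "?E (inc f) = inc g" using f by (simp add: inc inc_ops g_def)
        have "nrm ?B (?E a \<ominus>\<^bsub>?B\<^esub> ?E (inc f))
            = 1 / 2 * nrm ?B ((a \<oplus>\<^bsub>?B\<^esub> sign i \<odot>\<^bsub>?B\<^esub> \<alpha> a) \<ominus>\<^bsub>?B\<^esub> (inc f \<oplus>\<^bsub>?B\<^esub> sign i \<odot>\<^bsub>?B\<^esub> \<alpha> (inc f)))"
          using a f closed by (subst A.nrm_dist_smult) auto
        also have "\<dots> \<le> 1 / 2 * (nrm ?B (a \<ominus>\<^bsub>?B\<^esub> inc f)
            + nrm ?B (sign i \<odot>\<^bsub>?B\<^esub> \<alpha> a \<ominus>\<^bsub>?B\<^esub> sign i \<odot>\<^bsub>?B\<^esub> \<alpha> (inc f)))"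
          using a f closed by (intro mult_left_mono A.nrm_dist_add) auto
        also have "\<dots> = nrm ?B (a \<ominus>\<^bsub>?B\<^esub> inc f)"
          using a(1) f closed by (subst A.nrm_dist_smult) (auto simp: diff)
        finally show ?thesis using f unfolding Ea Eg by simp
      qed
      ultimately show ?thesis by blast
    qed
    then show "a \<in> closed_span ?B ?S" using a by (simp add: closed_span_def)
  next
    fix a assume "a \<in> closed_span ?B ?S"
    then have a: "a \<in> carrier ?B"
      and approx: "\<And>e. 0 < e \<Longrightarrow> \<exists>b\<in>lin_span ?B ?S. nrm ?B (a \<ominus>\<^bsub>?B\<^esub> b) < e"
      by (auto simp: closed_span_def)
    \<comment> \<open>For the reverse inclusion, the eigenvalue equation is linear and holds on the
      products, hence on their span; isometry of \<alpha> then extends it to limits.\<close>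
    have span: "b \<in> carrier ?B \<and> \<alpha> b = sign i \<odot>\<^bsub>?B\<^esub> b" if "b \<in> lin_span ?B ?S" for b
      using that
    proof (induction rule: lin_span.induct)
      case zero
      show ?case unfolding inc_zero by (simp add: inc inc_ops)
    next
      case (base b)
      then obtain \<mu> \<nu> where \<mu>\<nu>: "\<mu> \<in> mor \<Lambda>" "\<nu> \<in> mor \<Lambda>" "\<delta> \<mu> - \<delta> \<nu> = i"
        and b: "b = inc (free_gen \<mu>) \<otimes>\<^bsub>?B\<^esub> adj ?B (inc (free_gen \<nu>))" by blast
      have "sign i = sign (\<delta> \<mu>) * sign (\<delta> \<nu>)"
        unfolding \<mu>\<nu>(3)[symmetric] by (cases "\<delta> \<mu>"; cases "\<delta> \<nu>") (simp_all add: sign_def)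
      then show ?case using \<mu>\<nu>(1,2)
        by (simp add: b inc inc_ops free_twist_mult free_twist_star free_twist_gen free_star_smult
            free_smult_mult_left free_smult_mult_right mult.commute)
    next
      case (add b b')
      then show ?case by (simp add: \<alpha>.map_add A.smult_r_distr)
    next
      case (smult b z)
      then show ?case by (simp add: \<alpha>.map_smult A.smult_assoc[symmetric] mult.commute)
    qed
    have "nrm ?B (\<alpha> a \<ominus>\<^bsub>?B\<^esub> sign i \<odot>\<^bsub>?B\<^esub> a) \<le> 0 + e" if "0 < e" for e
    proof -
      \<comment> \<open>The distance from \<open>a\<close> to \<open>b\<close> is paid twice, once
        under \<alpha> and once under the scalar \<open>sign i\<close>.\<close>
      obtain b where b: "b \<in> lin_span ?B ?S" "nrm ?B (a \<ominus>\<^bsub>?B\<^esub> b) < e / 2"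
        using approx[of "e / 2"] \<open>0 < e\<close> by auto
      note bs = span[OF b(1)]
      have "nrm ?B (\<alpha> a \<ominus>\<^bsub>?B\<^esub> sign i \<odot>\<^bsub>?B\<^esub> a)
          \<le> nrm ?B (\<alpha> a \<ominus>\<^bsub>?B\<^esub> \<alpha> b) + nrm ?B (sign i \<odot>\<^bsub>?B\<^esub> b \<ominus>\<^bsub>?B\<^esub> sign i \<odot>\<^bsub>?B\<^esub> a)"
        using A.nrm_dist_triangle[of "\<alpha> a" "sign i \<odot>\<^bsub>?B\<^esub> a" "\<alpha> b"] a bs closed by auto
      also have "\<dots> = nrm ?B (a \<ominus>\<^bsub>?B\<^esub> b) + nrm ?B (b \<ominus>\<^bsub>?B\<^esub> a)"
        using diff[OF a, of b] A.nrm_dist_smult[of b a "sign i"] a bs by auto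
      also have "nrm ?B (b \<ominus>\<^bsub>?B\<^esub> a) = nrm ?B (a \<ominus>\<^bsub>?B\<^esub> b)"
        using a bs by (intro A.nrm_minus_commute) auto
      finally show ?thesis using b(2) by simp
    qed
    then have "nrm ?B (\<alpha> a \<ominus>\<^bsub>?B\<^esub> sign i \<odot>\<^bsub>?B\<^esub> a) \<le> 0" by (rule field_le_epsilon)
    moreover have d: "\<alpha> a \<ominus>\<^bsub>?B\<^esub> sign i \<odot>\<^bsub>?B\<^esub> a \<in> carrier ?B" using a closed by simp
    ultimately have "nrm ?B (\<alpha> a \<ominus>\<^bsub>?B\<^esub> sign i \<odot>\<^bsub>?B\<^esub> a) = 0" using A.nrm_nonneg[OF d] by linarith
    then have "\<alpha> a \<ominus>\<^bsub>?B\<^esub> sign i \<odot>\<^bsub>?B\<^esub> a = \<zero>\<^bsub>?B\<^esub>" using A.nrm_eq_0[OF d] by simp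
    then have "\<alpha> a = sign i \<odot>\<^bsub>?B\<^esub> a"
      using A.diff_add_cancel[of "\<alpha> a" "sign i \<odot>\<^bsub>?B\<^esub> a"] a closed by simp
    then show "a \<in> graded_part ?B \<alpha> i" using a by (simp add: part)
  qed
  with \<alpha> gen show thesis by (rule that)
qed

end

theorem lemma6p1:
  fixes P :: "'p monoid"
    and \<Lambda> :: "('e, 'p) pgraph"
    and \<delta> :: "'e \<Rightarrow> bit"
    and c :: "'e \<Rightarrow> 'e \<Rightarrow> complex"
    and k l :: nat
  assumes "P \<cong> NZ2_monoid k l"
    and "P_graph P \<Lambda>"
    and "row_finite P \<Lambda>"
    and "no_sources P \<Lambda>"
    and "Z2_functor \<Lambda> \<delta>"
    and "cocycle \<Lambda> c"
  defines "A \<equiv> pgraph_cstar P \<Lambda> c"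
    and "s \<equiv> pgraph_gen P \<Lambda> c"
  shows "\<exists>\<alpha>. grading_automorphism A \<alpha> \<and>
      (\<forall>\<eta>\<in>mor \<Lambda>. \<alpha> (s \<eta>) = sign (\<delta> \<eta>) \<odot>\<^bsub>A\<^esub> s \<eta>) \<and>
      (\<forall>i::bit. graded_part A \<alpha> i =
         closed_span A {s \<mu> \<otimes>\<^bsub>A\<^esub> adj A (s \<nu>) | \<mu> \<nu>.
           \<mu> \<in> mor \<Lambda> \<and> \<nu> \<in> mor \<Lambda> \<and> \<delta> \<mu> - \<delta> \<nu> = i})"
proof -
  interpret P_graph P \<Lambda> by fact
  have "row_finite_cocycle P \<Lambda> c"
    by unfold_locales (use assms NZ2_iso_commutative[OF assms(1) monoid_axioms] in auto)
  then interpret row_finite_cocycle P \<Lambda> c .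
  show ?thesis
    unfolding A_def s_def pgraph_cstar_eq pgraph_gen_eq by (rule grading[OF assms(5)]) blast
qed

end
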